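(* The posets $P_{K_t}$ ($t\ge 2$) satisfy $e(P_{K_t})=1$, and \[ \pi^-(P_{K_t})\ \ge\ 2-\frac1t-o\!\left(\frac1t\right)\qquad (t\to\infty). \] In particular $\pi^-(P_{K_t})\to 2$ as $t\to\infty$; hence there is no constant $c<2$ such that $\pi^+(P)\le c$ for all finite posets $P$ with $e(P)=1$.
   Context: For a simple graph $G=(V,E)$, the vertex-edge incidence poset is $P_G=(V\cup E,<)$, where the only strict relations are $v<e$ for $v\in V$, $e\in E$ with $v\in e$. $K_t$ is the complete graph on $t$ vertices. A family $\mathcal G$ of sets is a weak copy of a finite poset $(P,\leqslant)$ if there is a bijection $\psi:P\to\mathcal G$ such that $\psi(p)\subseteq\psi(p')$ whenever $p\leqslant p'$. A family $\mathcal F$ is (weak) $P$-free if no subfamily of it is a weak copy of $P$. $\mathrm{La}(n,P)$ is the maximum size of a weak $P$-free family $\mathcal F\subseteq 2^{[n]}$, $\pi^-(P)=\liminf_{n\to\infty}\mathrm{La}(n,P)/\binom{n}{\lfloor n/2\rfloor}$ and $\pi^+(P)=\limsup_{n\to\infty}\mathrm{La}(n,P)/\binom{n}{\lfloor n/2\rfloor}$. $e(P)$ is the maximum integer $k$ such that, for every $n$, the union of any $k$ consecutive layers of $2^{[n]}$ is weak $P$-free; a layer of $2^{[n]}$ is $\binom{[n]}{s}=\{Y\subseteq[n]:|Y|=s\}$. *)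

theory Defs
  imports "HOL-Library.Extended_Real" "HOL-Library.Landau_Symbols"
begin

text \<open>A poset is represented by its carrier together with its (reflexive) order relation.\<close>

type_synonym 'a poset = "'a set \<times> ('a \<times> 'a) set"

text \<open>The empty poset is excluded: every family contains a copy of it, so \<open>La\<close> and
  \<open>e_poset\<close> would be maxima over an empty set.\<close>

definition finite_poset :: "'a poset \<Rightarrow> bool" where
  "finite_poset P \<longleftrightarrow>
     finite (fst P) \<and> fst P \<noteq> {} \<and> snd P \<subseteq> fst P \<times> fst P \<and> partial_order_on (fst P) (snd P)"

definition weak_copy :: "'a poset \<Rightarrow> 'b set set \<Rightarrow> bool" where
  "weak_copy P \<G> \<longleftrightarrow>
     (\<exists>\<psi>. bij_betw \<psi> (fst P) \<G> \<and>
        (\<forall>p \<in> fst P. \<forall>q \<in> fst P. (p, q) \<in> snd P \<longrightarrow> \<psi> p \<subseteq> \<psi> q))"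

definition weak_free :: "'a poset \<Rightarrow> 'b set set \<Rightarrow> bool" where
  "weak_free P \<F> \<longleftrightarrow> \<not> (\<exists>\<G> \<subseteq> \<F>. weak_copy P \<G>)"

definition La :: "nat \<Rightarrow> 'a poset \<Rightarrow> nat" where
  "La n P = Max {card \<F> | \<F>. \<F> \<subseteq> Pow {1..n} \<and> weak_free P \<F>}"

text \<open>The densities are taken in the extended reals, where lower and upper limits always exist.\<close>

definition pi_lower :: "'a poset \<Rightarrow> ereal" where
  "pi_lower P = liminf (\<lambda>n. ereal (real (La n P) / real (n choose (n div 2))))"

definition pi_upper :: "'a poset \<Rightarrow> ereal" where
  "pi_upper P = limsup (\<lambda>n. ereal (real (La n P) / real (n choose (n div 2))))"

definition layer :: "nat \<Rightarrow> nat \<Rightarrow> nat set set" where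
  "layer n s = {Y. Y \<subseteq> {1..n} \<and> card Y = s}"

text \<open>The layers of the cube on \<open>{1..n}\<close> are those of index \<open>0, \<dots>, n\<close>;
  the bound \<open>s + k \<le> n + 1\<close> says that all of \<open>s, \<dots>, s + k - 1\<close> are such indices.\<close>

definition layers_free :: "'a poset \<Rightarrow> nat \<Rightarrow> bool" where
  "layers_free P k \<longleftrightarrow>
     (\<forall>n s. s + k \<le> n + 1 \<longrightarrow> weak_free P (\<Union>i \<in> {s..<s + k}. layer n i))"

definition e_poset :: "'a poset \<Rightarrow> nat" where
  "e_poset P = (GREATEST k. layers_free P k)"

definition incidence_poset :: "'v set \<Rightarrow> 'v set set \<Rightarrow> ('v + 'v set) poset" where
  "incidence_poset V E =
     (V <+> E, Id_on (V <+> E) \<union> {(Inl v, Inr e) | v e. v \<in> V \<and> e \<in> E \<and> v \<in> e})"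

definition complete_edges :: "'v set \<Rightarrow> 'v set set" where
  "complete_edges V = {e. e \<subseteq> V \<and> card e = 2}"

definition P_K :: "nat \<Rightarrow> (nat + nat set) poset" where
  "P_K t = incidence_poset {1..t} (complete_edges {1..t})"

lemma finite_poset_incidence_poset:
  assumes "finite V" "V \<noteq> {}" "finite E"
  shows "finite_poset (incidence_poset V E)"
  using assms
  by (auto simp: finite_poset_def incidence_poset_def partial_order_on_def preorder_on_def
      intro!: refl_onI transI antisymI)

end

theory Submission
  imports Defs
    "HOL-Number_Theory.Prime_Powers"
    "HOL-Computational_Algebra.Squarefree"
    "HOL-Analysis.Harmonic_Numbers"
    "HOL-Combinatorics.Multiset_Permutations"
    "HOL-Real_Asymp.Real_Asymp"
begin

text \<open>For the lower bound let \<open>p\<close> be a prime with \<open>p + 2 \<le> t\<close> and \<open>d = n div 2\<close>. Attach random vectors of the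
  \<open>d\<close>-dimensional space over the field with \<open>p\<close> elements to the points of \<open>{1..n}\<close>, and take the whole layer
  \<open>d - 1\<close> and those sets of layer \<open>d\<close> whose vectors are independent; by a union bound these are at least a
  proportion \<open>1 - 1 / (p - 1)\<close> of the layer. A copy of the poset would give \<open>t\<close> pairwise non-proportional
  vectors in a quotient of dimension two, which has only \<open>p + 1\<close> lines.

  For this to give \<open>2 - 1 / t - o (1 / t)\<close> for every \<open>t\<close> one needs primes \<open>p\<close> with \<open>p / t \<longrightarrow> 1\<close>. Their existence
  follows from Selberg's formula by an argument in the spirit of Erdos: if an interval \<open>(x, e\<^sup>a x]\<close> has almost no
  primes, then for almost all primes \<open>q\<close> the interval \<open>(x / q, e\<^sup>a x / q]\<close> has twice the expected number of
  primes. If all intervals of logarithmic length \<open>b < 2 a\<close> contain a positive proportion of primes, then these dense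
  intervals cover more than half of the logarithmic line, contradicting Mertens' estimate. So \<open>b\<close> can be
  replaced by \<open>3 b / 4\<close>, and hence be made arbitrarily small.

  For the upper bound, a family without a copy has no member with many members of the family both below and above it,
  so it splits into a part with few members below and a part with few members above each of its sets. By counting
  along random maximal chains either part is asymptotically at most as large as an antichain.\<close>

section \<open>Selberg's formula\<close>

text \<open>The loss 1 / (p - 1) comes from fewer than p^d / (p - 1) coefficient vectors up to
  scaling, each of which vanishes on a random labelling with probability p^(-d). Measured against 1
  / t the error is (t / (p - 1) - 1) / t. Bertrand's postulate would only give a loss of about 2 /
  t, so primes at distance o(t) below t are what the construction requires. The interval argument
  gives n the weight Lambda(n) / n at the point ln n, because Mertens' estimate has bounded error
  there and any fixed surplus of density over a long stretch is contradictory. Dropping the pair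
  term from Selberg's formula bounds the density by 2. On a sparse interval it is the prime term
  that drops out, and the pair term must attain this bound on average. The ratio 3 / 4 lies strictly
  between 1 / 2 and 1: density 2 on a proportion 3 / 4 of the line gives 3 / 2, which exceeds 1 with
  a margin for exceptions.\<close>

definition nats_le :: "real \<Rightarrow> nat set" where
  "nats_le x = {n. 0 < n \<and> real n \<le> x}"

lemma nats_le_altdef: "nats_le x = {1..nat \<lfloor>x\<rfloor>}"
  unfolding nats_le_def by (auto simp: le_nat_floor le_floor_iff nat_le_iff) linarith+

lemma finite_nats_le [simp]: "finite (nats_le x)"
  by (simp add: nats_le_altdef)

lemma nats_le_pos: "n \<in> nats_le x \<Longrightarrow> 0 < n"
  by (simp add: nats_le_def)

lemma nats_le_empty: "x < 1 \<Longrightarrow> nats_le x = {}"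
  by (auto simp: nats_le_def)

lemma nats_le_mono: "x \<le> y \<Longrightarrow> nats_le x \<subseteq> nats_le y"
  by (auto simp: nats_le_def)

text \<open>Both sides run over the pairs with \<open>d * m\<close> at most \<open>x\<close>; the
  right one groups them by the product, as for the summatory function of a Dirichlet
  convolution.\<close>

lemma sum_nats_le_divisors:
  fixes g :: "nat \<Rightarrow> nat \<Rightarrow> real"
  shows "(\<Sum>d\<in>nats_le x. \<Sum>m\<in>nats_le (x / real d). g d m) =
         (\<Sum>n\<in>nats_le x. \<Sum>d | d dvd n. g d (n div d))"
proof -
  have "(\<Sum>d\<in>nats_le x. \<Sum>m\<in>nats_le (x / real d). g d m) =
        (\<Sum>(d,m)\<in>(SIGMA d:nats_le x. nats_le (x / real d)). g d m)"
    by (rule sum.Sigma) auto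
  also have "\<dots> = (\<Sum>(n,d)\<in>(SIGMA n:nats_le x. {d. d dvd n}). g d (n div d))"
  proof (rule sum.reindex_bij_witness[of _ "\<lambda>(n,d). (d, n div d)" "\<lambda>(d,m). (d * m, d)"])
    fix a assume "a \<in> (SIGMA n:nats_le x. {d. d dvd n})"
    then obtain n d where a: "a = (n, d)" "n > 0" "real n \<le> x" "d dvd n"
      by (auto simp: nats_le_def)
    then obtain k where k: "n = d * k" by blast
    have "d > 0" "k > 0" using a k by (auto intro: Nat.gr0I)
    have "real d * 1 \<le> real d * real k" using \<open>k > 0\<close> by (intro mult_left_mono) auto
    also have "\<dots> \<le> x" using a k by simp
    finally have "real d \<le> x" by simp
    moreover have "real k \<le> x / real d" using a k \<open>d > 0\<close>
      by (auto simp: field_simps)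
    ultimately show "(case a of (n, d) \<Rightarrow> (d, n div d)) \<in> (SIGMA d:nats_le x. nats_le (x / real d))"
      using a k \<open>d > 0\<close> \<open>k > 0\<close> by (auto simp: nats_le_def)
  qed (auto simp: nats_le_def field_simps)
  also have "\<dots> = (\<Sum>n\<in>nats_le x. \<Sum>d | d dvd n. g d (n div d))"
    by (rule sum.Sigma [symmetric]) (auto dest: nats_le_pos)
  finally show ?thesis .
qed

section \<open>The Moebius function and an inversion formula with a logarithmic weight\<close>

definition moebius :: "nat \<Rightarrow> real" where
  "moebius n = (if squarefree n then (- 1) ^ card (prime_factors n) else 0)"

lemma abs_moebius_le: "\<bar>moebius n\<bar> \<le> 1"
  by (simp add: moebius_def)

lemma moebius_prime_mult:
  assumes "prime p" "\<not> p dvd d" "d > 0"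
  shows "moebius (p * d) = - moebius d"
proof -
  have cop: "coprime p d" using assms prime_imp_coprime by blast
  have "squarefree (p * d) \<longleftrightarrow> squarefree d"
    using cop assms(1) squarefree_mult_coprime[OF cop] squarefree_multD(2)[of p d] squarefree_prime by blast
  moreover have "prime_factors (p * d) = insert p (prime_factors d)"
    using assms by (simp add: prime_factors_product prime_prime_factors)
  moreover have "p \<notin> prime_factors d" using assms by auto
  ultimately show ?thesis by (simp add: moebius_def)
qed

text \<open>For a prime \<open>p\<close> dividing \<open>n\<close>, each divisor \<open>d\<close>
  prime to \<open>p\<close> cancels against \<open>p * d\<close>; the remaining divisors are
  multiples of \<open>p ^ 2\<close>, where \<open>moebius\<close> vanishes.\<close>

lemma sum_moebius_divisors:
  assumes "n > 1"
  shows "(\<Sum>d | d dvd n. moebius d) = 0"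
proof -
  obtain p where p: "prime p" "p dvd n" using assms prime_factor_nat[of n] by auto
  have fin: "finite {d. d dvd n}" using assms by simp
  let ?A = "{d. d dvd n \<and> \<not> p dvd d}"
  let ?B = "{d. d dvd n \<and> p dvd d}"
  have "(\<Sum>d | d dvd n. moebius d) = sum moebius ?A + sum moebius ?B"
    by (subst sum.union_disjoint [symmetric]) (auto intro!: sum.cong intro: finite_subset[OF _ fin])
  also have "sum moebius ?B = (\<Sum>d\<in>((*) p) ` ?A. moebius d)"
  proof (rule sum.mono_neutral_right)
    show "finite ?B" by (rule finite_subset[OF _ fin]) auto
    show "((*) p) ` ?A \<subseteq> ?B"
      using p by (auto intro: divides_mult prime_imp_coprime)
    show "\<forall>i\<in>?B - ((*) p) ` ?A. moebius i = 0"
    proof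
      fix i assume i: "i \<in> ?B - ((*) p) ` ?A"
      then obtain k where k: "i = p * k" by blast
      have "k dvd n" using i k by (auto dest: dvd_mult_right)
      then have "p dvd k" using i k by blast
      then have "p ^ 2 dvd i" using k by (simp add: power2_eq_square)
      then have "\<not> squarefree i" using p(1) by (auto simp: squarefree_def dest: not_prime_unit)
      then show "moebius i = 0" by (simp add: moebius_def)
    qed
  qed
  also have "\<dots> = (\<Sum>d\<in>?A. moebius (p * d))"
    by (rule sum.reindex_cong[of "(*) p"]) (use p in \<open>auto simp: inj_on_def\<close>)
  also have "\<dots> = (\<Sum>d\<in>?A. - moebius d)"
    using p(1) assms by (intro sum.cong refl moebius_prime_mult) (auto intro: Nat.gr0I)
  finally show ?thesis by (simp add: sum_negf)
qed

text \<open>Expand \<open>ln (n div d)\<close> as the sum of \<open>mangoldt e\<close> over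
  \<open>e dvd n div d\<close> and exchange the sums: the inner Moebius sum over the divisors of
  \<open>n div e\<close> vanishes unless \<open>e = n\<close>.\<close>

lemma sum_moebius_times_ln:
  assumes "n > 0"
  shows "(\<Sum>d | d dvd n. moebius d * ln (real (n div d))) = mangoldt n"
proof -
  have fin: "finite {d. d dvd n}" using assms by simp
  have dvd: "d dvd n \<and> e dvd n div d \<longleftrightarrow> d * e dvd n" for d e
  proof (cases "d dvd n")
    case True
    then have "d \<noteq> 0" using assms by auto
    then show ?thesis using True by (simp add: dvd_div_iff_mult mult.commute)
  next
    case False
    then show ?thesis using dvd_mult_left by blast
  qed
  have pairs: "(SIGMA d:{d. d dvd n}. {e. e dvd n div d}) = {p. fst p * snd p dvd n}"
    using dvd by (simp add: set_eq_iff split_paired_all mem_Sigma_iff)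
  have "(\<Sum>d | d dvd n. moebius d * ln (real (n div d))) =
        (\<Sum>d | d dvd n. \<Sum>e | e dvd n div d. moebius d * mangoldt e)"
  proof (intro sum.cong refl)
    fix d assume "d \<in> {d. d dvd n}"
    then have "n div d \<noteq> 0" using assms by (auto simp: dvd_div_eq_0_iff)
    then show "moebius d * ln (real (n div d)) = (\<Sum>e | e dvd n div d. moebius d * mangoldt e)"
      using mangoldt_sum[of "n div d", where ?'a = real] by (simp add: sum_distrib_left [symmetric])
  qed
  also have "\<dots> = (\<Sum>(d,e)\<in>(SIGMA d:{d. d dvd n}. {e. e dvd n div d}). moebius d * mangoldt e)"
    using assms by (intro sum.Sigma) (auto simp: dvd_div_eq_0_iff)
  also have "\<dots> = (\<Sum>(e,d)\<in>(SIGMA e:{e. e dvd n}. {d. d dvd n div e}). moebius d * mangoldt e)"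
    unfolding pairs
    by (rule sum.reindex_bij_witness[of _ "\<lambda>(e,d). (d,e)" "\<lambda>(d,e). (e,d)"])
      (auto simp: mult.commute)
  also have "\<dots> = (\<Sum>e | e dvd n. mangoldt e * (\<Sum>d | d dvd n div e. moebius d))"
    using assms by (subst sum.Sigma [symmetric]) (auto simp: dvd_div_eq_0_iff sum_distrib_left mult.commute)
  also have "\<dots> = (\<Sum>e\<in>{n}. mangoldt e * (\<Sum>d | d dvd n div e. moebius d))"
  proof (rule sum.mono_neutral_right[OF fin])
    show "\<forall>i\<in>{d. d dvd n} - {n}. mangoldt i * (\<Sum>d | d dvd n div i. moebius d) = 0"
    proof
      fix i assume "i \<in> {d. d dvd n} - {n}"
      then obtain k where k: "n = i * k" "i \<noteq> n" by auto
      with assms have "k \<noteq> 0" "k \<noteq> 1" "i > 0" by auto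
      with k have "n div i > 1" by simp
      then show "mangoldt i * (\<Sum>d | d dvd n div i. moebius d) = 0"
        by (simp add: sum_moebius_divisors)
    qed
  qed auto
  also have "\<dots> = mangoldt n" using assms by (simp add: moebius_def)
  finally show ?thesis .
qed

text \<open>The identity of Tatuzawa and Iseki.\<close>

lemma moebius_log_inversion:
  fixes F :: "real \<Rightarrow> real"
  assumes "x \<ge> 1"
  shows "(\<Sum>d\<in>nats_le x. moebius d * (ln (x / d) * (\<Sum>m\<in>nats_le (x / d). F (x / d / m)))) =
         ln x * F x + (\<Sum>n\<in>nats_le x. mangoldt n * F (x / n))"
proof -
  have x: "x > 0" "1 \<in> nats_le x" using assms by (auto simp: nats_le_def)
  have "(\<Sum>d\<in>nats_le x. moebius d * (ln (x / d) * (\<Sum>m\<in>nats_le (x / d). F (x / d / m)))) =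
     (\<Sum>d\<in>nats_le x. \<Sum>m\<in>nats_le (x / d). moebius d * ln (x / d) * F (x / real (d * m)))"
    by (simp add: sum_distrib_left mult_ac)
  also have "\<dots> = (\<Sum>n\<in>nats_le x. \<Sum>d | d dvd n. moebius d * ln (x / d) * F (x / real (d * (n div d))))"
    by (rule sum_nats_le_divisors)
  also have "\<dots> = (\<Sum>n\<in>nats_le x. (if n = 1 then ln x * F x else 0) + mangoldt n * F (x / n))"
  proof (intro sum.cong refl)
    fix n assume n: "n \<in> nats_le x"
    then have n0: "n > 0" by (simp add: nats_le_def)
    have "(\<Sum>d | d dvd n. moebius d * ln (x / d) * F (x / real (d * (n div d)))) =
      (\<Sum>d | d dvd n. (ln x - ln n) * F (x / n) * moebius d + F (x / n) * (moebius d * ln (real (n div d))))"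
    proof (intro sum.cong refl)
      fix d assume d: "d \<in> {d. d dvd n}"
      then have d0: "d > 0" using n0 by (auto intro: Nat.gr0I)
      \<comment> \<open>The part \<open>ln x - ln n\<close> is independent of \<open>d\<close>, so
        its Moebius sum survives only for \<open>n = 1\<close>; the part \<open>ln (n div d)\<close>
        produces \<open>mangoldt n\<close>.\<close>
      have eq: "ln (x / d) = ln x - ln n + ln (real (n div d))"
        using d d0 n0 x by (auto simp: ln_div real_of_nat_div)
      show "moebius d * ln (x / d) * F (x / real (d * (n div d))) =
        (ln x - ln n) * F (x / n) * moebius d + F (x / n) * (moebius d * ln (real (n div d)))"
        using d unfolding eq by (simp add: algebra_simps)
    qed
    also have "\<dots> = (ln x - ln n) * F (x / n) * (\<Sum>d | d dvd n. moebius d) + F (x / n) * mangoldt n"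
      by (simp add: sum.distrib sum_distrib_left [symmetric] sum_moebius_times_ln[OF n0])
    also have "\<dots> = (if n = 1 then ln x * F x else 0) + mangoldt n * F (x / n)"
      using n0 sum_moebius_divisors[of n] by (cases "n = 1") (auto simp: moebius_def)
    finally show "(\<Sum>d | d dvd n. moebius d * ln (x / d) * F (x / real (d * (n div d)))) =
      (if n = 1 then ln x * F x else 0) + mangoldt n * F (x / n)" .
  qed
  also have "\<dots> = ln x * F x + (\<Sum>n\<in>nats_le x. mangoldt n * F (x / n))"
    using x by (simp add: sum.distrib)
  finally show ?thesis .
qed

lemma sum_nats_le_swap:
  fixes f :: "nat \<Rightarrow> nat \<Rightarrow> real"
  shows "(\<Sum>d\<in>nats_le x. \<Sum>m\<in>nats_le (x / real d). f d m) =
         (\<Sum>m\<in>nats_le x. \<Sum>d\<in>nats_le (x / real m). f d m)"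
proof -
  have *: "real m \<le> x" if "real m \<le> x / real d" "d > 0" for m d :: nat
  proof -
    have "real m * 1 \<le> real m * real d" using that by (intro mult_left_mono) auto
    also have "\<dots> \<le> x" using that by (simp add: field_simps)
    finally show ?thesis by simp
  qed
  have "(\<Sum>d\<in>nats_le x. \<Sum>m\<in>nats_le (x / real d). f d m) =
        (\<Sum>(d,m)\<in>(SIGMA d:nats_le x. nats_le (x / real d)). f d m)"
    by (rule sum.Sigma) auto
  also have "\<dots> = (\<Sum>(m,d)\<in>(SIGMA m:nats_le x. nats_le (x / real m)). f d m)"
    by (rule sum.reindex_bij_witness[of _ "\<lambda>(m,d). (d,m)" "\<lambda>(d,m). (m,d)"])
      (auto simp: nats_le_def field_simps dest: *)
  also have "\<dots> = (\<Sum>m\<in>nats_le x. \<Sum>d\<in>nats_le (x / real m). f d m)"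
    by (rule sum.Sigma [symmetric]) auto
  finally show ?thesis .
qed

section \<open>Sums of logarithms and of reciprocals\<close>

lemma card_nats_le: "x \<ge> 0 \<Longrightarrow> real (card (nats_le x)) = of_int \<lfloor>x\<rfloor>"
  by (simp add: nats_le_altdef)

lemma ln_diff_le:
  fixes a b :: real
  assumes "a > 0" "b > 0"
  shows "ln a - ln b \<le> (a - b) / b"
  using ln_le_minus_one[of "a / b"] assms by (simp add: ln_div diff_divide_distrib)

text \<open>A weak form of Stirling's formula; the induction needs only that
  \<open>ln (N + 1) - ln N\<close> lies between \<open>1 / (N + 1)\<close> and
  \<open>1 / N\<close>.\<close>

lemma ln_fact_bounds:
  assumes "N > 0"
  shows "real N * ln N - N \<le> ln (fact N) \<and> ln (fact N) \<le> real N * ln N - N + 1 + ln N"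
  using assms
proof (induction N rule: nat_induct_non_zero)
  case (Suc N)
  have "ln (real N + 1) - ln N \<le> 1 / N" "ln N - ln (real N + 1) \<le> - (1 / (real N + 1))"
    using ln_diff_le[of "real N + 1" N] ln_diff_le[of N "real N + 1"] Suc.hyps by auto
  then have "real N * (ln (real N + 1) - ln N) \<le> real N * (1 / N)"
    "(real N + 1) * (ln N - ln (real N + 1)) \<le> (real N + 1) * - (1 / (real N + 1))"
    by (intro mult_left_mono; simp)+
  then have "real N * (ln (real N + 1) - ln N) \<le> 1" "(real N + 1) * (ln N - ln (real N + 1)) \<le> - 1"
    using Suc.hyps by simp_all
  moreover have "ln (fact (Suc N)) = ln (real N + 1) + ln (fact N)"
    by (simp add: ln_mult add.commute)
  ultimately show ?case using Suc.IH by (simp add: algebra_simps)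
qed auto

lemma sum_ln_nats_le:
  assumes "x \<ge> 1"
  shows "\<bar>(\<Sum>n\<in>nats_le x. ln (real n)) - (x * ln x - x)\<bar> \<le> 1 + ln x"
proof -
  define N where "N = nat \<lfloor>x\<rfloor>"
  have N: "N > 0" "real N \<le> x" "x < real N + 1"
    using assms by (auto simp: N_def le_nat_floor of_nat_floor)
  have "(\<Sum>n\<in>nats_le x. ln (real n)) = ln (\<Prod>n\<in>{1..N}. real n)"
    unfolding nats_le_altdef N_def [symmetric] by (subst ln_prod) auto
  also have "\<dots> = ln (fact N)" by (simp add: fact_prod)
  finally have T: "(\<Sum>n\<in>nats_le x. ln (real n)) = ln (fact N)" .
  have "real N * (ln x - ln N) \<le> x - N" "x * (ln N - ln x) \<le> N - x"
    using ln_diff_le[of x N] ln_diff_le[of N x] N assms by (auto simp: field_simps)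
  moreover have "(x - N) * ln x \<le> 1 * ln x"
    using N assms by (intro mult_right_mono) auto
  moreover have "(x - N) * ln N \<ge> 0" using N by simp
  moreover have "ln N \<le> ln x" using N by simp
  ultimately show ?thesis
    using ln_fact_bounds[OF N(1)] T unfolding abs_le_iff by (simp add: algebra_simps)
qed

lemma sum_inverse_nats_le:
  assumes "x \<ge> 1"
  shows "\<bar>(\<Sum>n\<in>nats_le x. 1 / real n) - ln x - euler_mascheroni\<bar> \<le> 1 / x"
proof -
  define N where "N = nat \<lfloor>x\<rfloor>"
  have N: "N > 0" "real N \<le> x" "x < real N + 1"
    using assms by (auto simp: N_def le_nat_floor of_nat_floor)
  have H: "(\<Sum>n\<in>nats_le x. 1 / real n) = harm N"
    unfolding nats_le_altdef N_def [symmetric] harm_def by (simp add: field_simps)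
  \<comment> \<open>The comparison of \<open>harm N\<close> with \<open>ln (N + 1)\<close> and that
    of \<open>ln (N + 1)\<close> with \<open>ln x\<close> have errors of opposite sign, each at most
    \<open>1 / x\<close>, so they do not add up.\<close>
  have "euler_mascheroni \<ge> harm N - ln (real N + 1) + 1 / (2 * (real N + 1))"
    "euler_mascheroni \<le> harm N - ln (real N + 1) + 1 / (2 * real N)"
    using euler_mascheroni_lower[of "N - 1"] euler_mascheroni_upper[of "N - 1"] N
    by (auto simp: of_nat_diff add.commute)
  moreover have "1 / (2 * real N) \<le> 1 / x" "1 / (2 * (real N + 1)) \<ge> 0"
    using N assms Suc_leI[OF N(1)] by (auto simp: field_simps)
  moreover have "ln (real N + 1) - ln x \<le> (real N + 1 - x) / x"
    using ln_diff_le[of "real N + 1" x] N assms by auto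
  moreover have "(real N + 1 - x) / x \<le> 1 / x"
    using N assms by (intro divide_right_mono) auto
  moreover have "ln x \<le> ln (real N + 1)" using N assms by simp
  ultimately show ?thesis unfolding H abs_le_iff by linarith
qed

section \<open>The bounds of Chebyshev and Mertens\<close>

definition psi :: "real \<Rightarrow> real" where
  "psi x = (\<Sum>n\<in>nats_le x. mangoldt n)"

definition mangoldt_log_sum :: "real \<Rightarrow> real" where
  "mangoldt_log_sum x = (\<Sum>n\<in>nats_le x. mangoldt n / real n)"

lemma psi_nonneg: "psi x \<ge> 0"
  unfolding psi_def by (intro sum_nonneg mangoldt_nonneg)

lemma psi_mono: "x \<le> y \<Longrightarrow> psi x \<le> psi y"
  unfolding psi_def by (intro sum_mono2 nats_le_mono mangoldt_nonneg finite_nats_le)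

lemma psi_eq_0: assumes "x < 2" shows "psi x = 0"
proof -
  have "mangoldt n = (0::real)" if "n \<in> nats_le x" for n
    using that assms by (cases "n = 1") (auto simp: nats_le_def)
  then show ?thesis by (simp add: psi_def)
qed

lemma sum_ln_eq_sum_mangoldt:
  "(\<Sum>n\<in>nats_le x. ln (real n)) = (\<Sum>d\<in>nats_le x. mangoldt d * card (nats_le (x / d)))"
proof -
  have "(\<Sum>d\<in>nats_le x. mangoldt d * card (nats_le (x / d))) =
        (\<Sum>d\<in>nats_le x. \<Sum>m\<in>nats_le (x / d). mangoldt d)"
    by (simp add: mult.commute)
  also have "\<dots> = (\<Sum>n\<in>nats_le x. \<Sum>d | d dvd n. mangoldt d)"
    by (rule sum_nats_le_divisors)
  also have "\<dots> = (\<Sum>n\<in>nats_le x. ln (real n))"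
    by (intro sum.cong refl, subst mangoldt_sum) (auto dest: nats_le_pos)
  finally show ?thesis by simp
qed

text \<open>Chebyshev's device: in \<open>T x - 2 * T (x / 2)\<close> the coefficient of
  \<open>mangoldt d\<close> is floor(x / d) - 2 floor(x / (2 d)), which is nonnegative throughout
  and at least 1 for \<open>d\<close> between \<open>x / 2\<close> and \<open>x\<close>. By Stirling
  the difference is at most \<open>x * ln 2\<close> plus a logarithmic error.\<close>

lemma psi_half:
  assumes "x \<ge> 2"
  shows "psi x \<le> psi (x / 2) + 4 * x"
proof -
  define T where "T x = (\<Sum>n\<in>nats_le x. ln (real n))" for x
  let ?c = "\<lambda>x. real (card (nats_le x))"
  have sub: "nats_le (x / 2) \<subseteq> nats_le x" using assms by (intro nats_le_mono) auto
  have "T (x / 2) = (\<Sum>d\<in>nats_le (x / 2). mangoldt d * ?c (x / 2 / d))"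
    unfolding T_def by (rule sum_ln_eq_sum_mangoldt)
  also have "\<dots> = (\<Sum>d\<in>nats_le x. mangoldt d * ?c (x / 2 / d))"
  proof (rule sum.mono_neutral_left[OF _ sub])
    show "\<forall>i\<in>nats_le x - nats_le (x / 2). mangoldt i * ?c (x / 2 / i) = 0"
    proof
      fix i assume "i \<in> nats_le x - nats_le (x / 2)"
      then have "nats_le (x / 2 / i) = {}"
        by (intro nats_le_empty) (auto simp: nats_le_def field_simps)
      then show "mangoldt i * ?c (x / 2 / i) = 0" by simp
    qed
  qed auto
  finally have T2: "T (x / 2) = (\<Sum>d\<in>nats_le x. mangoldt d * ?c (x / 2 / d))" .
  have "psi x - psi (x / 2) = (\<Sum>d\<in>nats_le x - nats_le (x / 2). mangoldt d)"
    unfolding psi_def by (subst sum_diff[OF _ sub]) auto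
  also have "\<dots> \<le> (\<Sum>d\<in>nats_le x - nats_le (x / 2). mangoldt d * (?c (x / d) - 2 * ?c (x / 2 / d)))"
  proof (rule sum_mono)
    fix d assume d: "d \<in> nats_le x - nats_le (x / 2)"
    then have "nats_le (x / 2 / d) = {}"
      by (intro nats_le_empty) (auto simp: nats_le_def field_simps)
    moreover have "1 \<in> nats_le (x / d)" using d by (auto simp: nats_le_def field_simps)
    then have "?c (x / d) \<ge> 1" by (metis One_nat_def Suc_leI card_gt_0_iff empty_iff finite_nats_le of_nat_1 of_nat_le_iff)
    ultimately have "mangoldt d * 1 \<le> mangoldt d * (?c (x / d) - 2 * ?c (x / 2 / d))"
      by (intro mult_left_mono mangoldt_nonneg) auto
    then show "mangoldt d \<le> mangoldt d * (?c (x / d) - 2 * ?c (x / 2 / d))" by simp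
  qed
  also have "\<dots> \<le> (\<Sum>d\<in>nats_le x. mangoldt d * (?c (x / d) - 2 * ?c (x / 2 / d)))"
  proof (rule sum_mono2)
    fix d assume d: "d \<in> nats_le x - (nats_le x - nats_le (x / 2))"
    have "2 * \<lfloor>y / 2\<rfloor> \<le> \<lfloor>y\<rfloor>" for y :: real by linarith
    from this[of "x / d"]
    have "of_int (2 * \<lfloor>x / 2 / d\<rfloor>) \<le> (of_int \<lfloor>x / d\<rfloor> :: real)"
      by (subst of_int_le_iff) (simp add: mult.commute)
    then show "0 \<le> mangoldt d * (?c (x / d) - 2 * ?c (x / 2 / d))"
      using assms by (intro mult_nonneg_nonneg mangoldt_nonneg) (simp add: card_nats_le)
  qed auto
  also have "\<dots> = T x - 2 * T (x / 2)"
    unfolding T2 by (simp add: T_def sum_ln_eq_sum_mangoldt algebra_simps sum_subtractf sum_distrib_left)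
  also have "\<dots> \<le> x * ln 2 + 3 + 3 * ln x"
    using sum_ln_nats_le[of x] sum_ln_nats_le[of "x / 2"] assms ln2_ge_two_thirds
    unfolding T_def abs_le_iff by (simp add: ln_div algebra_simps)
  also have "x * ln 2 \<le> x * 1" using assms ln_2_less_1 by (intro mult_left_mono) auto
  also have "x * 1 + 3 + 3 * ln x \<le> 4 * x" using ln_le_minus_one[of x] assms by simp
  finally show ?thesis by simp
qed

text \<open>Iterating \<open>psi_half\<close> sums the series 4 x (1 + 1/2 + 1/4 + ...) = 8 x, and
  the halving ends below 2, where \<open>psi\<close> vanishes.\<close>

lemma psi_le:
  assumes "x \<ge> 0"
  shows "psi x \<le> 8 * x"
proof -
  have "x < 2 ^ n \<longrightarrow> x \<ge> 0 \<longrightarrow> psi x \<le> 8 * x" for n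
  proof (induction n arbitrary: x)
    case (Suc n)
    show ?case
    proof (cases "x < 2")
      case False
      then show ?thesis using Suc[of "x / 2"] psi_half[of x] by auto
    qed (auto simp: psi_eq_0)
  qed (auto simp: psi_eq_0)
  moreover obtain n where "x < 2 ^ n" using real_arch_pow[of 2 x] by auto
  ultimately show ?thesis using assms by blast
qed

text \<open>In the sum of the logarithms the coefficient of \<open>mangoldt d\<close> is the floor
  of \<open>x / d\<close>. Replacing it by \<open>x / d\<close> costs at most \<open>psi x\<close>,
  hence at most \<open>8 * x\<close>, and the claim follows on division by \<open>x\<close>.\<close>

lemma mertens:
  assumes "x \<ge> 1"
  shows "\<bar>mangoldt_log_sum x - ln x\<bar> \<le> 8"
proof -
  define T where "T = (\<Sum>n\<in>nats_le x. ln (real n))"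
  have T: "T = (\<Sum>d\<in>nats_le x. mangoldt d * card (nats_le (x / d)))"
    unfolding T_def by (rule sum_ln_eq_sum_mangoldt)
  have 1: "x * mangoldt_log_sum x = (\<Sum>d\<in>nats_le x. mangoldt d * (x / d))"
    by (simp add: mangoldt_log_sum_def sum_distrib_left mult_ac)
  have bnd: "real (card (nats_le (x / d))) \<le> x / d" "x / d \<le> real (card (nats_le (x / d))) + 1" for d :: nat
    using assms by (subst card_nats_le; simp)+
  have "T \<le> x * mangoldt_log_sum x"
    unfolding T 1 by (intro sum_mono mult_left_mono bnd mangoldt_nonneg)
  moreover have "x * mangoldt_log_sum x \<le> (\<Sum>d\<in>nats_le x. mangoldt d * (real (card (nats_le (x / d))) + 1))"
    unfolding 1 by (intro sum_mono mult_left_mono bnd mangoldt_nonneg)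
  then have "x * mangoldt_log_sum x \<le> T + psi x"
    unfolding T psi_def by (simp add: algebra_simps sum.distrib)
  ultimately have "x * mangoldt_log_sum x \<le> x * (ln x + 8)" "x * mangoldt_log_sum x \<ge> x * (ln x - 8)"
    using sum_ln_nats_le[OF assms] psi_le[of x] ln_le_minus_one[of x] assms
    unfolding T_def [symmetric] abs_le_iff by (auto simp: algebra_simps)
  then show ?thesis using assms by (simp add: abs_le_iff)
qed

text \<open>The bound of 1 / sqrt n by 2 (sqrt n - sqrt (n - 1)) telescopes.\<close>

lemma sum_inverse_sqrt_nats_le:
  assumes "x \<ge> 0"
  shows "(\<Sum>n\<in>nats_le x. sqrt (x / real n)) \<le> 2 * x"
proof -
  have *: "(\<Sum>n\<in>{1..N}. 1 / sqrt (real n)) \<le> 2 * sqrt (real N)" for N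
  proof (induction N)
    case (Suc N)
    let ?a = "sqrt (real N)" and ?b = "sqrt (real N + 1)"
    have ab: "?a \<le> ?b" "?b > 0" "?a \<ge> 0" by (auto intro: real_sqrt_gt_zero)
    have "(?b - ?a) * (?b + ?a) = 1" by (simp add: algebra_simps)
    also have "1 = 1 / (2 * ?b) * (2 * ?b)" using ab by simp
    finally have "(?b - ?a) * (?b + ?a) = 1 / (2 * ?b) * (2 * ?b)" .
    moreover have "(?b - ?a) * (?b + ?a) \<le> (?b - ?a) * (2 * ?b)" using ab by (intro mult_left_mono) auto
    ultimately have "1 / (2 * ?b) \<le> ?b - ?a" using ab by (smt (verit) mult_right_le_imp_le)
    then have "1 / ?b \<le> 2 * (?b - ?a)" by simp
    then show ?case using Suc by (simp add: add.commute)
  qed auto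
  have "(\<Sum>n\<in>nats_le x. sqrt (x / real n)) = sqrt x * (\<Sum>n\<in>nats_le x. 1 / sqrt (real n))"
    by (simp add: sum_distrib_left real_sqrt_divide)
  also have "\<dots> \<le> sqrt x * (2 * sqrt (real (nat \<lfloor>x\<rfloor>)))"
    unfolding nats_le_altdef using assms by (intro mult_left_mono *) auto
  also have "\<dots> \<le> sqrt x * (2 * sqrt x)"
    using assms by (intro mult_left_mono) auto
  also have "\<dots> = 2 * x" using assms by simp
  finally show ?thesis .
qed

text \<open>With \<open>y\<close> the fourth root of \<open>x\<close>, \<open>ln x\<close> is 4 ln y
  and so at most \<open>4 * y\<close>. A majorant by a power of exponent below 1 is wanted because
  its values at \<open>x / d\<close> still sum to a multiple of \<open>x\<close>.\<close>

lemma ln_square_le_sqrt: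
  assumes "x \<ge> (1::real)"
  shows "ln x * (4 + ln x) \<le> 32 * sqrt x"
proof -
  define y where "y = sqrt (sqrt x)"
  have y: "y \<ge> 1" "y ^ 2 = sqrt x" "x = y ^ 4" using assms by (auto simp: y_def)
    (metis abs_of_nonneg dual_order.trans power2_eq_square power4_eq_xxxx real_sqrt_pow2 real_sqrt_ge_zero semiring_norm(163) zero_le_one mult.assoc)
  have l: "ln x \<le> 4 * y" "ln x \<ge> 0" using ln_le_minus_one[of y] y assms by (auto simp: ln_realpow)
  have "ln x * (4 + ln x) \<le> (4 * y) * (8 * y)" using l y by (intro mult_mono) auto
  also have "\<dots> = 32 * sqrt x" using y by (simp add: power2_eq_square)
  finally show ?thesis .
qed

text \<open>By the inversion formula it suffices that the sums of \<open>F (y / m)\<close> grow only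
  logarithmically: the outer sum over \<open>d\<close> is then of order \<open>x\<close> even when
  the signs of \<open>moebius\<close> are discarded.\<close>

theorem selberg:
  assumes x: "x \<ge> 1"
  shows "\<bar>psi x * ln x + (\<Sum>n\<in>nats_le x. mangoldt n * psi (x / n)) - 2 * x * ln x\<bar> \<le> 100 * x"
proof -
  define \<gamma> where "\<gamma> = (euler_mascheroni :: real)"
  have g: "0 < \<gamma>" "\<gamma> \<le> 1"
    using euler_mascheroni_pos euler_mascheroni_upper[of 0] ln2_ge_two_thirds
    by (auto simp: \<gamma>_def harm_def)
  \<comment> \<open>The logarithms sum to about \<open>y * ln y - y\<close> and the reciprocals to
    about ln y + \<gamma>, so the values \<open>psi (y / m) - y / m\<close> sum to about -(\<gamma>
    + 1) y. The added constant cancels this linear term.\<close>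
  define F where "F y = psi y - y + \<gamma> + 1" for y
  have F: "\<bar>\<Sum>m\<in>nats_le y. F (y / m)\<bar> \<le> 4 + ln y" if y: "y \<ge> 1" for y
  proof -
    define H where "H = (\<Sum>m\<in>nats_le y. 1 / real m)"
    define T where "T = (\<Sum>n\<in>nats_le y. ln (real n))"
    have "(\<Sum>m\<in>nats_le y. psi (y / m)) = (\<Sum>k\<in>nats_le y. \<Sum>m\<in>nats_le (y / k). mangoldt k)"
      unfolding psi_def by (rule sum_nats_le_swap)
    also have "\<dots> = T"
      by (simp add: T_def sum_ln_eq_sum_mangoldt mult.commute)
    finally have "(\<Sum>m\<in>nats_le y. F (y / m)) = T - y * H + (\<gamma> + 1) * card (nats_le y)"
      by (simp add: F_def sum.distrib sum_subtractf H_def sum_distrib_left algebra_simps)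
    moreover have "\<bar>y * (H - ln y - \<gamma>)\<bar> \<le> 1"
      using mult_left_mono[OF sum_inverse_nats_le[OF y], of y] y
      by (simp add: H_def \<gamma>_def abs_mult)
    moreover have "\<bar>T - (y * ln y - y)\<bar> \<le> 1 + ln y"
      unfolding T_def by (rule sum_ln_nats_le[OF y])
    moreover have "0 \<le> (\<gamma> + 1) * (y - card (nats_le y))" "(\<gamma> + 1) * (y - card (nats_le y)) \<le> 2 * 1"
      using g y by (intro mult_nonneg_nonneg mult_mono; simp add: card_nats_le; linarith)+
    ultimately show ?thesis by (simp add: algebra_simps abs_le_iff)
  qed
  have "\<bar>\<Sum>d\<in>nats_le x. moebius d * (ln (x / d) * (\<Sum>m\<in>nats_le (x / d). F (x / d / m)))\<bar>
     \<le> (\<Sum>d\<in>nats_le x. 32 * sqrt (x / d))"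
  proof (rule order_trans[OF sum_abs], rule sum_mono)
    fix d assume d: "d \<in> nats_le x"
    then have xd: "x / d \<ge> 1" by (auto simp: nats_le_def field_simps)
    have "\<bar>ln (x / d) * (\<Sum>m\<in>nats_le (x / d). F (x / d / m))\<bar> \<le> ln (x / d) * (4 + ln (x / d))"
      using F[OF xd] xd by (simp add: abs_mult mult_left_mono)
    also have "\<dots> \<le> 32 * sqrt (x / d)" by (rule ln_square_le_sqrt[OF xd])
    finally show "\<bar>moebius d * (ln (x / d) * (\<Sum>m\<in>nats_le (x / d). F (x / d / m)))\<bar> \<le> 32 * sqrt (x / d)"
      using mult_mono[OF abs_moebius_le[of d], of "\<bar>ln (x / d) * (\<Sum>m\<in>nats_le (x / d). F (x / d / m))\<bar>" "32 * sqrt (x / d)"]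
      by (simp add: abs_mult)
  qed
  also have "\<dots> \<le> 64 * x"
    using sum_inverse_sqrt_nats_le[of x] x by (simp add: sum_distrib_left [symmetric])
  finally have "\<bar>ln x * F x + (\<Sum>n\<in>nats_le x. mangoldt n * F (x / n))\<bar> \<le> 64 * x"
    unfolding moebius_log_inversion[OF x] .
  moreover have "(\<Sum>n\<in>nats_le x. mangoldt n * F (x / n)) =
      (\<Sum>n\<in>nats_le x. mangoldt n * psi (x / n)) - x * mangoldt_log_sum x + (\<gamma> + 1) * psi x"
    by (simp add: F_def mangoldt_log_sum_def psi_def sum_distrib_left sum.distrib sum_subtractf algebra_simps)
  moreover have "\<bar>x * (mangoldt_log_sum x - ln x)\<bar> \<le> 8 * x"
    using mult_left_mono[OF mertens[OF x], of x] x by (simp add: abs_mult)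
  moreover have "0 \<le> (\<gamma> + 1) * psi x" "0 \<le> (\<gamma> + 1) * ln x"
    using g psi_nonneg[of x] x by auto
  moreover have "(\<gamma> + 1) * psi x \<le> 2 * (8 * x)"
    by (rule mult_mono) (use g psi_nonneg[of x] psi_le[of x] x in auto)
  moreover have "(\<gamma> + 1) * ln x \<le> 2 * x"
    by (rule mult_mono) (use g ln_le_minus_one[of x] x in auto)
  ultimately show ?thesis by (simp add: F_def algebra_simps abs_le_iff)
qed

section \<open>Primes in short intervals\<close>

text \<open>The summatory function of the convolution of \<open>mangoldt\<close> with itself:
  Lambda(m) Lambda(n) summed over all m n up to \<open>x\<close>.\<close>

definition pair_sum :: "real \<Rightarrow> real" where
  "pair_sum x = (\<Sum>n\<in>nats_le x. mangoldt n * psi (x / n))"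

text \<open>The additional terms vanish as \<open>psi\<close> is 0 below 2. A common range
  \<open>z\<close> allows pair sums at different points to be subtracted term by term.\<close>

lemma pair_sum_altdef:
  assumes "x \<le> z"
  shows "pair_sum x = (\<Sum>n\<in>nats_le z. mangoldt n * psi (x / n))"
  unfolding pair_sum_def
proof (rule sum.mono_neutral_left)
  show "\<forall>i\<in>nats_le z - nats_le x. mangoldt i * psi (x / i) = 0"
  proof
    fix i assume "i \<in> nats_le z - nats_le x"
    then have "x / i < 2" by (auto simp: nats_le_def field_simps)
    then show "mangoldt i * psi (x / i) = 0" by (simp add: psi_eq_0)
  qed
qed (use nats_le_mono[OF assms] in auto)

lemma pair_sum_mono:
  assumes "x \<le> y"
  shows "pair_sum x \<le> pair_sum y"
  unfolding pair_sum_altdef[OF assms] pair_sum_altdef[OF order_refl[of y]]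
  using assms
  by (intro sum_mono mult_left_mono psi_mono mangoldt_nonneg divide_right_mono) auto

text \<open>The constant collects the errors of \<open>selberg\<close> at both ends;
  \<open>10 * c * exp c\<close> pays for replacing \<open>ln y\<close> by \<open>ln x\<close>, which
  differ by at most \<open>c\<close>.\<close>

lemma selberg_diff:
  assumes "c \<ge> 0"
  obtains C where "C \<ge> 0"
    "\<And>x y. 1 \<le> x \<Longrightarrow> x \<le> y \<Longrightarrow> y \<le> exp c * x \<Longrightarrow>
      \<bar>(psi y - psi x) * ln x + (pair_sum y - pair_sum x) - 2 * (y - x) * ln x\<bar> \<le> C * x"
proof
  let ?C = "100 * exp c + 100 + 10 * c * exp c"
  show "?C \<ge> 0" using assms by simp
  fix x y :: real assume xy: "1 \<le> x" "x \<le> y" "y \<le> exp c * x"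
  have sx: "\<bar>psi x * ln x + pair_sum x - 2 * x * ln x\<bar> \<le> 100 * x"
    and sy: "\<bar>psi y * ln y + pair_sum y - 2 * y * ln y\<bar> \<le> 100 * y"
    using selberg[of x] selberg[of y] xy by (auto simp: pair_sum_def)
  define d where "d = ln y - ln x"
  have "ln y \<le> ln (exp c * x)" using xy by simp
  then have d: "0 \<le> d" "d \<le> c" using xy by (auto simp: d_def ln_mult)
  have "0 \<le> psi y * d" "0 \<le> 2 * y * d" using psi_nonneg[of y] d xy by auto
  moreover have "psi y * d \<le> (8 * (exp c * x)) * c"
    using psi_le[of y] d xy by (intro mult_mono) auto
  moreover have "y * d \<le> (exp c * x) * c" using d xy by (intro mult_mono) auto
  moreover have "psi y * ln y = psi y * ln x + psi y * d" "2 * y * ln y = 2 * y * ln x + 2 * y * d"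
    by (auto simp: d_def algebra_simps)
  ultimately show "\<bar>(psi y - psi x) * ln x + (pair_sum y - pair_sum x) - 2 * (y - x) * ln x\<bar> \<le> ?C * x"
    using sx sy xy unfolding abs_le_iff by (simp add: algebra_simps)
qed

section \<open>Prime powers on the logarithmic line\<close>

definition Phi :: "real \<Rightarrow> real" where
  "Phi t = mangoldt_log_sum (exp t)"

lemma mem_nats_le_exp: "n \<in> nats_le (exp t) \<longleftrightarrow> 0 < n \<and> ln (real n) \<le> t"
proof (cases "n > 0")
  case True
  then have "ln (real n) \<le> t \<longleftrightarrow> exp (ln (real n)) \<le> exp t" by (simp only: exp_le_cancel_iff)
  with True show ?thesis by (simp add: nats_le_def)
qed (simp add: nats_le_def)

lemma Phi_diff:
  assumes "s \<le> t"
  shows "Phi t - Phi s = (\<Sum>n | 0 < n \<and> s < ln (real n) \<and> ln (real n) \<le> t. mangoldt n / n)"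
proof -
  have "{n. 0 < n \<and> s < ln (real n) \<and> ln (real n) \<le> t} = nats_le (exp t) - nats_le (exp s)"
    by (auto simp: mem_nats_le_exp)
  then show ?thesis
    using assms by (simp add: Phi_def mangoldt_log_sum_def sum_diff nats_le_mono)
qed

lemma finite_ln_interval: "finite {n. 0 < n \<and> s < ln (real n) \<and> ln (real n) \<le> t}"
  by (rule finite_subset[OF _ finite_nats_le[of "exp t"]])
    (auto simp: mem_nats_le_exp)

lemma Phi_mono: "s \<le> t \<Longrightarrow> Phi s \<le> Phi t"
  using Phi_diff[of s t] sum_nonneg[of "{n. 0 < n \<and> s < ln (real n) \<and> ln (real n) \<le> t}" "\<lambda>n. mangoldt n / real n"]
  by (simp add: mangoldt_nonneg)

lemma Phi_nonneg: "0 \<le> Phi t"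
  unfolding Phi_def mangoldt_log_sum_def by (intro sum_nonneg divide_nonneg_nonneg mangoldt_nonneg) auto

text \<open>Read on the line \<open>t = ln x\<close>, Mertens' estimate says that the masses
  \<open>mangoldt n / n\<close> have mean density 1, so a larger density cannot persist over a long
  stretch.\<close>

lemma Phi_mertens: "t \<ge> 0 \<Longrightarrow> \<bar>Phi t - t\<bar> \<le> 8"
  using mertens[of "exp t"] by (simp add: Phi_def)

text \<open>For \<open>n\<close> between \<open>x\<close> and \<open>y\<close> the weight
  \<open>1 / n\<close> lies between \<open>1 / y\<close> and \<open>1 / x\<close>, so on short
  intervals the two kinds of sums agree up to a factor near 1.\<close>

lemma mangoldt_log_sum_diff_bounds:
  assumes "0 < x" "x \<le> y"
  shows "x * (mangoldt_log_sum y - mangoldt_log_sum x) \<le> psi y - psi x"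
    and "psi y - psi x \<le> y * (mangoldt_log_sum y - mangoldt_log_sum x)"
proof -
  let ?N = "nats_le y - nats_le x"
  have sub: "nats_le x \<subseteq> nats_le y" using assms by (intro nats_le_mono) auto
  have L: "mangoldt_log_sum y - mangoldt_log_sum x = (\<Sum>n\<in>?N. mangoldt n / n)"
    unfolding mangoldt_log_sum_def by (rule sum_diff [symmetric]) (use sub in auto)
  have P: "psi y - psi x = (\<Sum>n\<in>?N. mangoldt n)"
    unfolding psi_def by (rule sum_diff [symmetric]) (use sub in auto)
  show "x * (mangoldt_log_sum y - mangoldt_log_sum x) \<le> psi y - psi x"
    unfolding L P sum_distrib_left
  proof (rule sum_mono)
    fix n assume n: "n \<in> ?N"
    then have "x * mangoldt n \<le> real n * mangoldt n"
      by (intro mult_right_mono mangoldt_nonneg) (auto simp: nats_le_def)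
    then show "x * (mangoldt n / real n) \<le> mangoldt n"
      using n by (auto simp: nats_le_def field_simps)
  qed
  show "psi y - psi x \<le> y * (mangoldt_log_sum y - mangoldt_log_sum x)"
    unfolding L P sum_distrib_left
  proof (rule sum_mono)
    fix n assume n: "n \<in> ?N"
    then have "real n * mangoldt n \<le> y * mangoldt n"
      by (intro mult_right_mono mangoldt_nonneg) (auto simp: nats_le_def)
    then show "mangoldt n \<le> y * (mangoldt n / real n)"
      using n by (auto simp: nats_le_def field_simps)
  qed
qed

text \<open>Since \<open>pair_sum\<close> is monotone, Selberg's formula bounds the increment of
  \<open>psi\<close> by about \<open>2 * (y - x)\<close>. The passage to \<open>Phi\<close> turns a
  length \<open>h\<close> into \<open>exp h - 1\<close>, hence the cut into short pieces.\<close>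

lemma Phi_diff_le:
  assumes c: "c > 0" and \<rho>: "\<rho> > 0"
  obtains t0 where "t0 \<ge> 0"
    "\<And>s t. t0 \<le> s \<Longrightarrow> s \<le> t \<Longrightarrow> t \<le> s + c \<Longrightarrow> Phi t - Phi s \<le> 2 * (t - s) + \<rho>"
proof -
  obtain C where C: "C \<ge> 0"
    "\<And>x y. 1 \<le> x \<Longrightarrow> x \<le> y \<Longrightarrow> y \<le> exp 1 * x \<Longrightarrow>
      \<bar>(psi y - psi x) * ln x + (pair_sum y - pair_sum x) - 2 * (y - x) * ln x\<bar> \<le> C * x"
    using selberg_diff[of 1] by auto
  \<comment> \<open>The quadratic errors of \<open>m\<close> pieces of length at most
    \<open>c / m\<close> add up to at most \<open>2 * c^2 / m\<close>. As \<open>m\<close> is chosen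
    before \<open>t0\<close>, the \<open>m\<close> errors \<open>C / u\<close> can afterwards be
    made small through \<open>t0\<close>.\<close>
  obtain m :: nat where m0: "real m > max (max 1 c) (4 * c\<^sup>2 / \<rho>)" using reals_Archimedean2 by blast
  then have m: "real m \<ge> 1" "real m \<ge> c" "2 * c\<^sup>2 / m \<le> \<rho> / 2"
    using \<rho> by (auto simp: field_simps)
  define t0 where "t0 = max 1 (2 * m * C / \<rho>)"
  have t0: "t0 \<ge> 1" "m * (C / t0) \<le> \<rho> / 2"
    using \<rho> by (auto simp: t0_def field_simps max_def)
  show ?thesis
  proof
    show "t0 \<ge> 0" using t0 by simp
    fix s t assume st: "t0 \<le> s" "s \<le> t" "t \<le> s + c"
    define h where "h = (t - s) / m"
    have h: "h \<ge> 0" "h \<le> 1" "m * h = t - s" using m st by (auto simp: h_def field_simps)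
    have step: "Phi (s + Suc i * h) - Phi (s + i * h) \<le> 2 * h + 2 * h\<^sup>2 + C / t0" for i
    proof -
      define u where "u = s + i * h"
      define x where "x = exp u"
      have u: "u \<ge> t0" using h st by (simp add: u_def add_increasing2)
      have v: "exp (s + Suc i * h) = exp h * x" by (simp add: x_def u_def algebra_simps exp_add)
      have x: "x \<ge> 1" "x \<le> exp h * x" "exp h * x \<le> exp 1 * x" "ln x = u"
        using u t0 h by (auto simp: x_def)
      have "(psi (exp h * x) - psi x) * u \<le> (2 * (exp h - 1) * u + C) * x"
        using C(2)[OF x(1-3)] pair_sum_mono[OF x(2)] unfolding x(4) abs_le_iff by (simp add: algebra_simps)
      moreover have "x * (mangoldt_log_sum (exp h * x) - mangoldt_log_sum x) * u \<le> (psi (exp h * x) - psi x) * u"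
        using mangoldt_log_sum_diff_bounds(1)[of x "exp h * x"] x u t0 by (intro mult_right_mono) auto
      ultimately have "(mangoldt_log_sum (exp h * x) - mangoldt_log_sum x) * u * x \<le> (2 * (exp h - 1) * u + C) * x"
        by (simp add: mult_ac)
      then have "(mangoldt_log_sum (exp h * x) - mangoldt_log_sum x) * u \<le> 2 * (exp h - 1) * u + C"
        using x(1) by simp
      then have "Phi (s + Suc i * h) - Phi (s + i * h) \<le> 2 * (exp h - 1) + C / u"
        using u t0 unfolding Phi_def v u_def [symmetric] x_def [symmetric] by (simp add: field_simps)
      moreover have "C / u \<le> C / t0" using C(1) u t0 by (intro divide_left_mono) auto
      moreover have "exp h \<le> 1 + h + h\<^sup>2" using h by (intro exp_bound) auto
      moreover have "X \<le> 2 * h + 2 * h\<^sup>2 + G" if "X \<le> 2 * (exp h - 1) + F" "F \<le> G" "exp h \<le> 1 + h + h\<^sup>2" for X F G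
        using that by (simp add: algebra_simps)
      ultimately show ?thesis by blast
    qed
    have "Phi t - Phi s = (\<Sum>i<m. Phi (s + Suc i * h) - Phi (s + i * h))"
      using sum_lessThan_telescope[of "\<lambda>i. Phi (s + real i * h)" m] h by simp
    also have "\<dots> \<le> (\<Sum>i<m. 2 * h + 2 * h\<^sup>2 + C / t0)" by (intro sum_mono step)
    also have "\<dots> = 2 * (m * h) + 2 * ((m * h) * h) + m * (C / t0)"
      by (simp add: algebra_simps power2_eq_square)
    also have "(m * h) * h \<le> c * (c / m)"
      using h st m c by (intro mult_mono) (auto simp: h_def divide_right_mono)
    also have "c * (c / m) = c\<^sup>2 / m" by (simp add: power2_eq_square)
    finally have "Phi t - Phi s \<le> 2 * (m * h) + 2 * (c\<^sup>2 / m) + m * (C / t0)" by simp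
    moreover have "2 * (c\<^sup>2 / m) \<le> \<rho> / 2" using m by simp
    ultimately show "Phi t - Phi s \<le> 2 * (t - s) + \<rho>" using t0(2) unfolding h(3) by linarith
  qed
qed

text \<open>If there is little mass right after \<open>t\<close>, the increment of
  \<open>pair_sum\<close> has to supply the whole main term of Selberg's formula. Written with the
  weights \<open>mangoldt n / n\<close>, of total mass about \<open>t\<close>, it says that the
  increments of \<open>Phi\<close> over length \<open>a\<close> at the points
  \<open>t - ln n\<close> average about \<open>2 * a\<close>, the maximum permitted by
  \<open>Phi_diff_le\<close>.\<close>

lemma sparse_imp_large_pair_sum:
  assumes a: "a > 0" and \<rho>: "\<rho> > 0"
  obtains \<eta> t0 where "\<eta> > 0"
    "\<And>t. t0 \<le> t \<Longrightarrow> Phi (t + a) - Phi t < \<eta> \<Longrightarrow>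
      (2 * a - \<rho>) * t \<le> (\<Sum>n\<in>nats_le (exp (t + a)). mangoldt n / n * (Phi (t + a - ln n) - Phi (t - ln n)))"
proof -
  obtain C where C: "C \<ge> 0"
    "\<And>x y. 1 \<le> x \<Longrightarrow> x \<le> y \<Longrightarrow> y \<le> exp 1 * x \<Longrightarrow>
      \<bar>(psi y - psi x) * ln x + (pair_sum y - pair_sum x) - 2 * (y - x) * ln x\<bar> \<le> C * x"
    using selberg_diff[of 1] by auto
  obtain m :: nat where m0: "real m > max (max 1 a) (6 * a\<^sup>2 / \<rho>)" using reals_Archimedean2 by blast
  then have m: "real m \<ge> 1" "real m \<ge> a" "2 * a\<^sup>2 / m \<le> \<rho> / 3"
    using \<rho> by (auto simp: field_simps)
  define t0 where "t0 = max (max 1 a) (3 * m * C / \<rho>)"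
  show ?thesis
  proof
    \<comment> \<open>The error \<open>\<rho> * t\<close> is shared equally by three terms: the
      quadratic error of the pieces, the sum \<open>m * C\<close>, and the sparse mass, which enters
      with the factor \<open>2 * t\<close> because \<open>u\<close> is at most
      \<open>t + a\<close>.\<close>
    show "\<rho> / 6 > 0" using \<rho> by simp
    fix t assume t0: "t0 \<le> t" and sparse: "Phi (t + a) - Phi t < \<rho> / 6"
    have t: "t \<ge> 1" "t \<ge> a" "m * C \<le> \<rho> / 3 * t"
      using t0 \<rho> by (auto simp: t0_def field_simps)
    define N where "N = nats_le (exp (t + a))"
    define h where "h = a / m"
    have h: "h > 0" "h \<le> 1" "m * h = a" using m a by (auto simp: h_def field_simps)
    have "exp (- h) \<le> 1 / (1 + h)"
      using h exp_ge_add_one_self[of h] by (simp add: exp_minus inverse_eq_divide frac_le)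
    also have "\<dots> \<le> 1 - h + h\<^sup>2"
      using h by (simp add: field_simps power2_eq_square)
    finally have exph: "1 - exp (- h) \<ge> h - h\<^sup>2" by simp
    have hh: "h - h\<^sup>2 \<ge> 0" using h by (simp add: power2_eq_square mult_left_le)
    \<comment> \<open>The range \<open>N\<close> is the same for all \<open>u\<close>, so that the
      increments of \<open>Q\<close> over the \<open>m\<close> pieces telescope.\<close>
    define Q where "Q u = (\<Sum>n\<in>N. mangoldt n / n * Phi (u - ln n))" for u
    have step: "Q (t + Suc i * h) - Q (t + i * h) \<ge>
      2 * (h - h\<^sup>2) * t - 2 * t * (Phi (t + Suc i * h) - Phi (t + i * h)) - C" if i: "i < m" for i
    proof -
      define u where "u = t + i * h"
      have ih: "Suc i * h \<le> m * h" using i h by (intro mult_right_mono) auto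
      have u: "t \<le> u" "u + h \<le> t + a" using h ih by (auto simp: u_def algebra_simps)
      have si: "t + Suc i * h = u + h" by (simp add: u_def algebra_simps)
      define x y where "x = exp u" and "y = exp (u + h)"
      have y: "y = exp h * x" by (simp add: x_def y_def exp_add)
      have x: "x \<ge> 1" "x \<le> y" "y \<le> exp 1 * x" "ln x = u" "y > 0" "x > 0"
        using u t h by (auto simp: x_def y_def exp_add)
      have "pair_sum y - pair_sum x = (\<Sum>n\<in>N. mangoldt n * (psi (y / n) - psi (x / n)))"
        using pair_sum_altdef[of x "exp (t + a)"] pair_sum_altdef[of y "exp (t + a)"] u h
        by (simp add: N_def x_def y_def sum_subtractf algebra_simps)
      also have "\<dots> \<le> (\<Sum>n\<in>N. y * (mangoldt n / n * (Phi (u + h - ln n) - Phi (u - ln n))))"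
      proof (rule sum_mono)
        fix n assume "n \<in> N"
        then have n: "n > 0" by (auto simp: N_def dest: nats_le_pos)
        have eq: "exp (u - ln n) = x / n" "exp (u + h - ln n) = y / n"
          using n by (auto simp: x_def y_def exp_diff exp_add)
        have "psi (y / n) - psi (x / n) \<le> (y / n) * (Phi (u + h - ln n) - Phi (u - ln n))"
          unfolding Phi_def eq
          by (rule mangoldt_log_sum_diff_bounds) (use x n in \<open>auto intro: divide_right_mono\<close>)
        then have "mangoldt n * (psi (y / n) - psi (x / n)) \<le> mangoldt n * ((y / n) * (Phi (u + h - ln n) - Phi (u - ln n)))"
          by (intro mult_left_mono mangoldt_nonneg)
        then show "mangoldt n * (psi (y / n) - psi (x / n)) \<le> y * (mangoldt n / n * (Phi (u + h - ln n) - Phi (u - ln n)))"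
          by (simp add: mult_ac)
      qed
      also have "\<dots> = y * (Q (u + h) - Q u)"
        by (simp add: Q_def sum_subtractf sum_distrib_left algebra_simps)
      finally have 1: "pair_sum y - pair_sum x \<le> y * (Q (u + h) - Q u)" .
      have "psi y - psi x \<le> y * (Phi (u + h) - Phi u)"
        using mangoldt_log_sum_diff_bounds(2)[OF x(6,2)] by (simp add: Phi_def x_def y_def)
      then have "(psi y - psi x) * u \<le> y * (Phi (u + h) - Phi u) * u"
        using u t by (intro mult_right_mono) auto
      moreover have "\<dots> \<le> y * (Phi (u + h) - Phi u) * (2 * t)"
      proof (rule mult_left_mono)
        show "u \<le> 2 * t" using u t h by linarith
        have "Phi u \<le> Phi (u + h)" using h by (intro Phi_mono) simp
        then show "0 \<le> y * (Phi (u + h) - Phi u)" using x by simp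
      qed
      moreover have "2 * (y - x) * u - C * x \<le> (psi y - psi x) * u + (pair_sum y - pair_sum x)"
        using C(2)[OF x(1-3)] unfolding x(4) abs_le_iff by simp
      moreover have "C * x \<le> C * y" using C x by (intro mult_left_mono) auto
      moreover have "y * (2 * (h - h\<^sup>2) * t) \<le> 2 * (y - x) * u"
      proof -
        have "y - x = y * (1 - exp (- h))" by (simp add: x_def y_def exp_add exp_minus field_simps)
        moreover have "y * (2 * (h - h\<^sup>2) * t) \<le> y * (2 * (1 - exp (- h)) * u)"
          using exph hh u t x h by (intro mult_left_mono mult_mono) auto
        ultimately show ?thesis by (simp add: mult_ac)
      qed
      ultimately have "y * (2 * (h - h\<^sup>2) * t - 2 * t * (Phi (u + h) - Phi u) - C) \<le> y * (Q (u + h) - Q u)"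
        using 1 by (simp add: algebra_simps)
      then show ?thesis using x unfolding si u_def [symmetric] by simp
    qed
    have "(2 * a - \<rho>) * t \<le> 2 * (a - a * h) * t - 2 * t * (\<rho> / 6) - m * C"
    proof -
      have "2 * (a * h) \<le> \<rho> / 3" using m by (simp add: h_def power2_eq_square)
      then have "2 * (a * h) * t \<le> \<rho> / 3 * t" using t by (intro mult_right_mono) auto
      then have "2 * (a * h) * t \<le> \<rho> * t / 3" "m * C \<le> \<rho> * t / 3" using t(3) by simp_all
      moreover have "A - W \<le> A - P - W / 3 - R" if "P \<le> W / 3" "R \<le> W / 3" for A P W R :: real
        using that by linarith
      ultimately have "2 * a * t - \<rho> * t \<le> 2 * a * t - 2 * (a * h) * t - \<rho> * t / 3 - m * C" by blast
      moreover have "(2 * a - \<rho>) * t = 2 * a * t - \<rho> * t" "2 * t * (\<rho> / 6) = \<rho> * t / 3"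
        "2 * (a - a * h) * t = 2 * a * t - 2 * (a * h) * t"
        by (simp_all add: algebra_simps)
      ultimately show ?thesis by simp
    qed
    also have "\<dots> \<le> 2 * (a - a * h) * t - 2 * t * (Phi (t + a) - Phi t) - m * C"
      using sparse t by simp
    also have "\<dots> = (\<Sum>i<m. 2 * (h - h\<^sup>2) * t - 2 * t * (Phi (t + Suc i * h) - Phi (t + i * h)) - C)"
    proof -
      have "(\<Sum>i<m. Phi (t + Suc i * h) - Phi (t + i * h)) = Phi (t + a) - Phi t"
        using sum_lessThan_telescope[of "\<lambda>i. Phi (t + real i * h)" m] h by simp
      moreover have "2 * (h - h\<^sup>2) * (m * t) = 2 * (a - a * h) * t"
        unfolding h(3) [symmetric] by (simp add: algebra_simps power2_eq_square)
      ultimately show ?thesis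
        by (simp only: sum_subtractf sum_distrib_left [symmetric] sum_constant card_lessThan)
    qed
    also have "\<dots> \<le> (\<Sum>i<m. Q (t + Suc i * h) - Q (t + i * h))" by (intro sum_mono step) auto
    also have "\<dots> = Q (t + a) - Q t"
      using sum_lessThan_telescope[of "\<lambda>i. Q (t + real i * h)" m] h by simp
    also have "\<dots> = (\<Sum>n\<in>N. mangoldt n / n * (Phi (t + a - ln n) - Phi (t - ln n)))"
      by (simp add: Q_def sum_subtractf algebra_simps)
    finally show "(2 * a - \<rho>) * t \<le> (\<Sum>n\<in>nats_le (exp (t + a)). mangoldt n / n * (Phi (t + a - ln n) - Phi (t - ln n)))"
      unfolding N_def .
  qed
qed

section \<open>Shrinking the length of sparse intervals\<close>

definition nonsparse :: "real \<Rightarrow> bool" where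
  "nonsparse b \<longleftrightarrow> (\<exists>\<delta>>0. \<exists>t0. \<forall>t\<ge>t0. \<delta> \<le> Phi (t + b) - Phi t)"

lemma nonsparse_mono:
  assumes "nonsparse a" "a \<le> b"
  shows "nonsparse b"
proof -
  obtain \<delta> t0 where "\<delta> > 0" "\<And>t. t \<ge> t0 \<Longrightarrow> \<delta> \<le> Phi (t + a) - Phi t"
    using assms(1) unfolding nonsparse_def by blast
  moreover have "Phi (t + a) \<le> Phi (t + b)" for t using assms(2) by (intro Phi_mono) auto
  ultimately show ?thesis unfolding nonsparse_def by (metis diff_right_mono order_trans)
qed

text \<open>Mertens' error is at most 8 at either end, so length 17 leaves mass at least 1.\<close>

lemma nonsparse_17: "nonsparse 17"
proof -
  have "1 \<le> Phi (t + 17) - Phi t" if "t \<ge> 0" for t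
    using Phi_mertens[of t] Phi_mertens[of "t + 17"] that unfolding abs_le_iff by linarith
  then show ?thesis unfolding nonsparse_def by (intro exI[of _ 1]) auto
qed

text \<open>Intervals of length \<open>a\<close> on which the density of \<open>\<Phi>\<close> is almost the maximal one, \<open>2\<close>,
  and whose left end points have gaps at most \<open>b\<close>, cover a proportion \<open>a / b\<close> of the line.\<close>

lemma window_gain:
  fixes \<Phi> :: "real \<Rightarrow> real"
  assumes mono: "\<And>s t. s \<le> t \<Longrightarrow> \<Phi> s \<le> \<Phi> t"
    and upper: "\<And>s t. u0 \<le> s \<Longrightarrow> s \<le> t \<Longrightarrow> t \<le> s + b \<Longrightarrow> \<Phi> t - \<Phi> s \<le> 2 * (t - s) + \<rho>"
    and ab: "0 < a" "a \<le> b" and \<rho>: "0 \<le> \<rho>" and \<tau>: "0 \<le> \<tau>"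
    and s: "z \<le> s" "s < z + b" and s': "s - b \<le> s'" "s' < z" "u0 \<le> s'"
    and sat: "2 * a - \<tau> \<le> \<Phi> (s + a) - \<Phi> s" "2 * a - \<tau> \<le> \<Phi> (s' + a) - \<Phi> s'"
  shows "2 * a - 2 * \<tau> - 3 * \<rho> \<le> \<Phi> (z + b) - \<Phi> z"
proof (cases "s + a \<le> z + b")
  case True
  then show ?thesis using mono[of "s + a" "z + b"] mono[of z s] s sat \<rho> \<tau> by linarith
next
  \<comment> \<open>The window at \<open>s\<close> sticks out of the cell by
    \<open>s + a - (z + b)\<close>, but since \<open>s - b \<le> s'\<close> the window at
    \<open>s'\<close> reaches at least as far beyond \<open>z\<close> and makes up for it. By the
    upper density bound a part of a nearly saturated window is again nearly saturated.\<close>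
  case False
  have "\<Phi> (s + a) - \<Phi> (z + b) \<le> 2 * (s + a - (z + b)) + \<rho>"
    by (rule upper) (use False s s' ab in linarith)+
  then have 1: "\<Phi> (z + b) - \<Phi> s \<ge> 2 * (z + b - s) - \<tau> - \<rho>"
    using sat(1) by (simp add: algebra_simps)
  have 2: "\<Phi> z - \<Phi> s' \<le> 2 * (z - s') + \<rho>"
    by (rule upper) (use s s' ab in linarith)+
  consider "s' + a \<le> z" | "z < s' + a" "s' + a \<le> s" | "s < s' + a" by linarith
  then show ?thesis
  proof cases
    case 1
    then show ?thesis using \<open>\<Phi> (z + b) - \<Phi> s \<ge> _\<close> mono[of z s] s s' \<rho> \<tau> by (simp add: algebra_simps)
  next
    case 2
    have "\<Phi> (s' + a) - \<Phi> z \<ge> 2 * (s' + a - z) - \<tau> - \<rho>"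
      using \<open>\<Phi> z - \<Phi> s' \<le> _\<close> sat(2) \<rho> by (simp add: algebra_simps)
    then show ?thesis using 1 mono[of "s' + a" s] 2 s s' \<rho> \<tau> by (simp add: algebra_simps)
  next
    case 3
    have "\<Phi> (s' + a) - \<Phi> s \<le> 2 * (s' + a - s) + \<rho>"
      by (rule upper) (use 3 s s' ab in linarith)+
    then have "\<Phi> s - \<Phi> z \<ge> 2 * (s - z) - \<tau> - 2 * \<rho>"
      using 2 sat(2) by (simp add: algebra_simps)
    then show ?thesis using 1 ab s s' \<rho> \<tau> by (simp add: algebra_simps)
  qed
qed

text \<open>Positions are read backwards from a sparse point \<open>T\<close>: the window of
  \<open>n\<close> starts at \<open>T - ln n\<close>, and the line is cut into cells from
  \<open>q * b\<close> to \<open>(q + 1) * b\<close>. An interval of length \<open>b\<close> has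
  mass at least \<open>\<delta>\<close>, so it contains an \<open>n\<close> with a saturated window
  unless the unsaturated ones near its cell have mass \<open>\<delta>\<close>. Their total mass is a
  small multiple of \<open>T\<close>, so few cells are exceptional.\<close>

lemma nonsparse_step:
  assumes b: "b > 0" and ns: "nonsparse b"
  shows "nonsparse (3 / 4 * b)"
proof (rule ccontr)
  assume sparse: "\<not> nonsparse (3 / 4 * b)"
  define a where "a = 3 / 4 * b"
  have a: "0 < a" "a \<le> b" using b by (auto simp: a_def)
  obtain \<delta> z where \<delta>: "\<delta> > 0" and "\<And>t. t \<ge> z \<Longrightarrow> \<delta> \<le> Phi (t + b) - Phi t"
    using ns unfolding nonsparse_def by blast
  define z0 where "z0 = max z 0"
  have z0: "z0 \<ge> 0" "\<And>t. t \<ge> z0 \<Longrightarrow> \<delta> \<le> Phi (t + b) - Phi t"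
    using \<open>\<And>t. t \<ge> z \<Longrightarrow> _\<close> by (auto simp: z0_def)
  \<comment> \<open>As \<open>\<rho> \<le> \<tau>\<close>, the gain
    \<open>2 * a - 2 * \<tau> - 3 * \<rho>\<close> of a cell is at least (3/2 - 5/16) b = 19/16 b.
    The choice of \<open>\<beta>\<close> limits the exceptional cells to a total length of
    \<open>T / 25\<close>.\<close>
  define \<tau> where "\<tau> = b / 16"
  define \<beta> where "\<beta> = \<delta> / (50 * b)"
  define \<rho> where "\<rho> = min \<tau> (\<beta> * \<tau> / 4)"
  have \<tau>: "\<tau> > 0" and \<beta>: "\<beta> > 0" using b \<delta> by (auto simp: \<tau>_def \<beta>_def)
  then have \<rho>: "\<rho> > 0" "\<rho> \<le> \<tau>" "4 * \<rho> \<le> \<beta> * \<tau>" by (auto simp: \<rho>_def)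
  obtain u0 where u0: "u0 \<ge> 0"
    "\<And>s t. u0 \<le> s \<Longrightarrow> s \<le> t \<Longrightarrow> t \<le> s + b \<Longrightarrow> Phi t - Phi s \<le> 2 * (t - s) + \<rho>"
    using Phi_diff_le[OF b \<rho>(1)] by blast
  obtain \<eta> t1 where \<eta>: "\<eta> > 0" "\<And>t. t1 \<le> t \<Longrightarrow> Phi (t + a) - Phi t < \<eta> \<Longrightarrow>
      (2 * a - \<rho>) * t \<le> (\<Sum>n\<in>nats_le (exp (t + a)). mangoldt n / n * (Phi (t + a - ln n) - Phi (t - ln n)))"
    using sparse_imp_large_pair_sum[OF a(1) \<rho>(1)] by blast
  define K where "K = (a + u0 + 16) * Phi (u0 + a)"
  \<comment> \<open>The argument for a cell also uses a window that starts in the preceding cell, so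
    the cell before \<open>q0\<close> must already lie beyond \<open>u0\<close>.\<close>
  obtain q0 :: nat where q0': "real q0 > u0 / b + 1" using reals_Archimedean2 by blast
  have q0: "q0 \<ge> 1" "(real q0 - 1) * b \<ge> u0"
  proof -
    have "real q0 > 1" using q0' u0 b by (smt (verit) divide_nonneg_pos)
    then show "q0 \<ge> 1" by simp
    show "(real q0 - 1) * b \<ge> u0" using q0' b by (simp add: field_simps)
  qed
  define T0 where "T0 = Max {t1, u0, z0, (8 * (2 * a + \<rho>) + K) / \<rho>, 10 * (8 + 2 * (z0 + b + q0 * b)), (q0 + 1) * b + z0}"
  have "\<not> (\<forall>t\<ge>T0. \<eta> \<le> Phi (t + a) - Phi t)"
    using sparse \<eta>(1) unfolding nonsparse_def a_def by blast
  then obtain T where T: "T \<ge> T0" "Phi (T + a) - Phi T < \<eta>" by (auto simp: not_le)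
  have "T \<ge> (8 * (2 * a + \<rho>) + K) / \<rho>" and T0: "T \<ge> t1" "T \<ge> u0" "T \<ge> z0"
    "T \<ge> 10 * (8 + 2 * (z0 + b + q0 * b))" "T \<ge> (q0 + 1) * b + z0"
    using T(1) by (auto simp: T0_def)
  then have T1: "8 * (2 * a + \<rho>) + K \<le> \<rho> * T" using \<rho> by (simp add: field_simps)
  have Tpos: "T \<ge> 0" using T0 u0 by linarith

  define w where "w n = (mangoldt n / real n :: real)" for n
  have w: "w n \<ge> 0" for n by (simp add: w_def mangoldt_nonneg)
  define D where "D n = Phi (T + a - ln (real n)) - Phi (T - ln (real n))" for n :: nat
  have Phi_w: "Phi t - Phi s = (\<Sum>n | 0 < n \<and> s < ln (real n) \<and> ln (real n) \<le> t. w n)" if "s \<le> t" for s t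
    using Phi_diff[OF that] by (simp add: w_def)
  define N1 N2 where "N1 = nats_le (exp (T - u0))" and "N2 = nats_le (exp (T + a)) - N1"
  have N1: "n \<in> N1 \<longleftrightarrow> 0 < n \<and> ln (real n) \<le> T - u0" for n
    by (simp add: N1_def mem_nats_le_exp)
  have fin: "finite N1" "finite N2" by (auto simp: N1_def N2_def)
  have D1: "D n \<le> 2 * a + \<rho>" if "n \<in> N1" for n
    using u0(2)[of "T - ln (real n)" "T + a - ln (real n)"] that a by (simp add: N1 D_def)
  have D2: "D n \<le> Phi (u0 + a)" if "n \<in> N2" for n
  proof -
    have "ln (real n) > T - u0" using that by (auto simp: N2_def N1 mem_nats_le_exp)
    then show ?thesis unfolding D_def using Phi_mono[of "T + a - ln (real n)" "u0 + a"] Phi_nonneg[of "T - ln (real n)"]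
      by linarith
  qed
  have W1: "sum w N1 \<le> T + 8"
    using Phi_mertens[of "T - u0"] T0 u0 unfolding abs_le_iff
    by (simp add: N1_def w_def Phi_def mangoldt_log_sum_def)
  have W2: "sum w N2 \<le> a + u0 + 16"
  proof -
    have "N2 = {n. 0 < n \<and> T - u0 < ln (real n) \<and> ln (real n) \<le> T + a}"
      by (auto simp: N2_def N1 mem_nats_le_exp)
    then have "sum w N2 = Phi (T + a) - Phi (T - u0)" using Phi_w[of "T - u0" "T + a"] u0 a by simp
    then show ?thesis using Phi_mertens[of "T - u0"] Phi_mertens[of "T + a"] T0 u0 a
      unfolding abs_le_iff by simp
  qed
  define B where "B = {n\<in>N1. D n < 2 * a - \<tau>}"
  \<comment> \<open>Markov's inequality: over \<open>N1\<close>, of total weight about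
    \<open>T\<close>, the mean of \<open>D\<close> is within a multiple of \<open>\<rho>\<close> of
    its upper bound \<open>2 * a + \<rho>\<close>, whereas every \<open>n\<close> in
    \<open>B\<close> falls short of that bound by more than \<open>\<tau>\<close>.\<close>
  have "sum w B \<le> \<beta> * T"
  proof -
    have sub: "N1 \<subseteq> nats_le (exp (T + a))"
      unfolding N1_def using u0 a by (intro nats_le_mono) auto
    have "(2 * a - \<rho>) * T \<le> (\<Sum>n\<in>nats_le (exp (T + a)). w n * D n)"
      using \<eta>(2)[OF T0(1) T(2)] by (simp add: w_def D_def)
    also have "\<dots> = (\<Sum>n\<in>N1. w n * D n) + (\<Sum>n\<in>N2. w n * D n)"
      unfolding N2_def by (subst sum.subset_diff[OF sub]) auto
    also have "(\<Sum>n\<in>N2. w n * D n) \<le> (\<Sum>n\<in>N2. w n * Phi (u0 + a))"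
      by (intro sum_mono mult_left_mono D2 w)
    also have "\<dots> = sum w N2 * Phi (u0 + a)" by (simp add: sum_distrib_right)
    also have "\<dots> \<le> K" unfolding K_def by (intro mult_right_mono W2 Phi_nonneg)
    finally have L: "(2 * a - \<rho>) * T \<le> (\<Sum>n\<in>N1. w n * D n) + K" by simp
    have "\<tau> * sum w B = (\<Sum>n\<in>B. w n * \<tau>)" by (simp add: sum_distrib_left mult.commute)
    also have "\<dots> \<le> (\<Sum>n\<in>B. w n * (2 * a + \<rho> - D n))"
      using \<rho> by (intro sum_mono mult_left_mono w) (auto simp: B_def)
    also have "\<dots> \<le> (\<Sum>n\<in>N1. w n * (2 * a + \<rho> - D n))"
    proof (rule sum_mono2[OF fin(1)])
      show "0 \<le> w n * (2 * a + \<rho> - D n)" if "n \<in> N1 - B" for n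
        using D1[of n] w[of n] that by simp
    qed (auto simp: B_def)
    also have "\<dots> = (\<Sum>n\<in>N1. (2 * a + \<rho>) * w n - w n * D n)" by (simp add: algebra_simps)
    also have "\<dots> = (2 * a + \<rho>) * sum w N1 - (\<Sum>n\<in>N1. w n * D n)"
      by (simp only: sum_distrib_left sum_subtractf)
    also have "\<dots> \<le> (2 * a + \<rho>) * (T + 8) - ((2 * a - \<rho>) * T - K)"
      using L W1 a \<rho> by (intro diff_mono mult_left_mono) auto
    also have "\<dots> = 2 * (\<rho> * T) + (8 * (2 * a + \<rho>) + K)" by (simp add: algebra_simps)
    also have "\<dots> \<le> 3 * (\<rho> * T)" using T1 by (simp add: algebra_simps)
    also have "\<dots> \<le> (4 * \<rho>) * T" using \<rho> Tpos by simp
    also have "\<dots> \<le> (\<beta> * \<tau>) * T" using \<rho> Tpos by (intro mult_right_mono) auto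
    finally have "\<tau> * sum w B \<le> \<tau> * (\<beta> * T)" by (simp add: mult_ac)
    then show ?thesis using \<tau> by simp
  qed

  define q1 where "q1 = nat \<lfloor>(T - z0) / b\<rfloor>"
  have q1: "real q1 * b \<le> T - z0" "T - z0 \<le> (real q1 + 1) * b" "q0 \<le> q1"
  proof -
    have nn: "(T - z0) / b \<ge> 0" using T0 b by simp
    have "real q1 \<le> (T - z0) / b" "(T - z0) / b \<le> real q1 + 1"
      unfolding q1_def using nn by (simp_all add: of_nat_floor)
    then show "real q1 * b \<le> T - z0" "T - z0 \<le> (real q1 + 1) * b" using b by (auto simp: field_simps)
    have "real q0 + 1 \<le> (T - z0) / b" using T0(5) b by (simp add: field_simps)
    then have "real q0 \<le> real q1" using \<open>(T - z0) / b \<le> real q1 + 1\<close> by linarith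
    then show "q0 \<le> q1" by simp
  qed
  \<comment> \<open>Two cells wide: the windows starting in cell \<open>q\<close> or in the one
    before it. Hence each \<open>n\<close> is counted for at most two values of
    \<open>q\<close>.\<close>
  define BQ where "BQ q = {n\<in>B. T - (real q + 1) * b < ln (real n) \<and> ln (real n) \<le> T - (real q - 1) * b}" for q :: nat
  define NF where "NF = {q\<in>{q0..<q1}. \<delta> \<le> sum w (BQ q)}"
  have finB: "finite B" using fin by (auto simp: B_def)
  have "\<delta> * card NF \<le> 2 * (\<beta> * T)"
  proof -
    have "\<delta> * card NF = (\<Sum>q\<in>NF. \<delta>)" by simp
    also have "\<dots> \<le> (\<Sum>q\<in>NF. sum w (BQ q))" by (intro sum_mono) (auto simp: NF_def)
    also have "\<dots> \<le> (\<Sum>q\<in>{q0..<q1}. sum w (BQ q))"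
      by (intro sum_mono2 sum_nonneg w) (auto simp: NF_def)
    also have "\<dots> = (\<Sum>q\<in>{q0..<q1}. \<Sum>n\<in>B. if n \<in> BQ q then w n else 0)"
    proof (rule sum.cong[OF refl])
      fix q
      have "B \<inter> BQ q = BQ q" by (auto simp: BQ_def)
      then show "sum w (BQ q) = (\<Sum>n\<in>B. if n \<in> BQ q then w n else 0)"
        using sum.inter_restrict[OF finB, of w "BQ q"] by simp
    qed
    also have "\<dots> = (\<Sum>n\<in>B. \<Sum>q\<in>{q0..<q1}. if n \<in> BQ q then w n else 0)"
      by (rule sum.swap)
    also have "\<dots> \<le> (\<Sum>n\<in>B. 2 * w n)"
    proof (rule sum_mono)
      fix n assume n: "n \<in> B"
      define y where "y = (T - ln (real n)) / b"
      have "{q\<in>{q0..<q1}. n \<in> BQ q} \<subseteq> {nat \<lfloor>y\<rfloor>, nat \<lfloor>y\<rfloor> + 1}"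
      proof
        fix q assume q: "q \<in> {q\<in>{q0..<q1}. n \<in> BQ q}"
        then have "real q - 1 \<le> y" "y < real q + 1"
          using b by (auto simp: BQ_def y_def field_simps)
        then have "\<lfloor>y\<rfloor> = int q \<or> \<lfloor>y\<rfloor> = int q - 1" by linarith
        moreover have "q \<ge> 1" using q q0 by auto
        ultimately show "q \<in> {nat \<lfloor>y\<rfloor>, nat \<lfloor>y\<rfloor> + 1}" by auto
      qed
      then have "card {q\<in>{q0..<q1}. n \<in> BQ q} \<le> card {nat \<lfloor>y\<rfloor>, nat \<lfloor>y\<rfloor> + 1}"
        by (intro card_mono) auto
      also have "\<dots> \<le> 2" by (simp add: card_insert_if)
      finally have "real (card {q\<in>{q0..<q1}. n \<in> BQ q}) * w n \<le> 2 * w n"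
        using w by (intro mult_right_mono) auto
      then show "(\<Sum>q\<in>{q0..<q1}. if n \<in> BQ q then w n else 0) \<le> 2 * w n"
        by (subst sum.inter_filter [symmetric]) auto
    qed
    also have "\<dots> \<le> 2 * (\<beta> * T)" using \<open>sum w B \<le> \<beta> * T\<close> by (simp add: sum_distrib_left [symmetric])
    finally show ?thesis .
  qed

  have fine: "19 / 16 * b \<le> Phi (real (Suc q) * b) - Phi (real q * b)" if q: "q \<in> {q0..<q1} - NF" for q
  proof -
    have qb: "(real q + 1) * b \<le> T - z0" "u0 \<le> (real q - 1) * b"
    proof -
      have "real q + 1 \<le> real q1" "real q0 \<le> real q" using q by auto
      then have "(real q + 1) * b \<le> real q1 * b" "(real q0 - 1) * b \<le> (real q - 1) * b"
        using b by (intro mult_right_mono; simp)+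
      then show "(real q + 1) * b \<le> T - z0" "u0 \<le> (real q - 1) * b" using q1 q0 by linarith+
    qed
    have good: "\<exists>n. 0 < n \<and> y < ln (real n) \<and> ln (real n) \<le> y + b \<and> 2 * a - \<tau> \<le> D n"
      if y: "T - (real q + 1) * b \<le> y" "y + b \<le> T - (real q - 1) * b" for y
    proof (rule ccontr)
      assume none: "\<not> ?thesis"
      have "\<delta> \<le> Phi (y + b) - Phi y" using y qb by (intro z0) linarith
      also have "\<dots> = (\<Sum>n | 0 < n \<and> y < ln (real n) \<and> ln (real n) \<le> y + b. w n)"
        using b by (intro Phi_w) auto
      also have "\<dots> \<le> sum w (BQ q)"
      proof (rule sum_mono2)
        show "finite (BQ q)" using finB by (simp add: BQ_def)
        show "{n. 0 < n \<and> y < ln (real n) \<and> ln (real n) \<le> y + b} \<subseteq> BQ q"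
        proof
          fix n assume n: "n \<in> {n. 0 < n \<and> y < ln (real n) \<and> ln (real n) \<le> y + b}"
          then have "D n < 2 * a - \<tau>" using none by (auto simp: not_le)
          moreover have "n \<in> N1" unfolding N1 using n y qb by auto
          ultimately show "n \<in> BQ q" using n y by (auto simp: BQ_def B_def)
        qed
      qed (rule w)
      finally show False using q by (auto simp: NF_def)
    qed
    \<comment> \<open>The largest member of \<open>G\<close> has the earliest saturated window of
      the cell. The saturated \<open>n'\<close> found within a further distance \<open>b\<close> is
      outside \<open>G\<close> by maximality, so its window starts in the preceding cell, as
      \<open>window_gain\<close> requires.\<close>
    define G where "G = {n. 0 < n \<and> T - (real q + 1) * b < ln (real n) \<and> ln (real n) \<le> T - real q * b \<and> 2 * a - \<tau> \<le> D n}"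
    have "finite G" by (rule finite_subset[OF _ finite_ln_interval[of "T - (real q + 1) * b" "T - real q * b"]]) (auto simp: G_def)
    moreover have "G \<noteq> {}" using good[of "T - (real q + 1) * b"] b by (auto simp: G_def algebra_simps)
    ultimately have "Max G \<in> G" "\<And>n. n \<in> G \<Longrightarrow> n \<le> Max G" by auto
    then obtain n where n: "n \<in> G" "\<And>n'. n' \<in> G \<Longrightarrow> n' \<le> n" by blast
    obtain n' where n': "0 < n'" "ln (real n) < ln (real n')" "ln (real n') \<le> ln (real n) + b" "2 * a - \<tau> \<le> D n'"
      using good[of "ln (real n)"] n(1) b by (auto simp: G_def algebra_simps)
    have "n' > n" using n' n(1) by (auto simp: G_def)
    then have "n' \<notin> G" using n(2)[of n'] by auto
    then have "ln (real n') > T - real q * b" using n' n(1) by (auto simp: G_def)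
    then have "2 * a - 2 * \<tau> - 3 * \<rho> \<le> Phi (real q * b + b) - Phi (real q * b)"
      using n(1) n' qb b \<rho> \<tau>
      by (intro window_gain[where s = "T - ln (real n)" and s' = "T - ln (real n')", OF Phi_mono u0(2)])
        (auto simp: G_def D_def algebra_simps a)
    then show ?thesis using \<rho> by (simp add: a_def \<tau>_def algebra_simps)
  qed
  have "19 / 16 * b * (real (q1 - q0) - card NF) = (\<Sum>q\<in>{q0..<q1} - NF. 19 / 16 * b)"
  proof -
    have "NF \<subseteq> {q0..<q1}" by (auto simp: NF_def)
    then have "real (card ({q0..<q1} - NF)) = real (q1 - q0) - card NF"
      using card_mono[of "{q0..<q1}" NF] by (subst card_Diff_subset) (auto intro: finite_subset)
    then show ?thesis by simp
  qed
  also have "\<dots> \<le> (\<Sum>q\<in>{q0..<q1} - NF. Phi (real (Suc q) * b) - Phi (real q * b))"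
    by (intro sum_mono fine)
  also have "\<dots> \<le> (\<Sum>q\<in>{q0..<q1}. Phi (real (Suc q) * b) - Phi (real q * b))"
  proof (rule sum_mono2)
    show "0 \<le> Phi (real (Suc q) * b) - Phi (real q * b)" for q
      using Phi_mono[of "real q * b" "real (Suc q) * b"] b by (simp add: mult_right_mono)
  qed auto
  also have "\<dots> = Phi (real q1 * b) - Phi (real q0 * b)"
    by (rule sum_Suc_diff') (use q1 in auto)
  also have "\<dots> \<le> Phi T"
    using Phi_mono[of "real q1 * b" T] Phi_nonneg[of "real q0 * b"] q1 z0 by linarith
  also have "\<dots> \<le> T + 8" using Phi_mertens[OF Tpos] unfolding abs_le_iff by simp
  finally have "19 / 16 * b * (real q1 - real q0 - card NF) \<le> T + 8"
    using q1 by (simp add: of_nat_diff)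
  then have "19 / 16 * (real q1 * b) - 19 / 16 * (real q0 * b) - 19 / 16 * (b * card NF) \<le> T + 8"
    by (simp add: algebra_simps)
  moreover have "b * card NF \<le> T / 25"
    using \<open>\<delta> * card NF \<le> 2 * (\<beta> * T)\<close> \<delta> b by (simp add: \<beta>_def field_simps)
  moreover have "real q1 * b \<ge> T - z0 - b" using q1 by (simp add: algebra_simps)
  moreover have "real q0 * b \<ge> 0" using b by simp
  \<comment> \<open>Up to a constant, the ordinary cells contribute 19/16 (1 - 1/25) T = 1.14 T,
    against the bound \<open>T + 8\<close>; the choice of \<open>T0\<close> keeps the constants
    within a tenth of \<open>T\<close>.\<close>
  ultimately show False using T0(4) b z0(1) by argo
qed

lemma nonsparse_all:
  assumes "a > 0"
  shows "nonsparse a"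
proof -
  have ns: "nonsparse ((3 / 4) ^ k * 17)" for k
  proof (induction k)
    case (Suc k)
    have "nonsparse (3 / 4 * ((3 / 4) ^ k * 17))" by (rule nonsparse_step[OF _ Suc]) simp
    then show ?case by (simp only: power_Suc mult.assoc)
  qed (use nonsparse_17 in simp)
  obtain k where "(3 / 4 :: real) ^ k < a / 17"
    using real_arch_pow_inv[of "a / 17" "3 / 4"] assms by auto
  then show ?thesis using nonsparse_mono[OF ns[of k], of a] by simp
qed

text \<open>Without primes the positive mass would rest on proper prime powers. There are at most
  \<open>sqrt (2 * x)\<close> of them in the interval, each of mass at most
  \<open>ln (2 * x) / x\<close>, so their total mass tends to 0.\<close>

theorem prime_in_short_interval:
  assumes "\<epsilon> > 0"
  obtains x0 where "\<And>x. x \<ge> x0 \<Longrightarrow> \<exists>p. prime p \<and> x < real p \<and> real p \<le> (1 + \<epsilon>) * x"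
proof -
  \<comment> \<open>The bound \<open>ln 2\<close> keeps the interval within a factor 2, so it
    contains at most one power of each prime and \<open>aprimedivisor\<close> is injective
    there.\<close>
  define a where "a = min (ln (1 + \<epsilon>)) (ln 2)"
  have a: "a > 0" "exp a \<le> 1 + \<epsilon>" "exp a \<le> 2"
    using assms by (auto simp: a_def min_def simp flip: ln_ge_iff)
  obtain \<delta> t0 where \<delta>: "\<delta> > 0" "\<And>t. t \<ge> t0 \<Longrightarrow> \<delta> \<le> Phi (t + a) - Phi t"
    using nonsparse_all[OF a(1)] unfolding nonsparse_def by blast
  have "((\<lambda>x::real. sqrt (2 * x) * (ln (2 * x) / x)) \<longlongrightarrow> 0) at_top" by real_asymp
  then have "eventually (\<lambda>x::real. sqrt (2 * x) * (ln (2 * x) / x) < \<delta>) at_top"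
    using \<delta>(1) by (rule order_tendstoD)
  then obtain x1 where x1: "\<And>x. x \<ge> x1 \<Longrightarrow> sqrt (2 * x) * (ln (2 * x) / x) < \<delta>"
    unfolding eventually_at_top_linorder by blast
  show ?thesis
  proof
    fix x assume x: "x \<ge> max 1 (max x1 (exp t0))"
    define A where "A = {n. 0 < n \<and> ln x < ln (real n) \<and> ln (real n) \<le> ln x + a}"
    have x': "x \<ge> 1" "ln x \<ge> t0" using x by (auto simp: ln_ge_iff)
    have A: "n \<in> A \<longleftrightarrow> x < real n \<and> real n \<le> exp a * x" for n
    proof (cases "n > 0")
      case True
      have "ln (real n) \<le> ln x + a \<longleftrightarrow> ln (real n) \<le> ln (exp a * x)"
        using x' by (simp add: ln_mult add.commute)
      also have "\<dots> \<longleftrightarrow> real n \<le> exp a * x" using True x' by (subst ln_le_cancel_iff) auto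
      finally show ?thesis using True x' by (auto simp: A_def)
    qed (use x' in \<open>auto simp: A_def\<close>)
    have finA: "finite A" unfolding A_def by (rule finite_ln_interval)
    show "\<exists>p. prime p \<and> x < real p \<and> real p \<le> (1 + \<epsilon>) * x"
    proof (rule ccontr)
      assume none: "\<not> ?thesis"
      have le: "exp a * x \<le> (1 + \<epsilon>) * x" "exp a * x \<le> 2 * x"
        using a x' by (intro mult_right_mono; simp)+
      have np: "\<not> prime n" if "n \<in> A" for n
        using none that order_trans[OF _ le(1)] A by blast
      have A2: "real n \<le> 2 * x" if "n \<in> A" for n
        using that order_trans[OF _ le(2)] A by blast
      define A' where "A' = {n\<in>A. primepow n}"
      have pp: "\<exists>k\<ge>2. prime (aprimedivisor n) \<and> n = aprimedivisor n ^ k" if n: "n \<in> A'" for n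
      proof -
        have "primepow n" using n by (simp add: A'_def)
        then obtain p k where pk: "prime p" "k > 0" "n = p ^ k"
          unfolding primepow_def by blast
        then have "aprimedivisor n = p" by (simp add: aprimedivisor_prime_power)
        moreover have "k \<noteq> 1" using pk np[of n] n by (auto simp: A'_def)
        ultimately show ?thesis using pk by (intro exI[of _ k]) auto
      qed
      have inj: "inj_on aprimedivisor A'"
      proof (rule linorder_inj_onI)
        fix m n assume mn: "m < n" "m \<in> A'" "n \<in> A'"
        show "aprimedivisor m \<noteq> aprimedivisor n"
        proof
          assume eq: "aprimedivisor m = aprimedivisor n"
          define p where "p = aprimedivisor m"
          obtain k l where kl: "m = p ^ k" "n = p ^ l" "prime p"
            using pp[OF mn(2)] pp[OF mn(3)] eq unfolding p_def by metis
          have "p \<ge> 2" using kl(3) by (rule prime_ge_2_nat)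
          then have "k < l" using mn(1) kl by (simp add: power_strict_increasing_iff)
          then have "p ^ Suc k \<le> n" unfolding kl(2) using \<open>p \<ge> 2\<close> by (intro power_increasing) auto
          moreover have "2 * m \<le> p ^ Suc k" using \<open>p \<ge> 2\<close> kl(1) by simp
          ultimately have "2 * real m \<le> real n" by linarith
          then show False using A2[of n] mn A[of m] by (auto simp: A'_def)
        qed
      qed auto
      have img: "aprimedivisor ` A' \<subseteq> nats_le (sqrt (2 * x))"
      proof safe
        fix n assume n: "n \<in> A'"
        obtain k where k: "k \<ge> 2" "prime (aprimedivisor n)" "n = aprimedivisor n ^ k"
          using pp[OF n] by blast
        have "aprimedivisor n ^ 2 \<le> n"
          using k prime_gt_0_nat[OF k(2)] power_increasing[of 2 k "aprimedivisor n"] by auto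
        then have "real (aprimedivisor n) ^ 2 \<le> 2 * x"
          using A2[of n] n by (simp add: A'_def flip: of_nat_power)
        then have "real (aprimedivisor n) \<le> sqrt (2 * x)" by (rule real_le_rsqrt)
        then show "aprimedivisor n \<in> nats_le (sqrt (2 * x))"
          using prime_gt_0_nat[OF k(2)] by (simp add: nats_le_def)
      qed
      have "\<delta> \<le> (\<Sum>n\<in>A. mangoldt n / n)"
        using \<delta>(2)[OF x'(2)] a by (subst (asm) Phi_diff) (auto simp: A_def)
      also have "\<dots> = (\<Sum>n\<in>A'. mangoldt n / n)"
        by (rule sum.mono_neutral_right[OF finA]) (auto simp: A'_def mangoldt_def)
      also have "\<dots> \<le> (\<Sum>n\<in>A'. ln (2 * x) / x)"
      proof (rule sum_mono)
        fix n assume n: "n \<in> A'"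
        then have n': "x < real n" "real n \<le> 2 * x" using A A2 by (auto simp: A'_def)
        have "mangoldt n \<le> ln (real n)" using n' x' by (intro mangoldt_le) auto
        also have "\<dots> \<le> ln (2 * x)" using n' x' by simp
        finally show "mangoldt n / real n \<le> ln (2 * x) / x"
          using n' x' by (intro frac_le) (auto intro: mangoldt_nonneg)
      qed
      also have "\<dots> = real (card A') * (ln (2 * x) / x)" by simp
      also have "\<dots> \<le> sqrt (2 * x) * (ln (2 * x) / x)"
      proof (rule mult_right_mono)
        have "card A' = card (aprimedivisor ` A')" using inj by (simp add: card_image)
        also have "\<dots> \<le> card (nats_le (sqrt (2 * x)))" using img by (intro card_mono) auto
        finally have "real (card A') \<le> real_of_int \<lfloor>sqrt (2 * x)\<rfloor>"
          using x' by (subst card_nats_le [symmetric]) auto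
        then show "real (card A') \<le> sqrt (2 * x)" by linarith
      qed (use x' in auto)
      also have "\<dots> < \<delta>" using x by (intro x1) auto
      finally show False by simp
    qed
  qed
qed

section \<open>Families with few comparable pairs\<close>

text \<open>Permutations encode maximal chains, by the sets of their initial segments. One whose
  chain passes through \<open>A\<close> and \<open>B\<close> is a concatenation of permutations of
  \<open>A\<close>, \<open>B - A\<close> and \<open>V - B\<close>.\<close>

lemma card_permutations_with_prefixes:
  assumes "finite V" "A \<subseteq> B" "B \<subseteq> V"
  shows "card {xs \<in> permutations_of_set V. set (take (card A) xs) = A \<and> set (take (card B) xs) = B} =
         fact (card A) * fact (card B - card A) * fact (card V - card B)"
    (is "card ?S = _")
proof -
  have fin: "finite A" "finite B" using assms by (auto dest: finite_subset)
  let ?D = "permutations_of_set A \<times> permutations_of_set (B - A) \<times> permutations_of_set (V - B)"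
  let ?f = "\<lambda>(a, b, c). a @ b @ c"
  have len: "length a = card A" if "a \<in> permutations_of_set A" for a and A :: "'a set"
    using that by (rule length_finite_permutations_of_set)
  have "inj_on ?f ?D"
    by (auto simp: inj_on_def dest!: len)
  moreover have "?f ` ?D = ?S"
  proof
    show "?f ` ?D \<subseteq> ?S"
    proof
      fix xs assume "xs \<in> ?f ` ?D"
      then obtain a b c where abc: "xs = a @ b @ c" "a \<in> permutations_of_set A"
        "b \<in> permutations_of_set (B - A)" "c \<in> permutations_of_set (V - B)" by auto
      have cd: "card B = card A + card (B - A)"
        using fin assms card_mono[of B A] by (simp add: card_Diff_subset)
      have "length a = card A" "length b = card (B - A)" using abc len by blast+
      then have "take (card A) xs = a" "take (card B) xs = a @ b"
        by (auto simp: abc(1) cd)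
      with abc assms show "xs \<in> ?S"
        by (auto simp: permutations_of_set_def)
    qed
    show "?S \<subseteq> ?f ` ?D"
    proof
      fix xs assume xs: "xs \<in> ?S"
      let ?a = "take (card A) xs" and ?b = "drop (card A) (take (card B) xs)" and ?c = "drop (card B) xs"
      have le: "card A \<le> card B" using fin assms by (intro card_mono)
      have d: "distinct xs" "set xs = V" using xs by (auto simp: permutations_of_set_def)
      have 1: "take (card A) (take (card B) xs) = ?a" using le by (simp add: min_def)
      have ab: "?a @ ?b = take (card B) xs"
        using append_take_drop_id[of "card A" "take (card B) xs"] unfolding 1 .
      have abc: "?a @ ?b @ ?c = xs"
        using append_take_drop_id[of "card B" xs] by (simp only: ab append.assoc [symmetric])
      have sa: "set ?a = A" and sab: "set (take (card B) xs) = B" using xs by auto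
      have "distinct (?a @ ?b)" unfolding ab using d by simp
      then have "set ?a \<inter> set ?b = {}" by (simp only: distinct_append)
      moreover have "set ?a \<union> set ?b = B" using arg_cong[OF ab, of set] sab by (simp only: set_append)
      ultimately have "set ?b = B - A" unfolding sa by blast
      moreover have "set ?c = V - B"
      proof -
        have "distinct (take (card B) xs @ ?c)" "set (take (card B) xs @ ?c) = V"
          using d by (simp_all only: append_take_drop_id)
        then have "B \<inter> set ?c = {}" "B \<union> set ?c = V"
          unfolding distinct_append set_append sab by blast+
        then show ?thesis by blast
      qed
      ultimately have "(?a, ?b, ?c) \<in> ?D" using d sa by (auto simp: permutations_of_set_def)
      then show "xs \<in> ?f ` ?D" using abc by (intro image_eqI[of _ _ "(?a, ?b, ?c)"]) simp_all
    qed
  qed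
  ultimately have "card ?S = card ?D" using card_image[of ?f ?D] by (simp only:)
  also have "\<dots> = fact (card A) * fact (card B - card A) * fact (card V - card B)"
    using fin assms by (simp add: card_cartesian_product card_Diff_subset)
  finally show ?thesis .
qed

lemma card_permutations_with_prefix:
  assumes "finite V" "A \<subseteq> V"
  shows "card {xs \<in> permutations_of_set V. set (take (card A) xs) = A} =
         fact (card A) * fact (card V - card A)"
proof -
  have "{xs \<in> permutations_of_set V. set (take (card A) xs) = A} =
        {xs \<in> permutations_of_set V. set (take (card A) xs) = A \<and> set (take (card V) xs) = V}"
    by (auto simp: permutations_of_set_def distinct_card)
  then show ?thesis using card_permutations_with_prefixes[OF assms(1,2)] by simp
qed

lemma le_binomial:
  assumes "0 < k" "k < n"
  shows "n \<le> n choose k"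
  using assms
proof (induction n arbitrary: k)
  case (Suc n)
  then obtain j where j: "k = Suc j" by (cases k) auto
  show ?case
  proof (cases "k = n")
    case True
    then show ?thesis using binomial_symmetric[of n "Suc n"] by simp
  next
    case False
    then have "n \<le> n choose k" using Suc by simp
    moreover have "n choose j > 0" using Suc.prems j by (intro zero_less_binomial) simp
    ultimately show ?thesis unfolding j binomial_Suc_Suc by linarith
  qed
qed simp

text \<open>On a random maximal chain, a member of \<open>G\<close> that is not the least one on the chain has a
  member of \<open>G\<close> below it, which for a given set happens with probability at most \<open>M / m\<close>.\<close>

lemma card_few_below:
  fixes M m :: nat
  assumes V: "finite V" and G: "G \<subseteq> Pow V" and m: "0 < m" "M < m"
    and size: "\<And>B. B \<in> G \<Longrightarrow> m \<le> card B"
    and below: "\<And>B. B \<in> G \<Longrightarrow> card {A \<in> G. A \<subset> B} \<le> M"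
  shows "real (card G) * (1 - M / m) \<le> real (card V choose (card V div 2))"
proof -
  define n where "n = card V"
  define \<Omega> where "\<Omega> = permutations_of_set V"
  define E where "E B = {xs \<in> \<Omega>. set (take (card B) xs) = B}" for B
  define below_set where "below_set B = {A \<in> G. A \<subset> B}" for B
  have fin: "finite \<Omega>" "card \<Omega> = fact n" "finite G"
    using V G by (auto simp: \<Omega>_def n_def intro: finite_subset)
  have finB: "finite B" "B \<subseteq> V" "card B \<le> n" if "B \<in> G" for B
    using that G V by (auto simp: n_def intro: finite_subset card_mono)
  have E: "card (E B) = fact (card B) * fact (n - card B)" if "B \<in> G" for B
    unfolding E_def \<Omega>_def n_def using card_permutations_with_prefix[OF V finB(2)[OF that]] by simp
  \<comment> \<open>Of the chains through \<open>B\<close>, one in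
    \<open>card B choose card A\<close> also passes through \<open>A\<close>. Since
    \<open>0 < m \<le> card A < card B\<close>, this binomial coefficient is at least
    \<open>card B\<close>, hence at least \<open>m\<close>.\<close>
  have EE: "m * card (E A \<inter> E B) \<le> card (E B)" if "B \<in> G" "A \<in> below_set B" for A B
  proof -
    have A: "A \<in> G" "A \<subset> B" using that by (auto simp: below_set_def)
    have lt: "card A < card B" using A finB that by (intro psubset_card_mono)
    have "E A \<inter> E B = {xs \<in> permutations_of_set V. set (take (card A) xs) = A \<and> set (take (card B) xs) = B}"
      by (auto simp: E_def \<Omega>_def)
    then have eq: "card (E A \<inter> E B) = fact (card A) * fact (card B - card A) * fact (n - card B)"
      using card_permutations_with_prefixes[OF V _ finB(2)[OF that(1)], of A] A by (simp add: n_def)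
    have "m \<le> card B choose card A"
      using size[OF A(1)] size[OF that(1)] lt m le_binomial[of "card A" "card B"] by linarith
    then have "m * (fact (card A) * fact (card B - card A)) \<le>
        (card B choose card A) * (fact (card A) * fact (card B - card A))"
      by (rule mult_right_mono) simp
    also have "\<dots> = fact (card B)" using binomial_fact_lemma[of "card A" "card B"] lt by (simp add: mult_ac)
    finally have "m * (fact (card A) * fact (card B - card A)) * fact (n - card B) \<le> fact (card B) * fact (n - card B)"
      by (rule mult_right_mono) simp
    then show ?thesis by (simp add: eq E[OF that(1)] mult_ac)
  qed
  have chain: "card {B \<in> G. xs \<in> E B} \<le> 1 + (\<Sum>B\<in>G. card {A \<in> below_set B. xs \<in> E A \<inter> E B})" for xs
  proof (cases "{B \<in> G. xs \<in> E B} = {}")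
    case False
    let ?X = "{B \<in> G. xs \<in> E B}"
    have finX: "finite ?X" using fin by simp
    obtain B0 where B0: "B0 \<in> ?X" "\<And>B. B \<in> ?X \<Longrightarrow> card B0 \<le> card B"
      using ex_has_least_nat[of "\<lambda>B. B \<in> ?X" _ card] False by blast
    have "B0 \<in> below_set B" if "B \<in> ?X" "B \<noteq> B0" for B
    proof -
      have "set (take (card B0) xs) \<subseteq> set (take (card B) xs)"
        by (rule set_take_subset_set_take) (use B0 that in auto)
      then show ?thesis using B0(1) that by (auto simp: below_set_def E_def)
    qed
    note lower = this
    have "1 \<le> card {A \<in> below_set B. xs \<in> E A \<inter> E B}" if B: "B \<in> ?X - {B0}" for B
    proof -
      have "B0 \<in> {A \<in> below_set B. xs \<in> E A \<inter> E B}" using lower[of B] B B0(1) by auto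
      moreover have "finite {A \<in> below_set B. xs \<in> E A \<inter> E B}" using fin by (simp add: below_set_def)
      ultimately have "card {A \<in> below_set B. xs \<in> E A \<inter> E B} > 0" by (subst card_gt_0_iff) blast
      then show ?thesis by simp
    qed
    then have "(\<Sum>B\<in>?X - {B0}. 1) \<le> (\<Sum>B\<in>?X - {B0}. card {A \<in> below_set B. xs \<in> E A \<inter> E B})"
      by (intro sum_mono)
    also have "\<dots> \<le> (\<Sum>B\<in>G. card {A \<in> below_set B. xs \<in> E A \<inter> E B})"
      using fin by (intro sum_mono2) auto
    finally have "card (?X - {B0}) \<le> (\<Sum>B\<in>G. card {A \<in> below_set B. xs \<in> E A \<inter> E B})" by simp
    moreover have "card ?X \<le> 1 + card (?X - {B0})" using card_Diff_singleton[OF B0(1)] by linarith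
    ultimately show ?thesis by linarith
  next
    case True
    then show ?thesis by (simp only: card.empty le0)
  qed
  have count: "(\<Sum>xs\<in>\<Omega>. card {Y \<in> H. xs \<in> f Y}) = (\<Sum>Y\<in>H. card (f Y))"
    if "finite H" "\<And>Y. Y \<in> H \<Longrightarrow> f Y \<subseteq> \<Omega>" for H :: "'a set set" and f
  proof -
    have "(\<Sum>xs\<in>\<Omega>. card {Y \<in> H. xs \<in> f Y}) = (\<Sum>xs\<in>\<Omega>. \<Sum>Y\<in>H. if xs \<in> f Y then 1 else 0)"
      using that(1) by (simp add: sum.inter_filter [symmetric])
    also have "\<dots> = (\<Sum>Y\<in>H. \<Sum>xs\<in>\<Omega>. if xs \<in> f Y then 1 else 0)" by (rule sum.swap)
    also have "\<dots> = (\<Sum>Y\<in>H. card (f Y))"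
    proof (intro sum.cong refl)
      fix Y assume "Y \<in> H"
      then have "{xs \<in> \<Omega>. xs \<in> f Y} = f Y" using that(2) by blast
      then show "(\<Sum>xs\<in>\<Omega>. if xs \<in> f Y then 1 else 0) = card (f Y)"
        using fin(1) by (simp add: sum.inter_filter [symmetric])
    qed
    finally show ?thesis .
  qed
  \<comment> \<open>This is \<open>fact n\<close> times the mean number of members of
    \<open>G\<close> on a random chain. The excess over one is bounded by the number of comparable
    pairs on the chain, which gives \<open>W * (1 - M / m) \<le> fact n\<close>.\<close>
  define W where "W = (\<Sum>B\<in>G. card (E B))"
  have "W = (\<Sum>xs\<in>\<Omega>. card {B \<in> G. xs \<in> E B})"
    unfolding W_def by (rule count [symmetric]) (auto simp: fin E_def)
  also have "\<dots> \<le> (\<Sum>xs\<in>\<Omega>. 1 + (\<Sum>B\<in>G. card {A \<in> below_set B. xs \<in> E A \<inter> E B}))"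
    by (intro sum_mono chain)
  also have "\<dots> = (\<Sum>xs\<in>\<Omega>. 1) + (\<Sum>xs\<in>\<Omega>. \<Sum>B\<in>G. card {A \<in> below_set B. xs \<in> E A \<inter> E B})"
    by (rule sum.distrib)
  also have "(\<Sum>xs\<in>\<Omega>. 1) = (fact n :: nat)" by (simp add: fin)
  also have "(\<Sum>xs\<in>\<Omega>. \<Sum>B\<in>G. card {A \<in> below_set B. xs \<in> E A \<inter> E B}) =
      (\<Sum>B\<in>G. \<Sum>xs\<in>\<Omega>. card {A \<in> below_set B. xs \<in> E A \<inter> E B})"
    by (rule sum.swap)
  also have "(\<Sum>B\<in>G. \<Sum>xs\<in>\<Omega>. card {A \<in> below_set B. xs \<in> E A \<inter> E B}) = (\<Sum>B\<in>G. \<Sum>A\<in>below_set B. card (E A \<inter> E B))"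
    by (intro sum.cong refl count) (auto simp: below_set_def fin E_def)
  finally have W: "W \<le> fact n + (\<Sum>B\<in>G. \<Sum>A\<in>below_set B. card (E A \<inter> E B))" .
  have "m * (\<Sum>B\<in>G. \<Sum>A\<in>below_set B. card (E A \<inter> E B)) = (\<Sum>B\<in>G. \<Sum>A\<in>below_set B. m * card (E A \<inter> E B))"
    by (simp add: sum_distrib_left)
  also have "\<dots> \<le> (\<Sum>B\<in>G. \<Sum>A\<in>below_set B. card (E B))" by (intro sum_mono EE)
  also have "\<dots> = (\<Sum>B\<in>G. card (below_set B) * card (E B))" by simp
  also have "\<dots> \<le> (\<Sum>B\<in>G. M * card (E B))"
    using below by (intro sum_mono mult_right_mono) (auto simp: below_set_def)
  also have "\<dots> = M * W" by (simp add: W_def sum_distrib_left)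
  finally have "m * W \<le> m * fact n + M * W"
    using mult_left_mono[OF W, of m] by (simp add: algebra_simps)
  then have "real (m * W) \<le> real (m * fact n + M * W)" by (simp only: of_nat_le_iff)
  then have "real W * (1 - M / m) \<le> fact n" using m by (simp add: field_simps)
  moreover have "real (card G) * fact n \<le> W * real (n choose (n div 2))"
  proof -
    \<comment> \<open>As in the LYM inequality, the middle binomial coefficient bounds below the
      number of chains through a single set.\<close>
    have "fact n \<le> card (E B) * (n choose (n div 2))" if "B \<in> G" for B
    proof -
      have "fact n = card (E B) * (n choose card B)"
        using binomial_fact_lemma[OF finB(3)[OF that]] E[OF that] by simp
      also have "\<dots> \<le> card (E B) * (n choose (n div 2))" by (intro mult_left_mono binomial_maximum) simp
      finally show ?thesis .
    qed
    then have "(\<Sum>B\<in>G. fact n) \<le> (\<Sum>B\<in>G. card (E B) * (n choose (n div 2)))" by (intro sum_mono)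
    then have "card G * fact n \<le> W * (n choose (n div 2))" by (simp add: W_def sum_distrib_right)
    then have "real (card G * fact n) \<le> real (W * (n choose (n div 2)))" by (simp only: of_nat_le_iff)
    then show ?thesis by simp
  qed
  then have "real (card G) * fact n * (1 - M / m) \<le> W * real (n choose (n div 2)) * (1 - M / m)"
    using m by (intro mult_right_mono) (auto simp: field_simps)
  moreover have "real W * (1 - M / m) * real (n choose (n div 2)) \<le> fact n * real (n choose (n div 2))"
    using \<open>real W * (1 - M / m) \<le> fact n\<close> by (intro mult_right_mono) auto
  ultimately have "real (card G) * fact n * (1 - M / m) \<le> fact n * real (n choose (n div 2))"
    by (simp only: mult_ac)
  then have "fact n * (real (card G) * (1 - M / m)) \<le> fact n * real (n choose (n div 2))"
    by (simp only: mult_ac)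
  then show ?thesis by (simp add: n_def)
qed

text \<open>\<open>card_few_below\<close> applies to the members with few sets below them and, after
  complementation, to those with few above. It requires sets of at least \<open>m\<close> elements,
  so the lowest and the highest layers are counted separately.\<close>

lemma card_few_below_or_above:
  fixes M m n :: nat
  assumes F: "F \<subseteq> Pow {1..n}" and m: "0 < m" "M < m"
    and few: "\<And>B. B \<in> F \<Longrightarrow> card {A \<in> F. A \<subset> B} \<le> M \<or> card {C \<in> F. B \<subset> C} \<le> M"
  shows "real (card F) \<le> 2 * real (n choose (n div 2)) / (1 - M / m) + 2 * real (\<Sum>k<m. n choose k)"
proof -
  let ?V = "{1..n}"
  define FL where "FL = {B \<in> F. m \<le> card B \<and> card {A \<in> F. A \<subset> B} \<le> M}"
  define FU where "FU = {B \<in> F. m + card B \<le> n \<and> card {C \<in> F. B \<subset> C} \<le> M}"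
  define T1 where "T1 = {X. X \<subseteq> ?V \<and> card X < m}"
  define T2 where "T2 = {X. X \<subseteq> ?V \<and> n < m + card X}"
  have finF: "finite F" using F by (rule finite_subset) simp
  have pos: "1 - M / m > 0" using m by (simp add: field_simps)
  have L: "real (card FL) * (1 - M / m) \<le> real (n choose (n div 2))"
  proof -
    have few: "card {A \<in> FL. A \<subset> B} \<le> M" if "B \<in> FL" for B
    proof -
      have "card {A \<in> FL. A \<subset> B} \<le> card {A \<in> F. A \<subset> B}"
        using finF by (intro card_mono) (auto simp: FL_def)
      then show ?thesis using that by (auto simp: FL_def)
    qed
    have "real (card FL) * (1 - M / m) \<le> real (card ?V choose (card ?V div 2))"
    proof (rule card_few_below[OF _ _ m _ few])
      show "FL \<subseteq> Pow ?V" using F by (auto simp: FL_def)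
      show "m \<le> card B" if "B \<in> FL" for B using that by (simp add: FL_def)
    qed simp
    then show ?thesis by simp
  qed
  define cp where "cp B = ?V - B" for B
  have cp: "cp (cp B) = B" "card (cp B) = n - card B" if "B \<subseteq> ?V" for B
    using that finite_subset[OF that] by (auto simp: cp_def card_Diff_subset)
  have inj: "inj_on cp F" by (rule inj_on_inverseI[of _ cp]) (use cp(1) F in blast)
  have U: "real (card FU) * (1 - M / m) \<le> real (n choose (n div 2))"
  proof -
    have sub: "FU \<subseteq> F" by (auto simp: FU_def)
    have few: "card {A \<in> cp ` FU. A \<subset> B} \<le> M" if B: "B \<in> cp ` FU" for B
    proof -
      obtain D where D: "D \<in> FU" "B = cp D" using B by blast
      have "{A \<in> cp ` FU. A \<subset> B} \<subseteq> cp ` {C \<in> F. D \<subset> C}"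
      proof
        fix A assume "A \<in> {A \<in> cp ` FU. A \<subset> B}"
        then obtain C where C: "C \<in> FU" "A = cp C" "cp C \<subset> cp D" using D by blast
        then have V: "C \<subseteq> ?V" "D \<subseteq> ?V" using F sub D(1) by blast+
        have "cp (cp D) \<subseteq> cp (cp C)" using C(3) unfolding cp_def[of "cp D"] cp_def[of "cp C"] by blast
        then have "D \<subset> C" using C(3) cp(1)[OF V(1)] cp(1)[OF V(2)] by auto
        then show "A \<in> cp ` {C \<in> F. D \<subset> C}" using C sub by blast
      qed
      then have "card {A \<in> cp ` FU. A \<subset> B} \<le> card (cp ` {C \<in> F. D \<subset> C})"
        using finF by (intro card_mono) auto
      also have "\<dots> \<le> card {C \<in> F. D \<subset> C}" using finF by (intro card_image_le) auto
      also have "\<dots> \<le> M" using D by (auto simp: FU_def)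
      finally show ?thesis .
    qed
    have size: "m \<le> card B" if B: "B \<in> cp ` FU" for B
    proof -
      obtain D where D: "D \<in> FU" "B = cp D" using B by blast
      then have "D \<subseteq> ?V" using sub F by blast
      then show ?thesis using cp(2)[of D] D by (auto simp: FU_def)
    qed
    have "real (card (cp ` FU)) * (1 - M / m) \<le> real (card ?V choose (card ?V div 2))"
    proof (rule card_few_below[OF _ _ m size few])
      show "cp ` FU \<subseteq> Pow ?V" unfolding cp_def by blast
    qed simp
    moreover have "card (cp ` FU) = card FU" by (rule card_image) (rule inj_on_subset[OF inj sub])
    ultimately show ?thesis by simp
  qed
  have bin: "card {X. X \<subseteq> ?V \<and> card X < m} = (\<Sum>k<m. n choose k)"
  proof -
    have "{X. X \<subseteq> ?V \<and> card X < m} = (\<Union>k<m. {X. X \<subseteq> ?V \<and> card X = k})" by auto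
    also have "card \<dots> = (\<Sum>k<m. card {X. X \<subseteq> ?V \<and> card X = k})"
      by (rule card_UN_disjoint) auto
    also have "\<dots> = (\<Sum>k<m. n choose k)"
      by (intro sum.cong refl, subst n_subsets) auto
    finally show ?thesis .
  qed
  have "card T2 \<le> card ((-) ?V ` T1)"
  proof (rule card_mono)
    show "T2 \<subseteq> (-) ?V ` T1"
    proof
      fix X assume X: "X \<in> T2"
      then have XV: "X \<subseteq> ?V" by (simp add: T2_def)
      then have "card X \<le> n" using card_mono[of ?V X] by simp
      then have "cp X \<in> T1" using X cp(2)[OF XV] by (auto simp: T1_def T2_def cp_def)
      moreover have "X = ?V - cp X" using XV by (auto simp: cp_def)
      ultimately show "X \<in> (-) ?V ` T1" by blast
    qed
  qed (simp add: T1_def)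
  also have "\<dots> \<le> card T1" by (rule card_image_le) (simp add: T1_def)
  finally have T: "card T2 \<le> (\<Sum>k<m. n choose k)" "card T1 = (\<Sum>k<m. n choose k)" using bin by (auto simp: T1_def)
  have "F \<subseteq> (FL \<union> FU) \<union> (T1 \<union> T2)"
  proof
    fix B assume "B \<in> F"
    then show "B \<in> (FL \<union> FU) \<union> (T1 \<union> T2)"
      using F few[of B] by (cases "card B < m"; cases "n < m + card B") (auto simp: FL_def FU_def T1_def T2_def)
  qed
  then have "card F \<le> card ((FL \<union> FU) \<union> (T1 \<union> T2))"
    using finF by (intro card_mono) (auto simp: FL_def FU_def T1_def T2_def)
  also have "\<dots> \<le> (card FL + card FU) + (card T1 + card T2)"
    by (intro order_trans[OF card_Un_le] add_mono card_Un_le)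
  finally have "real (card F) \<le> card FL + card FU + 2 * real (\<Sum>k<m. n choose k)" using T by linarith
  moreover have "real (card FL) \<le> real (n choose (n div 2)) / (1 - M / m)"
    "real (card FU) \<le> real (n choose (n div 2)) / (1 - M / m)"
    using L U pos by (simp_all add: pos_le_divide_eq)
  ultimately show ?thesis by simp
qed

text \<open>Fixed lower layers are of polynomial size, while the middle one has at least 2^n / (n +
  1) sets.\<close>

lemma binomial_tail_negligible:
  "(\<lambda>n. real (\<Sum>k<m. n choose k) / real (n choose (n div 2))) \<longlonglongrightarrow> 0"
proof (rule tendsto_sandwich[where f = "\<lambda>_. 0"])
  show "(\<lambda>n. real m * (real n ^ m * (real n + 1) / 2 ^ n)) \<longlonglongrightarrow> 0" by real_asymp
  show "\<forall>\<^sub>F n in sequentially. real (\<Sum>k<m. n choose k) / real (n choose (n div 2)) \<le>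
     real m * (real n ^ m * (real n + 1) / 2 ^ n)"
    using eventually_gt_at_top[of 0]
  proof eventually_elim
    case (elim n)
    have "n choose k \<le> n ^ m" if "k < m" for k
    proof (cases "k \<le> n")
      case True
      have "n choose k \<le> n ^ k" by (rule binomial_le_pow[OF True])
      also have "\<dots> \<le> n ^ m" using that elim by (intro power_increasing) auto
      finally show ?thesis .
    qed (simp add: binomial_eq_0)
    then have "(\<Sum>k<m. n choose k) \<le> (\<Sum>k<m. n ^ m)" by (intro sum_mono) auto
    then have "(\<Sum>k<m. n choose k) \<le> m * n ^ m" by simp
    then have "real (\<Sum>k<m. n choose k) \<le> real (m * n ^ m)" by (simp only: of_nat_le_iff)
    then have 1: "real (\<Sum>k<m. n choose k) \<le> real m * real n ^ m" by simp
    have "2 ^ n = (\<Sum>k\<le>n. n choose k)" by (simp add: choose_row_sum)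
    also have "\<dots> \<le> (\<Sum>k\<le>n. n choose (n div 2))" by (intro sum_mono binomial_maximum)
    finally have "2 ^ n \<le> (n + 1) * (n choose (n div 2))" by simp
    then have "real (2 ^ n) \<le> real ((n + 1) * (n choose (n div 2)))" by (simp only: of_nat_le_iff)
    then have 2: "2 ^ n \<le> (real n + 1) * real (n choose (n div 2))" by (simp add: algebra_simps)
    have pos: "real (n choose (n div 2)) > 0" by simp
    have "real (\<Sum>k<m. n choose k) * 2 ^ n \<le> (real m * real n ^ m) * ((real n + 1) * real (n choose (n div 2)))"
      by (rule mult_mono[OF 1 2]) auto
    then show ?case using pos by (simp add: field_simps)
  qed
  show "\<forall>\<^sub>F n in sequentially. 0 \<le> real (\<Sum>k<m. n choose k) / real (n choose (n div 2))"
    by (intro always_eventually allI divide_nonneg_nonneg of_nat_0_le_iff)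
qed (rule tendsto_const)

text \<open>With more than \<open>M\<close> members on both sides of \<open>B\<close>, the vertices
  can be placed injectively below \<open>B\<close> and the edges above it; then every vertex lies
  below every edge, which is more than the poset demands.\<close>

lemma weak_free_P_K_few_below_or_above:
  fixes F :: "'b set set"
  assumes free: "weak_free (P_K t) F" and "finite F" "B \<in> F"
    and M: "M = t + card (complete_edges {1..t})"
  shows "card {A \<in> F. A \<subset> B} \<le> M \<or> card {C \<in> F. B \<subset> C} \<le> M"
proof (rule ccontr)
  assume "\<not> ?thesis"
  then have big: "card {1..t} \<le> card {A \<in> F. A \<subset> B}" "card (complete_edges {1..t}) \<le> card {C \<in> F. B \<subset> C}"
    using M by auto
  have finE: "finite (complete_edges {1..t})" by (simp add: complete_edges_def)
  obtain f where f: "inj_on f {1..t}" "f ` {1..t} \<subseteq> {A \<in> F. A \<subset> B}"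
    using card_le_inj[OF _ _ big(1)] \<open>finite F\<close> by auto
  obtain g where g: "inj_on g (complete_edges {1..t})" "g ` complete_edges {1..t} \<subseteq> {C \<in> F. B \<subset> C}"
    using card_le_inj[OF _ _ big(2)] \<open>finite F\<close> finE by auto
  define \<psi> where "\<psi> = case_sum f g"
  have fst: "fst (P_K t) = {1..t} <+> complete_edges {1..t}" by (simp add: P_K_def incidence_poset_def)
  have ne: "f v \<noteq> g e" if "v \<in> {1..t}" "e \<in> complete_edges {1..t}" for v e
  proof -
    have "f v \<in> {A \<in> F. A \<subset> B}" "g e \<in> {C \<in> F. B \<subset> C}" using f(2) g(2) that by blast+
    then show ?thesis by blast
  qed
  have inj: "inj_on \<psi> (fst (P_K t))"
  proof (rule inj_onI)
    fix p q assume "p \<in> fst (P_K t)" "q \<in> fst (P_K t)" "\<psi> p = \<psi> q"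
    then show "p = q" unfolding fst
      by (cases p; cases q)
        (simp_all add: Plus_def image_iff \<psi>_def ne ne [symmetric] inj_on_eq_iff[OF f(1)] inj_on_eq_iff[OF g(1)] del: atLeastAtMost_iff)
  qed
  have "weak_copy (P_K t) (\<psi> ` fst (P_K t))"
    unfolding weak_copy_def
  proof (intro exI[of _ \<psi>] conjI ballI impI)
    show "bij_betw \<psi> (fst (P_K t)) (\<psi> ` fst (P_K t))" using inj by (simp add: bij_betw_def)
    fix p q assume pq: "p \<in> fst (P_K t)" "q \<in> fst (P_K t)" "(p, q) \<in> snd (P_K t)"
    then consider "p = q" | v e where "p = Inl v" "q = Inr e" "v \<in> {1..t}" "e \<in> complete_edges {1..t}"
      by (auto simp: P_K_def incidence_poset_def)
    then show "\<psi> p \<subseteq> \<psi> q"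
    proof cases
      case 2
      then have "f v \<in> {A \<in> F. A \<subset> B}" "g e \<in> {C \<in> F. B \<subset> C}" using f(2) g(2) by blast+
      then have "f v \<subseteq> g e" by blast
      then show ?thesis using 2 by (simp add: \<psi>_def)
    qed auto
  qed
  moreover have "\<psi> ` fst (P_K t) \<subseteq> F" using f(2) g(2) unfolding fst by (auto simp: \<psi>_def)
  ultimately show False using free unfolding weak_free_def by blast
qed

section \<open>Extremal families and the upper bound on the density\<close>

lemma La_attained:
  assumes "fst P \<noteq> {}"
  obtains F where "F \<subseteq> Pow {1..n}" "weak_free P F" "La n P = card F"
proof -
  let ?S = "{card F | F. F \<subseteq> Pow {1..n} \<and> weak_free P F}"
  have "finite ?S" by (rule finite_subset[of _ "card ` Pow (Pow {1..n})"]) auto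
  moreover have "weak_free P ({} :: nat set set)"
    using assms by (auto simp: weak_free_def weak_copy_def bij_betw_def)
  then have "?S \<noteq> {}" by blast
  ultimately have "La n P \<in> ?S" unfolding La_def by (rule Max_in)
  then show ?thesis using that by blast
qed

lemma card_le_La:
  assumes "F \<subseteq> Pow {1..n}" "weak_free P F"
  shows "card F \<le> La n P"
  unfolding La_def
  by (rule Max_ge) (use assms in \<open>auto intro: finite_subset[of _ "card ` Pow (Pow {1..n})"]\<close>)

text \<open>For \<open>c > 2\<close> the threshold \<open>m\<close> is fixed so large that
  \<open>2 / (1 - M / m) < c\<close>; as \<open>n\<close> grows, the layers cut off by
  \<open>m\<close> are negligible.\<close>

lemma pi_lower_P_K_le_2:
  assumes "t > 0"
  shows "pi_lower (P_K t) \<le> 2"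
proof -
  define M where "M = t + card (complete_edges {1..t})"
  have ne: "fst (P_K t) \<noteq> {}" using assms by (auto simp: P_K_def incidence_poset_def)
  have "pi_lower (P_K t) \<le> ereal c" if c: "c > 2" for c
  proof -
    have "(\<lambda>m. 2 / (1 - real M / real m)) \<longlonglongrightarrow> 2 / (1 - 0)"
      by (intro tendsto_intros lim_const_over_n) auto
    then have "eventually (\<lambda>m. 2 / (1 - real M / real m) < c) sequentially"
      using c by (intro order_tendstoD) auto
    then have "eventually (\<lambda>m. 2 / (1 - real M / real m) < c \<and> m > M) sequentially"
      using eventually_gt_at_top[of M] by eventually_elim auto
    then obtain m where m: "2 / (1 - real M / real m) < c" "m > M"
      by (auto simp: eventually_sequentially)
    have "(\<lambda>n. 2 / (1 - real M / real m) + 2 * (real (\<Sum>k<m. n choose k) / real (n choose (n div 2))))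
        \<longlonglongrightarrow> 2 / (1 - real M / real m) + 2 * 0"
      by (intro tendsto_intros binomial_tail_negligible)
    then have "eventually (\<lambda>n. 2 / (1 - real M / real m) + 2 * (real (\<Sum>k<m. n choose k) / real (n choose (n div 2))) < c) sequentially"
      using m by (intro order_tendstoD) auto
    then have "eventually (\<lambda>n. ereal (real (La n (P_K t)) / real (n choose (n div 2))) \<le> ereal c) sequentially"
    proof eventually_elim
      case (elim n)
      obtain F where F: "F \<subseteq> Pow {1..n}" "weak_free (P_K t) F" "La n (P_K t) = card F"
        using La_attained[OF ne] by blast
      have "finite F" using F(1) by (rule finite_subset) simp
      have C: "real (n choose (n div 2)) > 0" by simp
      have "real (card F) \<le> 2 * real (n choose (n div 2)) / (1 - M / m) + 2 * real (\<Sum>k<m. n choose k)"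
        using weak_free_P_K_few_below_or_above[OF F(2) \<open>finite F\<close> _ M_def] m
        by (intro card_few_below_or_above[OF F(1)]) auto
      then have "real (card F) / real (n choose (n div 2)) \<le>
        (2 * real (n choose (n div 2)) / (1 - M / m) + 2 * real (\<Sum>k<m. n choose k)) / real (n choose (n div 2))"
        by (rule divide_right_mono) simp
      also have "\<dots> = 2 / (1 - real M / real m) + 2 * (real (\<Sum>k<m. n choose k) / real (n choose (n div 2)))"
        using C by (simp add: add_divide_distrib)
      finally show ?case using elim F(3) by simp
    qed
    then have "limsup (\<lambda>n. ereal (real (La n (P_K t)) / real (n choose (n div 2)))) \<le> ereal c"
      by (rule Limsup_bounded)
    then show ?thesis unfolding pi_lower_def
      by (rule order_trans[OF Liminf_le_Limsup[OF trivial_limit_sequentially]])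
  qed
  note le = this
  show ?thesis
  proof (rule ereal_le_epsilon2)
    fix e :: real assume "0 < e"
    then have "pi_lower (P_K t) \<le> ereal (2 + e)" by (intro le) simp
    also have "ereal (2 + e) = ereal 2 + ereal e" by simp
    finally show "pi_lower (P_K t) \<le> 2 + ereal e" by simp
  qed
qed

section \<open>Families from random vectors over a prime field\<close>

text \<open>A labelling \<open>\<phi>\<close> assigns to \<open>x\<close> the vector \<open>(\<phi> (x, i))\<^sub>i\<close> with \<open>i < d\<close>, over the integers modulo \<open>p\<close>.\<close>

definition vanishes :: "nat \<Rightarrow> nat \<Rightarrow> (nat \<times> nat \<Rightarrow> int) \<Rightarrow> nat set \<Rightarrow> (nat \<Rightarrow> int) \<Rightarrow> bool" where
  "vanishes p d \<phi> B c \<longleftrightarrow> (\<forall>i<d. int p dvd (\<Sum>x\<in>B. c x * \<phi> (x, i)))"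

text \<open>Linear independence over the field with \<open>p\<close> elements, with integers as
  representatives, so that divisibility by \<open>p\<close> stands for being zero.\<close>

definition indep :: "nat \<Rightarrow> nat \<Rightarrow> (nat \<times> nat \<Rightarrow> int) \<Rightarrow> nat set \<Rightarrow> bool" where
  "indep p d \<phi> B \<longleftrightarrow> (\<forall>c. vanishes p d \<phi> B c \<longrightarrow> (\<forall>x\<in>B. int p dvd c x))"

abbreviation residues_below :: "nat \<Rightarrow> int set" where
  "residues_below p \<equiv> {0..<int p}"

lemma residues_below_eqI:
  assumes "a \<in> residues_below p" "b \<in> residues_below p" "int p dvd a - b"
  shows "a = b"
proof -
  have "a mod int p = b mod int p" using assms(3) by (simp add: mod_eq_dvd_iff)
  then show ?thesis using assms(1,2) by simp
qed

text \<open>The coefficient of \<open>x0\<close> is invertible modulo \<open>p\<close>, so a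
  vanishing combination determines the vector at \<open>x0\<close> from all the others, and
  restriction away from \<open>x0\<close> is injective.\<close>

lemma card_vanishing_labellings:
  assumes p: "prime p" and V: "finite V" "B \<subseteq> V" and x0: "x0 \<in> B" "\<not> int p dvd c x0"
  shows "card {\<phi> \<in> (V \<times> {..<d}) \<rightarrow>\<^sub>E residues_below p. vanishes p d \<phi> B c} \<le> p ^ ((card V - 1) * d)"
    (is "card ?R \<le> _")
proof -
  let ?W = "(V - {x0}) \<times> {..<d}"
  have "inj_on (\<lambda>\<phi>. restrict \<phi> ?W) ?R"
  proof (rule inj_onI)
    fix \<phi> \<theta> assume \<phi>: "\<phi> \<in> ?R" and \<theta>: "\<theta> \<in> ?R" and eq: "restrict \<phi> ?W = restrict \<theta> ?W"
    have off: "\<phi> (x, i) = \<theta> (x, i)" if "x \<in> V - {x0}" "i < d" for x i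
      using fun_cong[OF eq, of "(x, i)"] that by simp
    have on: "\<phi> (x0, i) = \<theta> (x0, i)" if i: "i < d" for i
    proof (rule residues_below_eqI)
      have "int p dvd (\<Sum>x\<in>B. c x * \<phi> (x, i)) - (\<Sum>x\<in>B. c x * \<theta> (x, i))"
        using \<phi> \<theta> i by (auto simp: vanishes_def)
      also have "\<dots> = (\<Sum>x\<in>B. c x * (\<phi> (x, i) - \<theta> (x, i)))"
        by (simp add: sum_subtractf algebra_simps)
      also have "\<dots> = (\<Sum>x\<in>{x0}. c x * (\<phi> (x, i) - \<theta> (x, i)))"
        using V x0 off i by (intro sum.mono_neutral_right) (auto intro: finite_subset)
      finally show "int p dvd \<phi> (x0, i) - \<theta> (x0, i)"
        using p x0 by (simp add: prime_dvd_mult_iff)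
    qed (use \<phi> \<theta> i x0 V in \<open>auto simp: PiE_mem\<close>)
    show "\<phi> = \<theta>"
    proof (rule PiE_ext)
      show "\<phi> \<in> (V \<times> {..<d}) \<rightarrow>\<^sub>E residues_below p" "\<theta> \<in> (V \<times> {..<d}) \<rightarrow>\<^sub>E residues_below p"
        using \<phi> \<theta> by auto
      fix y assume "y \<in> V \<times> {..<d}"
      then show "\<phi> y = \<theta> y" using off on by (cases y) (metis Diff_iff SigmaE2 lessThan_iff singletonD)
    qed
  qed
  moreover have "(\<lambda>\<phi>. restrict \<phi> ?W) ` ?R \<subseteq> ?W \<rightarrow>\<^sub>E residues_below p"
  proof (rule image_subsetI)
    fix \<phi> assume "\<phi> \<in> ?R"
    then show "restrict \<phi> ?W \<in> ?W \<rightarrow>\<^sub>E residues_below p"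
      unfolding restrict_PiE_iff by (blast intro: PiE_mem)
  qed
  moreover have "finite (?W \<rightarrow>\<^sub>E residues_below p)" using V by (intro finite_PiE) auto
  ultimately have "card ?R \<le> card (?W \<rightarrow>\<^sub>E residues_below p)" by (rule card_inj_on_le)
  also have "\<dots> = p ^ ((card V - 1) * d)"
    using V x0 by (subst card_PiE) (auto simp: card_cartesian_product)
  finally show ?thesis .
qed

text \<open>Every dependence comes with its \<open>p - 1\<close> nonzero multiples, hence the factor \<open>p - 1\<close>.\<close>

lemma card_dependent_labellings:
  assumes p: "prime p" and V: "finite V" "B \<subseteq> V" and B: "card B = d" "d > 0"
  shows "(p - 1) * card {\<phi> \<in> (V \<times> {..<d}) \<rightarrow>\<^sub>E residues_below p. \<not> indep p d \<phi> B} \<le> p ^ (card V * d)"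
proof -
  define \<Phi> where "\<Phi> = (V \<times> {..<d}) \<rightarrow>\<^sub>E residues_below p"
  define Co where "Co = {c \<in> B \<rightarrow>\<^sub>E residues_below p. \<exists>x\<in>B. \<not> int p dvd c x}"
  define Dep where "Dep = {\<phi> \<in> \<Phi>. \<not> indep p d \<phi> B}"
  have p1: "p > 1" using p by (rule prime_gt_1_nat)
  have finB: "finite B" using V by (auto intro: finite_subset)
  have fin: "finite \<Phi>" "finite (B \<rightarrow>\<^sub>E residues_below p)" unfolding \<Phi>_def using V finB by (auto intro!: finite_PiE)
  then have finCo: "finite Co" "finite Dep" by (auto simp: Co_def Dep_def)
  have many: "p - 1 \<le> card {c \<in> Co. vanishes p d \<phi> B c}" if "\<phi> \<in> Dep" for \<phi>
  proof -
    obtain c x0 where c: "vanishes p d \<phi> B c" "x0 \<in> B" "\<not> int p dvd c x0"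
      using \<open>\<phi> \<in> Dep\<close> by (auto simp: Dep_def indep_def)
    \<comment> \<open>The multiples of \<open>c\<close> are reduced modulo \<open>p\<close> to
      become elements of the finite set \<open>Co\<close>; they are distinct since
      \<open>c x0\<close> is invertible.\<close>
    define h where "h k = restrict (\<lambda>x. (int k * c x) mod int p) B" for k
    have nd: "\<not> int p dvd int k" if "k \<in> {1..<p}" for k
      using that by (auto dest: zdvd_imp_le)
    have "inj_on h {1..<p}"
    proof (rule inj_onI)
      fix k l assume kl: "k \<in> {1..<p}" "l \<in> {1..<p}" "h k = h l"
      have "(int k * c x0) mod int p = (int l * c x0) mod int p"
        using fun_cong[OF kl(3), of x0] c by (simp add: h_def)
      then have "int p dvd (int k - int l) * c x0" by (simp add: mod_eq_dvd_iff algebra_simps)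
      then have "int p dvd int k - int l" using p c by (simp add: prime_dvd_mult_iff)
      then have "int k = int l" using kl by (intro residues_below_eqI[of _ p]) auto
      then show "k = l" by simp
    qed
    moreover have "h ` {1..<p} \<subseteq> {c \<in> Co. vanishes p d \<phi> B c}"
    proof
      fix e assume "e \<in> h ` {1..<p}"
      then obtain k where k: "k \<in> {1..<p}" "e = h k" by blast
      have "\<not> int p dvd int k * c x0" using nd[OF k(1)] c p by (simp add: prime_dvd_mult_iff)
      then have "\<not> int p dvd e x0" using c by (simp add: k h_def dvd_mod_iff)
      then have "e \<in> Co" using c p1 unfolding Co_def by (auto simp: k h_def)
      moreover have "vanishes p d \<phi> B e"
        unfolding vanishes_def
      proof (intro allI impI)
        fix i assume i: "i < d"
        have "(\<Sum>x\<in>B. e x * \<phi> (x, i)) mod int p = (\<Sum>x\<in>B. (int k * c x * \<phi> (x, i)) mod int p) mod int p"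
          by (subst mod_sum_eq [symmetric]) (simp add: k h_def mod_mult_left_eq)
        also have "\<dots> = (int k * (\<Sum>x\<in>B. c x * \<phi> (x, i))) mod int p"
          by (simp add: mod_sum_eq sum_distrib_left mult.assoc)
        also have "\<dots> = 0" using c(1) i by (auto simp: vanishes_def)
        finally show "int p dvd (\<Sum>x\<in>B. e x * \<phi> (x, i))" by presburger
      qed
      ultimately show "e \<in> {c \<in> Co. vanishes p d \<phi> B c}" by simp
    qed
    ultimately have "card {1..<p} \<le> card {c \<in> Co. vanishes p d \<phi> B c}"
      using finCo by (intro card_inj_on_le) auto
    then show ?thesis by simp
  qed
  \<comment> \<open>Pairs of a labelling and a dependence are counted in two ways. The number
    \<open>d\<close> of coordinates equals \<open>card B\<close>, so the at most
    \<open>p ^ d\<close> coefficient vectors exactly make up for the factor \<open>p ^ d\<close>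
    lost with each vanishing condition.\<close>
  have "(p - 1) * card Dep = (\<Sum>\<phi>\<in>Dep. p - 1)" by simp
  also have "\<dots> \<le> (\<Sum>\<phi>\<in>Dep. card {c \<in> Co. vanishes p d \<phi> B c})" by (intro sum_mono many)
  also have "\<dots> \<le> (\<Sum>\<phi>\<in>\<Phi>. card {c \<in> Co. vanishes p d \<phi> B c})"
    using fin by (intro sum_mono2) (auto simp: Dep_def)
  also have "\<dots> = (\<Sum>\<phi>\<in>\<Phi>. \<Sum>c\<in>Co. if vanishes p d \<phi> B c then 1 else 0)"
    using finCo by (simp add: sum.inter_filter [symmetric])
  also have "\<dots> = (\<Sum>c\<in>Co. \<Sum>\<phi>\<in>\<Phi>. if vanishes p d \<phi> B c then 1 else 0)" by (rule sum.swap)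
  also have "\<dots> = (\<Sum>c\<in>Co. card {\<phi> \<in> \<Phi>. vanishes p d \<phi> B c})"
    using fin by (simp add: sum.inter_filter [symmetric])
  also have "\<dots> \<le> (\<Sum>c\<in>Co. p ^ ((card V - 1) * d))"
  proof (rule sum_mono)
    fix c assume "c \<in> Co"
    then obtain x where "x \<in> B" "\<not> int p dvd c x" by (auto simp: Co_def)
    then show "card {\<phi> \<in> \<Phi>. vanishes p d \<phi> B c} \<le> p ^ ((card V - 1) * d)"
      unfolding \<Phi>_def by (rule card_vanishing_labellings[OF p V])
  qed
  also have "\<dots> = card Co * p ^ ((card V - 1) * d)" by simp
  also have "\<dots> \<le> p ^ d * p ^ ((card V - 1) * d)"
  proof (rule mult_right_mono)
    have "card Co \<le> card (B \<rightarrow>\<^sub>E residues_below p)" using fin by (intro card_mono) (auto simp: Co_def)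
    then show "card Co \<le> p ^ d" using finB B by (simp add: card_PiE)
  qed simp
  also have "\<dots> = p ^ (card V * d)"
  proof -
    have "card B \<le> card V" using V by (intro card_mono)
    then have "card V * d = d + (card V - 1) * d" using B by (cases "card V") auto
    then show ?thesis by (simp add: power_add)
  qed
  finally show ?thesis unfolding Dep_def \<Phi>_def .
qed

text \<open>First moment: if every labelling had too many dependent sets, summing over labellings
  would contradict \<open>card_dependent_labellings\<close> for some set.\<close>

lemma labelling_with_few_dependent_sets:
  assumes p: "prime p" and V: "finite V" and d: "d > 0"
  obtains \<phi> where "(p - 1) * card {B. B \<subseteq> V \<and> card B = d \<and> \<not> indep p d \<phi> B} \<le> card V choose d"
proof -
  define \<Phi> where "\<Phi> = (V \<times> {..<d}) \<rightarrow>\<^sub>E residues_below p"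
  define L where "L = {B. B \<subseteq> V \<and> card B = d}"
  have p0: "p > 0" using p by (rule prime_gt_0_nat)
  have fin: "finite \<Phi>" "finite L" unfolding \<Phi>_def L_def using V by (auto intro!: finite_PiE)
  have card\<Phi>: "card \<Phi> = p ^ (card V * d)"
    unfolding \<Phi>_def using V by (subst card_PiE) (auto simp: card_cartesian_product)
  then have "\<Phi> \<noteq> {}" using p0 by auto
  have "\<exists>\<phi>\<in>\<Phi>. (p - 1) * card {B \<in> L. \<not> indep p d \<phi> B} \<le> card L"
  proof (rule ccontr)
    assume "\<not> ?thesis"
    then have "(\<Sum>\<phi>\<in>\<Phi>. card L) < (\<Sum>\<phi>\<in>\<Phi>. (p - 1) * card {B \<in> L. \<not> indep p d \<phi> B})"
      using fin \<open>\<Phi> \<noteq> {}\<close> by (intro sum_strict_mono) auto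
    also have "\<dots> = (\<Sum>\<phi>\<in>\<Phi>. \<Sum>B\<in>L. if \<not> indep p d \<phi> B then p - 1 else 0)"
      using fin by (simp add: sum.inter_filter [symmetric] mult.commute)
    also have "\<dots> = (\<Sum>B\<in>L. \<Sum>\<phi>\<in>\<Phi>. if \<not> indep p d \<phi> B then p - 1 else 0)" by (rule sum.swap)
    also have "\<dots> = (\<Sum>B\<in>L. (p - 1) * card {\<phi> \<in> \<Phi>. \<not> indep p d \<phi> B})"
      using fin by (simp add: sum.inter_filter [symmetric] mult.commute)
    also have "\<dots> \<le> (\<Sum>B\<in>L. p ^ (card V * d))"
      unfolding \<Phi>_def by (intro sum_mono card_dependent_labellings[OF p V]) (auto simp: L_def d)
    also have "\<dots> = (\<Sum>\<phi>\<in>\<Phi>. card L)" by (simp add: card\<Phi>)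
    finally show False by simp
  qed
  then obtain \<phi> where "(p - 1) * card {B \<in> L. \<not> indep p d \<phi> B} \<le> card L" by blast
  moreover have "{B \<in> L. \<not> indep p d \<phi> B} = {B. B \<subseteq> V \<and> card B = d \<and> \<not> indep p d \<phi> B}"
    by (auto simp: L_def)
  ultimately show ?thesis using that V by (simp add: L_def n_subsets)
qed

text \<open>The vectors of \<open>X\<close> are pairwise non-proportional modulo the span of \<open>S\<close>, which has codimension two,
  so there are at most \<open>p + 1\<close> of them.\<close>

lemma card_independent_pairs_le:
  assumes p: "prime p" and fin: "finite S" "finite X" and disj: "S \<inter> X = {}"
    and S: "card S + 2 = d" and X: "card X \<ge> 2"
    and ind: "\<And>x y. x \<in> X \<Longrightarrow> y \<in> X \<Longrightarrow> x \<noteq> y \<Longrightarrow> indep p d \<phi> (insert x (insert y S))"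
  shows "card X \<le> p + 1"
proof -
  have p1: "p > 1" using p by (rule prime_gt_1_nat)
  obtain x1 where x1: "x1 \<in> X" using X by fastforce
  define U where "U = S \<rightarrow>\<^sub>E residues_below p"
  \<comment> \<open>The scalar multiples of the vectors of \<open>X\<close>, with the zero multiple
    represented only once, by \<open>x1\<close>; otherwise \<open>h\<close> would not be
    injective.\<close>
  define D where "D = insert (x1, 0) (X \<times> {1..<int p})"
  define h :: "(nat \<times> int) \<times> (nat \<Rightarrow> int) \<Rightarrow> nat \<Rightarrow> int" where
    "h = (\<lambda>((x, a), u). restrict (\<lambda>i. (a * \<phi> (x, i) + (\<Sum>s\<in>S. u s * \<phi> (s, i))) mod int p) {..<d})"
  have D: "a \<in> residues_below p" "x \<in> X" "a = 0 \<Longrightarrow> x = x1" if "(x, a) \<in> D" for x a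
    using that p1 x1 by (auto simp: D_def)
  have "inj_on h (D \<times> U)"
  proof (rule inj_onI)
    fix z z' assume z: "z \<in> D \<times> U" "z' \<in> D \<times> U" "h z = h z'"
    obtain x a u y b w where zz: "z = ((x, a), u)" "z' = ((y, b), w)" by (metis prod.exhaust)
    have xa: "(x, a) \<in> D" "u \<in> U" and yb: "(y, b) \<in> D" "w \<in> U" using z zz by auto
    have U: "u s \<in> residues_below p" "w s \<in> residues_below p" if "s \<in> S" for s
      using xa yb that by (auto simp: U_def dest: PiE_mem)
    have rel: "int p dvd (a * \<phi> (x, i) - b * \<phi> (y, i)) + (\<Sum>s\<in>S. (u s - w s) * \<phi> (s, i))" if "i < d" for i
    proof -
      have "(a * \<phi> (x, i) + (\<Sum>s\<in>S. u s * \<phi> (s, i))) mod int p = (b * \<phi> (y, i) + (\<Sum>s\<in>S. w s * \<phi> (s, i))) mod int p"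
        using fun_cong[OF z(3), of i] that by (simp add: h_def zz)
      then have "int p dvd (a * \<phi> (x, i) + (\<Sum>s\<in>S. u s * \<phi> (s, i))) - (b * \<phi> (y, i) + (\<Sum>s\<in>S. w s * \<phi> (s, i)))"
        by (simp add: mod_eq_dvd_iff)
      also have "\<dots> = (a * \<phi> (x, i) - b * \<phi> (y, i)) + (\<Sum>s\<in>S. (u s - w s) * \<phi> (s, i))"
        by (simp add: algebra_simps sum_subtractf)
      finally show ?thesis .
    qed
    have xS: "x \<notin> S" "y \<notin> S" using D(2)[OF xa(1)] D(2)[OF yb(1)] disj by auto
    \<comment> \<open>The coefficients on \<open>X\<close> are rewritten as \<open>e\<close> on two
      distinct points, since independence is given for pairs only. This serves both
      \<open>x = y\<close>, with an auxiliary second point, and \<open>x \<noteq> y\<close>.\<close>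
    have key: "(\<forall>s\<in>S. int p dvd u s - w s) \<and> int p dvd e x' \<and> int p dvd e y'"
      if xy: "x' \<in> X" "y' \<in> X" "x' \<noteq> y'"
        and e: "\<And>i. e x' * \<phi> (x', i) + e y' * \<phi> (y', i) = a * \<phi> (x, i) - b * \<phi> (y, i)" for e x' y'
    proof -
      define c where "c s = (if s \<in> S then u s - w s else e s)" for s
      have nS: "x' \<notin> S" "y' \<notin> S" using xy disj by auto
      have "vanishes p d \<phi> (insert x' (insert y' S)) c"
        unfolding vanishes_def
      proof (intro allI impI)
        fix i assume "i < d"
        have "(\<Sum>s\<in>insert x' (insert y' S). c s * \<phi> (s, i)) =
            (e x' * \<phi> (x', i) + e y' * \<phi> (y', i)) + (\<Sum>s\<in>S. (u s - w s) * \<phi> (s, i))"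
          using nS xy fin by (simp add: c_def)
        then show "int p dvd (\<Sum>s\<in>insert x' (insert y' S). c s * \<phi> (s, i))"
          using rel[OF \<open>i < d\<close>] e by simp
      qed
      then have "\<forall>s\<in>insert x' (insert y' S). int p dvd c s"
        using ind[OF xy] unfolding indep_def by blast
      then show ?thesis using nS by (auto simp: c_def)
    qed
    have ua: "(\<forall>s\<in>S. int p dvd u s - w s) \<and> x = y \<and> a = b"
    proof (cases "x = y")
      case True
      have "X - {x} \<noteq> {}" using X fin by (metis card_Diff_singleton_if card.empty diff_le_self
            Suc_1 Suc_le_eq diff_is_0_eq not_less One_nat_def)
      then obtain z where z: "z \<in> X" "z \<noteq> x" by blast
      have "(\<forall>s\<in>S. int p dvd u s - w s) \<and> int p dvd ((\<lambda>_. 0)(x := a - b)) x \<and> int p dvd ((\<lambda>_. 0)(x := a - b)) z"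
        by (rule key) (use z D(2)[OF xa(1)] True in \<open>auto simp: algebra_simps\<close>)
      then show ?thesis using True residues_below_eqI[OF D(1)[OF xa(1)] D(1)[OF yb(1)]] by simp
    next
      case False
      have "(\<forall>s\<in>S. int p dvd u s - w s) \<and> int p dvd ((\<lambda>_. - b)(x := a)) x \<and> int p dvd ((\<lambda>_. - b)(x := a)) y"
        by (rule key) (use D(2)[OF xa(1)] D(2)[OF yb(1)] False in auto)
      then have "int p dvd a - 0" "int p dvd b - 0" using False by auto
      then have "a = 0" "b = 0"
        using D(1)[OF xa(1)] D(1)[OF yb(1)] p1 by (auto intro!: residues_below_eqI[of _ p])
      then show ?thesis using D(3)[OF xa(1)] D(3)[OF yb(1)] False by simp
    qed
    have "u = w"
      using xa(2) yb(2) U ua unfolding U_def by (intro PiE_ext[of u S _ w]) (auto intro!: residues_below_eqI[of _ p])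
    then show "z = z'" using ua zz by simp
  qed
  moreover have "h ` (D \<times> U) \<subseteq> {..<d} \<rightarrow>\<^sub>E residues_below p"
  proof (rule image_subsetI)
    fix z assume "z \<in> D \<times> U"
    obtain x a u where z: "z = ((x, a), u)" by (metis prod.exhaust)
    show "h z \<in> {..<d} \<rightarrow>\<^sub>E residues_below p"
      unfolding h_def z prod.case restrict_PiE_iff using p1 by simp
  qed
  ultimately have "card (D \<times> U) \<le> card ({..<d} \<rightarrow>\<^sub>E residues_below p)"
    by (intro card_inj_on_le) (auto intro!: finite_PiE)
  also have "\<dots> = p ^ 2 * p ^ card S" by (simp add: card_PiE S [symmetric] power_add power2_eq_square)
  also have "card (D \<times> U) = (1 + card X * (p - 1)) * p ^ card S"
  proof -
    have "card D = 1 + card X * (p - 1)"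
      unfolding D_def using fin p1 by (subst card_insert_disjoint) (auto simp: card_cartesian_product nat_diff_distrib)
    moreover have "card U = p ^ card S" unfolding U_def using fin by (simp add: card_PiE)
    ultimately show ?thesis by (simp add: card_cartesian_product)
  qed
  finally have "(1 + card X * (p - 1)) * p ^ card S \<le> p ^ 2 * p ^ card S" .
  \<comment> \<open>The nonzero multiples of the vectors of \<open>X\<close> and the zero vector are
    distinct elements of a plane of \<open>p ^ 2\<close> points, and p^2 = 1 + (p + 1) (p -
    1).\<close>
  then have "1 + card X * (p - 1) \<le> p ^ 2" by (rule mult_right_le_imp_le) (use p1 in simp)
  also have "\<dots> = 1 + (p + 1) * (p - 1)" using p1 by (cases p) (auto simp: power2_eq_square algebra_simps)
  finally have "card X * (p - 1) \<le> (p + 1) * (p - 1)" by (simp only: add_le_cancel_left)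
  then show ?thesis by (rule mult_right_le_imp_le) (use p1 in simp)
qed

section \<open>The posets of complete graphs\<close>

lemma fst_P_K: "fst (P_K t) = {1..t} <+> complete_edges {1..t}"
  by (simp add: P_K_def incidence_poset_def)

lemma pair_in_complete_edges: "i \<in> V \<Longrightarrow> j \<in> V \<Longrightarrow> i \<noteq> j \<Longrightarrow> {i, j} \<in> complete_edges V"
  by (simp add: complete_edges_def)

text \<open>Vertices and edges are different elements of the poset, so injectivity of the copy makes
  the inclusions strict.\<close>

lemma weak_copy_P_K_E:
  assumes "weak_copy (P_K t) G"
  obtains A E where "A ` {1..t} \<subseteq> G" "E ` complete_edges {1..t} \<subseteq> G"
    "inj_on A {1..t}" "inj_on E (complete_edges {1..t})"
    "\<And>v e. v \<in> {1..t} \<Longrightarrow> e \<in> complete_edges {1..t} \<Longrightarrow> v \<in> e \<Longrightarrow> A v \<subset> E e"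
proof -
  obtain \<psi> where bij: "bij_betw \<psi> (fst (P_K t)) G"
    and mono: "\<forall>p\<in>fst (P_K t). \<forall>q\<in>fst (P_K t). (p, q) \<in> snd (P_K t) \<longrightarrow> \<psi> p \<subseteq> \<psi> q"
    using assms unfolding weak_copy_def by blast
  have inj: "inj_on \<psi> ({1..t} <+> complete_edges {1..t})" and img: "\<psi> ` ({1..t} <+> complete_edges {1..t}) = G"
    using bij by (auto simp: bij_betw_def fst_P_K)
  show ?thesis
  proof (rule that[of "\<lambda>v. \<psi> (Inl v)" "\<lambda>e. \<psi> (Inr e)"])
    show "(\<lambda>v. \<psi> (Inl v)) ` {1..t} \<subseteq> G" "(\<lambda>e. \<psi> (Inr e)) ` complete_edges {1..t} \<subseteq> G"
      using img by blast+
    show "inj_on (\<lambda>v. \<psi> (Inl v)) {1..t}"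
      by (rule inj_onI) (use inj_onD[OF inj] in blast)
    show "inj_on (\<lambda>e. \<psi> (Inr e)) (complete_edges {1..t})"
      by (rule inj_onI) (use inj_onD[OF inj] in blast)
    fix v e assume ve: "v \<in> {1..t}" "e \<in> complete_edges {1..t}" "v \<in> e"
    have "(Inl v, Inr e) \<in> snd (P_K t)" using ve by (auto simp: P_K_def incidence_poset_def)
    moreover have "Inl v \<in> fst (P_K t)" "Inr e \<in> fst (P_K t)" unfolding fst_P_K using ve by blast+
    ultimately have "\<psi> (Inl v) \<subseteq> \<psi> (Inr e)" using mono by blast
    moreover have "\<psi> (Inl v) \<noteq> \<psi> (Inr e)"
      using inj_onD[OF inj, of "Inl v" "Inr e"] ve by blast
    ultimately show "\<psi> (Inl v) \<subset> \<psi> (Inr e)" by blast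
  qed
qed

lemma layers_free_P_K_1:
  assumes "t \<ge> 2"
  shows "layers_free (P_K t) 1"
  unfolding layers_free_def weak_free_def
proof (intro allI impI notI)
  fix n s assume "\<exists>G\<subseteq>(\<Union>i\<in>{s..<s + 1}. layer n i). weak_copy (P_K t) G"
  then obtain G where G: "G \<subseteq> layer n s" "weak_copy (P_K t) G" by auto
  obtain A E where AE: "A ` {1..t} \<subseteq> G" "E ` complete_edges {1..t} \<subseteq> G"
    "\<And>v e. v \<in> {1..t} \<Longrightarrow> e \<in> complete_edges {1..t} \<Longrightarrow> v \<in> e \<Longrightarrow> A v \<subset> E e"
    using weak_copy_P_K_E[OF G(2)] by metis
  have e: "{1, 2} \<in> complete_edges {1..t}" using assms by (intro pair_in_complete_edges) auto
  have "A 1 \<subset> E {1, 2}" using AE(3)[of 1 "{1, 2}"] e assms by auto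
  moreover have "1 \<in> {1..t}" using assms by simp
  then have "A 1 \<in> layer n s" "E {1, 2} \<in> layer n s" using AE(1,2) G(1) e by blast+
  ultimately show False using psubset_card_mono[of "E {1, 2}" "A 1"]
    by (auto simp: layer_def finite_subset)
qed

lemma not_layers_free_P_K:
  assumes "t \<ge> 2" "k \<ge> 2"
  shows "\<not> layers_free (P_K t) k"
proof
  assume "layers_free (P_K t) k"
  \<comment> \<open>In the cube of dimension \<open>t + k\<close> there is room for the points
    \<open>1\<close> to \<open>t\<close> and for the layers \<open>1\<close> to \<open>k\<close>;
    singletons and pairs form a copy in the first two of these layers.\<close>
  then have free: "weak_free (P_K t) (\<Union>i\<in>{1..<1 + k}. layer (t + k) i)"
  proof -
    have "1 + k \<le> (t + k) + 1" by simp
    with \<open>layers_free (P_K t) k\<close> show ?thesis unfolding layers_free_def by blast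
  qed
  define \<psi> :: "nat + nat set \<Rightarrow> nat set" where "\<psi> = case_sum (\<lambda>v. {v}) (\<lambda>e. e)"
  have card_e: "card e = 2" "e \<subseteq> {1..t}" if "e \<in> complete_edges {1..t}" for e
    using that by (auto simp: complete_edges_def)
  have "inj_on \<psi> (fst (P_K t))"
    unfolding fst_P_K
  proof (rule inj_onI)
    fix p q :: "nat + nat set"
    assume "p \<in> {1..t} <+> complete_edges {1..t}" "q \<in> {1..t} <+> complete_edges {1..t}" "\<psi> p = \<psi> q"
    then show "p = q" by (cases p; cases q) (auto simp: \<psi>_def complete_edges_def)
  qed
  then have "weak_copy (P_K t) (\<psi> ` fst (P_K t))"
    unfolding weak_copy_def
    by (intro exI[of _ \<psi>] conjI) (auto simp: bij_betw_def P_K_def incidence_poset_def \<psi>_def)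
  moreover have "\<psi> ` fst (P_K t) \<subseteq> (\<Union>i\<in>{1..<1 + k}. layer (t + k) i)"
  proof (rule image_subsetI)
    fix p assume "p \<in> fst (P_K t)"
    then consider v where "p = Inl v" "v \<in> {1..t}" | e where "p = Inr e" "e \<in> complete_edges {1..t}"
      unfolding fst_P_K by blast
    then show "\<psi> p \<in> (\<Union>i\<in>{1..<1 + k}. layer (t + k) i)"
    proof cases
      case 1
      then have "\<psi> p \<in> layer (t + k) 1" by (auto simp: \<psi>_def layer_def)
      then show ?thesis using assms by (intro UN_I[of 1]) auto
    next
      case 2
      then have "\<psi> p \<in> layer (t + k) 2" using card_e[of e] by (auto simp: \<psi>_def layer_def)
      then show ?thesis using assms by (intro UN_I[of 2]) auto
    qed
  qed
  ultimately show False using free unfolding weak_free_def by blast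
qed

lemma e_poset_P_K:
  assumes "t \<ge> 2"
  shows "e_poset (P_K t) = 1"
  unfolding e_poset_def
proof (rule Greatest_equality)
  show "layers_free (P_K t) 1" by (rule layers_free_P_K_1[OF assms])
  show "k \<le> 1" if "layers_free (P_K t) k" for k
    using that not_layers_free_P_K[OF assms, of k] by (cases "k \<le> 1") auto
qed

text \<open>A copy of \<open>P_K t\<close> in two consecutive layers is a sunflower: its lower sets are \<open>S \<union> {x}\<close>, \<open>x \<in> X\<close>,
  and its upper sets are the unions of two of them.\<close>

lemma weak_free_P_K_two_layers:
  assumes p: "prime p" and t: "p + 2 \<le> t" and d: "d > 0"
  shows "weak_free (P_K t) (layer n (d - 1) \<union> {B \<in> layer n d. indep p d \<phi> B})"
  unfolding weak_free_def
proof (intro notI)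
  let ?F = "layer n (d - 1) \<union> {B \<in> layer n d. indep p d \<phi> B}"
  assume "\<exists>G\<subseteq>?F. weak_copy (P_K t) G"
  then obtain G where G: "G \<subseteq> ?F" "weak_copy (P_K t) G" by blast
  obtain A E where img: "A ` {1..t} \<subseteq> G" "E ` complete_edges {1..t} \<subseteq> G"
    and inj: "inj_on A {1..t}" "inj_on E (complete_edges {1..t})"
    and sub: "\<And>v e. v \<in> {1..t} \<Longrightarrow> e \<in> complete_edges {1..t} \<Longrightarrow> v \<in> e \<Longrightarrow> A v \<subset> E e"
    using weak_copy_P_K_E[OF G(2)] by metis
  have t4: "t \<ge> 4" using t prime_ge_2_nat[OF p] by simp
  have ed: "{i, j} \<in> complete_edges {1..t}" if "i \<in> {1..t}" "j \<in> {1..t}" "i \<noteq> j" for i j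
    using that by (rule pair_in_complete_edges)
  have fin: "finite X" if "X \<in> ?F" for X
    using that by (auto simp: layer_def intro: finite_subset)
  have level: "card (A i) = d - 1" "card (E {i, j}) = d" "indep p d \<phi> (E {i, j})" "finite (A i)" "finite (E {i, j})"
    if ij: "i \<in> {1..t}" "j \<in> {1..t}" "i \<noteq> j" for i j
  proof -
    have in_F: "A i \<in> ?F" "E {i, j} \<in> ?F" using img G(1) ed[OF ij] ij by blast+
    then show "finite (A i)" "finite (E {i, j})" using fin by blast+
    \<comment> \<open>Strict inclusion leaves only one possibility in two layers: vertices go to the
      lower layer and edges to the upper one, where independence is imposed.\<close>
    have "card (A i) < card (E {i, j})"
      using sub[OF ij(1) ed[OF ij]] \<open>finite (E {i, j})\<close> by (intro psubset_card_mono) auto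
    then show "card (A i) = d - 1" "card (E {i, j}) = d" "indep p d \<phi> (E {i, j})"
      using in_F by (auto simp: layer_def)
  qed
  have union: "A i \<union> A j = E {i, j}" if ij: "i \<in> {1..t}" "j \<in> {1..t}" "i \<noteq> j" for i j
  proof (rule card_seteq)
    show "finite (E {i, j})" by (rule level[OF ij])
    show "A i \<union> A j \<subseteq> E {i, j}" using sub[OF ij(1) ed[OF ij]] sub[OF ij(2) ed[OF ij]] by auto
    have finA: "finite (A i)" "finite (A j)" using level(4)[OF ij] level(4)[of j i] ij by auto
    have "card (A i) = card (A j)" using level(1)[OF ij] level(1)[of j i] ij by auto
    moreover have "A i \<noteq> A j" using inj_onD[OF inj(1), of i j] ij by auto
    ultimately have "\<not> A j \<subseteq> A i" using card_subset_eq[OF finA(1), of "A j"] by metis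
    then have "card (A i) < card (A i \<union> A j)" using finA by (intro psubset_card_mono) auto
    then show "card (E {i, j}) \<le> card (A i \<union> A j)" using level(1,2)[OF ij] by simp
  qed
  have inter: "card (A i \<inter> A j) + 2 = d" if ij: "i \<in> {1..t}" "j \<in> {1..t}" "i \<noteq> j" for i j
  proof -
    have "card (A i) + card (A j) = card (E {i, j}) + card (A i \<inter> A j)"
      using card_Un_Int[of "A i" "A j"] level(4)[OF ij] level(4)[of j i] ij union[OF ij] by auto
    moreover have "card (A j) = d - 1" using level(1)[of j i] ij by auto
    moreover have "A i \<noteq> A j" using inj_onD[OF inj(1), of i j] ij by auto
    \<comment> \<open>For \<open>d = 1\<close> both sets would be empty, contrary to their being
      different.\<close>
    then have "d \<noteq> 1" using level[OF ij] level(1,4)[of j i] ij by auto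
    ultimately show ?thesis using level(1,2)[OF ij] d by simp
  qed
  define S where "S = A 1 \<inter> A 2"
  have one_two: "(1::nat) \<in> {1..t}" "(2::nat) \<in> {1..t}" using t4 by auto
  have S: "card S + 2 = d" "finite S"
    using inter[of 1 2] level(4)[of 1 2] one_two by (auto simp: S_def)
  \<comment> \<open>Pairwise unions of size \<open>d\<close> leave two configurations: a sunflower
    with kernel \<open>S\<close>, or several sets inside a common \<open>d\<close>-set. If
    \<open>A j\<close> misses \<open>s\<close>, then \<open>A j = E {1, 2} - {s}\<close>, hence
    \<open>E {1, j} = E {1, 2}\<close>, which injectivity on edges excludes.\<close>
  have SA: "S \<subseteq> A j" if j: "j \<in> {1..t}" for j
  proof (rule ccontr)
    assume "\<not> S \<subseteq> A j"
    then obtain s where s: "s \<in> A 1" "s \<in> A 2" "s \<notin> A j" by (auto simp: S_def)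
    then have j12: "j \<noteq> 1" "j \<noteq> 2" by auto
    have minus: "A i - {s} \<subseteq> A j" if i: "i \<in> {1..t}" "i \<noteq> j" "s \<in> A i" for i
    proof -
      have "A i \<inter> A j = A i - {s}"
      proof (rule card_seteq)
        show "finite (A i - {s})" using level(4)[OF i(1) j i(2)] by simp
        show "A i \<inter> A j \<subseteq> A i - {s}" using s by auto
        show "card (A i - {s}) \<le> card (A i \<inter> A j)"
          using inter[OF i(1) j i(2)] level(1)[OF i(1) j i(2)] i(3) level(4)[OF i(1) j i(2)] by simp
      qed
      then show ?thesis by blast
    qed
    have "E {1, 2} - {s} \<subseteq> A j"
      using minus[of 1] minus[of 2] j12 s one_two union[of 1 2] by auto
    moreover have "card (A j) \<le> card (E {1, 2} - {s})"
    proof -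
      have "s \<in> E {1, 2}" using union[of 1 2] s one_two by auto
      then have "card (E {1, 2} - {s}) = card (E {1, 2}) - 1" by (rule card_Diff_singleton)
      moreover have "card (E {1, 2}) = d" by (rule level(2)) (use one_two in auto)
      moreover have "card (A j) = d - 1" by (rule level(1)[of j 1]) (use j j12 one_two in auto)
      ultimately show ?thesis by simp
    qed
    ultimately have "E {1, 2} - {s} = A j"
      using level(4)[of j 1] j j12 one_two by (intro card_seteq) auto
    then have "A 1 \<union> A j \<subseteq> E {1, 2}" using union[of 1 2] one_two by auto
    then have "E {1, j} \<subseteq> E {1, 2}" using union[of 1 j] j j12 one_two by auto
    moreover have "card (E {1, 2}) = card (E {1, j})" "finite (E {1, 2})"
      using level(2)[of 1 2] level(2)[of 1 j] level(5)[of 1 2] j j12 one_two by auto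
    ultimately have "E {1, j} = E {1, 2}" using card_subset_eq by metis
    then have "{1, j} = {1, 2}"
      using inj_onD[OF inj(2)] ed[of 1 j] ed[of 1 2] j j12 one_two by auto
    then show False using j12 by (auto simp: doubleton_eq_iff)
  qed
  have "\<exists>x. x \<notin> S \<and> A j = insert x S" if j: "j \<in> {1..t}" for j
  proof -
    obtain i where i: "i \<in> {1..t}" "i \<noteq> j"
      using that[of 1] that[of 2] one_two by (cases "j = 1") auto
    have "card (A j - S) = 1"
      using level(1)[of j i] i j S SA[OF j] by (simp add: card_Diff_subset)
    then obtain x where "A j - S = {x}" by (auto simp: card_1_singleton_iff)
    then show ?thesis using SA[OF j] by blast
  qed
  then obtain x where x: "\<And>j. j \<in> {1..t} \<Longrightarrow> x j \<notin> S \<and> A j = insert (x j) S" by metis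
  have inj_x: "inj_on x {1..t}"
    using inj(1) x unfolding inj_on_def by metis
  have "card (x ` {1..t}) \<le> p + 1"
  proof (rule card_independent_pairs_le[OF p S(2) _ _ S(1)])
    show "S \<inter> x ` {1..t} = {}" using x by auto
    show "card (x ` {1..t}) \<ge> 2" using inj_x t4 by (simp add: card_image)
    fix y z assume yz: "y \<in> x ` {1..t}" "z \<in> x ` {1..t}" "y \<noteq> z"
    then obtain i j where ij: "i \<in> {1..t}" "j \<in> {1..t}" "y = x i" "z = x j" by blast
    then have "i \<noteq> j" using yz by auto
    then have "insert y (insert z S) = E {i, j}"
      using union[of i j] x[of i] x[of j] ij by auto
    then show "indep p d \<phi> (insert y (insert z S))"
      using level(3)[of i j] ij \<open>i \<noteq> j\<close> by simp
  qed simp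
  then show False using t inj_x by (simp add: card_image)
qed

section \<open>The lower bound on the density\<close>

lemma La_P_K_ge:
  assumes p: "prime p" and t: "p + 2 \<le> t" and d: "d > 0"
  shows "real (n choose (d - 1)) + real (n choose d) * (1 - 1 / (real p - 1)) \<le> real (La n (P_K t))"
proof -
  obtain \<phi> where \<phi>: "(p - 1) * card {B. B \<subseteq> {1..n} \<and> card B = d \<and> \<not> indep p d \<phi> B} \<le> n choose d"
    using labelling_with_few_dependent_sets[OF p, of "{1..n}" d] d by auto
  define L where "L = {B \<in> layer n d. indep p d \<phi> B}"
  define Dep where "Dep = {B \<in> layer n d. \<not> indep p d \<phi> B}"
  have p1: "p > 1" using p by (rule prime_gt_1_nat)
  have fin: "finite (layer n k)" and card: "card (layer n k) = n choose k" for k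
    using n_subsets[of "{1..n}" k] by (auto simp: layer_def)
  have "layer n (d - 1) \<inter> L = {}" using d by (auto simp: layer_def L_def)
  then have "card (layer n (d - 1) \<union> L) = (n choose (d - 1)) + card L"
    using fin by (subst card_Un_disjoint) (auto simp: L_def card)
  moreover have "card (layer n (d - 1) \<union> L) \<le> La n (P_K t)"
    by (rule card_le_La) (use weak_free_P_K_two_layers[OF p t d] in \<open>auto simp: L_def layer_def\<close>)
  moreover have "layer n d = L \<union> Dep" "L \<inter> Dep = {}" by (auto simp: L_def Dep_def)
  then have "n choose d = card L + card Dep"
    using fin[of d] card[of d] by (metis card_Un_disjoint finite_Un)
  then have "real (n choose d) = real (card L) + real (card Dep)" by simp
  moreover have "(p - 1) * card Dep \<le> n choose d"
  proof -
    have "Dep = {B. B \<subseteq> {1..n} \<and> card B = d \<and> \<not> indep p d \<phi> B}" by (auto simp: Dep_def layer_def)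
    then show ?thesis using \<phi> by simp
  qed
  then have "real ((p - 1) * card Dep) \<le> real (n choose d)" by (simp only: of_nat_le_iff)
  then have "real (card Dep) \<le> real (n choose d) / (real p - 1)"
    using p1 by (simp add: field_simps of_nat_diff)
  moreover have "real (n choose d) * (1 - 1 / (real p - 1)) = real (n choose d) - real (n choose d) / (real p - 1)"
    by (simp add: right_diff_distrib)
  ultimately show ?thesis by linarith
qed

text \<open>Neighbouring middle layers have the size ratio \<open>d / (n - d + 1)\<close>, which
  tends to 1 for \<open>d = n div 2\<close>, so the full layer \<open>d - 1\<close> contributes 1 in
  the limit.\<close>

lemma pi_lower_P_K_ge:
  assumes p: "prime p" and t: "p + 2 \<le> t"
  shows "ereal (2 - 1 / (real p - 1)) \<le> pi_lower (P_K t)"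
proof -
  define f where "f n = real (n div 2) / (real n - real (n div 2) + 1) + (1 - 1 / (real p - 1))" for n
  have "(\<lambda>n. real (n div 2) / (real n - real (n div 2) + 1)) \<longlonglongrightarrow> 1"
  proof (rule tendsto_sandwich)
    have *: "real n / 2 - 1 / 2 \<le> real (n div 2)" "real (n div 2) \<le> real n / 2" for n
      by (auto simp: field_simps)
    show "\<forall>\<^sub>F n in sequentially. (real n / 2 - 1 / 2) / (real n / 2 + 3 / 2) \<le> real (n div 2) / (real n - real (n div 2) + 1)"
      using eventually_gt_at_top[of 1]
    proof eventually_elim
      case (elim n)
      then show ?case using *[of n] by (intro frac_le) auto
    qed
    show "\<forall>\<^sub>F n in sequentially. real (n div 2) / (real n - real (n div 2) + 1) \<le> 1"
      using *(2) by (intro always_eventually allI) (simp add: field_simps)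
    show "(\<lambda>n. (real n / 2 - 1 / 2) / (real n / 2 + 3 / 2)) \<longlonglongrightarrow> 1" by real_asymp
  qed (rule tendsto_const)
  then have "f \<longlonglongrightarrow> 1 + (1 - 1 / (real p - 1))"
    unfolding f_def by (intro tendsto_intros)
  then have lim: "(\<lambda>n. ereal (f n)) \<longlonglongrightarrow> ereal (2 - 1 / (real p - 1))" by simp
  have "\<forall>\<^sub>F n in sequentially. ereal (f n) \<le> ereal (real (La n (P_K t)) / real (n choose (n div 2)))"
    using eventually_gt_at_top[of 1]
  proof eventually_elim
    case (elim n)
    define d where "d = n div 2"
    have d: "d > 0" "d \<le> n" using elim by (auto simp: d_def)
    have pos: "real (n choose d) > 0" using d by simp
    have "(n choose d) * d = (n choose (d - 1)) * (n - (d - 1))"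
      using binomial_absorb_comp[of n "d - 1"] binomial_absorption[of "d - 1" n] d
      by (cases d) (auto simp: mult_ac)
    then have "real ((n choose d) * d) = real ((n choose (d - 1)) * (n - (d - 1)))" by simp
    then have "real (n choose d) * d = real (n choose (d - 1)) * (real n - real d + 1)"
      using d by (simp add: of_nat_diff)
    then have "real d / (real n - real d + 1) = real (n choose (d - 1)) / real (n choose d)"
      using pos d by (simp add: field_simps)
    then have "f n = (real (n choose (d - 1)) + real (n choose d) * (1 - 1 / (real p - 1))) / real (n choose d)"
      using pos unfolding f_def d_def [symmetric] by (simp add: add_divide_distrib)
    also have "\<dots> \<le> real (La n (P_K t)) / real (n choose d)"
      by (rule divide_right_mono[OF La_P_K_ge[OF p t d(1)]]) simp
    finally show ?case by (simp add: d_def)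
  qed
  then have "liminf (\<lambda>n. ereal (f n)) \<le> pi_lower (P_K t)"
    unfolding pi_lower_def by (rule Liminf_mono)
  moreover have "liminf (\<lambda>n. ereal (f n)) = ereal (2 - 1 / (real p - 1))"
    by (rule lim_imp_Liminf[OF trivial_limit_sequentially lim])
  ultimately show ?thesis by simp
qed

text \<open>With the largest admissible prime \<open>q t\<close>, the error times \<open>t\<close>
  is \<open>t / (q t - 1) - 1\<close>. It tends to 0 because every interval from \<open>x\<close> to
  \<open>(1 + \<delta>) * x\<close> with \<open>x\<close> large contains a prime.\<close>

lemma pi_lower_P_K_asymptotic:
  "\<exists>\<epsilon> :: nat \<Rightarrow> real. \<epsilon> \<in> o(\<lambda>t. 1 / real t) \<and>
    (\<forall>t\<ge>2. ereal (2 - 1 / real t - \<epsilon> t) \<le> pi_lower (P_K t))"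
proof -
  define q where "q t = Max {p. prime p \<and> p + 2 \<le> t}" for t :: nat
  \<comment> \<open>Below 4 no prime is admissible; the value 2 makes the claimed bound negative
    there.\<close>
  define \<epsilon> where "\<epsilon> t = (if t < 4 then 2 else 1 / (real (q t) - 1) - 1 / real t)" for t
  have fin: "finite {p. prime p \<and> p + 2 \<le> t}" for t :: nat
    by (rule finite_subset[of _ "{..t}"]) auto
  have q: "prime (q t)" "q t + 2 \<le> t" if "t \<ge> 4" for t
  proof -
    have "2 \<in> {p. prime p \<and> p + 2 \<le> t}" using that by simp
    then have "{p. prime p \<and> p + 2 \<le> t} \<noteq> {}" by blast
    then have "q t \<in> {p. prime p \<and> p + 2 \<le> t}" unfolding q_def by (intro Max_in fin)
    then show "prime (q t)" "q t + 2 \<le> t" by auto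
  qed
  show ?thesis
  proof (intro exI[of _ \<epsilon>] conjI allI impI)
    show "\<epsilon> \<in> o(\<lambda>t. 1 / real t)"
    proof (rule landau_o.smallI)
      fix c :: real assume c: "c > 0"
      \<comment> \<open>A prime above \<open>x = (t - 2) / (1 + \<delta>)\<close> bounds the ratio
        by \<open>t / (x - 1)\<close>, whose limit \<open>1 + \<delta>\<close> must stay strictly
        below \<open>1 + c\<close>.\<close>
      define \<delta> where "\<delta> = c / 2"
      have \<delta>: "\<delta> > 0" using c by (simp add: \<delta>_def)
      obtain x0 where x0: "\<And>x. x \<ge> x0 \<Longrightarrow> \<exists>p. prime p \<and> x < real p \<and> real p \<le> (1 + \<delta>) * x"
        using prime_in_short_interval[OF \<delta>] by blast
      have "\<forall>\<^sub>F t :: nat in sequentially. real t \<ge> max 4 (2 + (1 + \<delta>) * max x0 0) \<and> (real t - 2) / (1 + \<delta>) - 1 > 0 \<and> 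
          real t / ((real t - 2) / (1 + \<delta>) - 1) < 1 + c"
      proof -
        have "\<forall>\<^sub>F t :: nat in sequentially. (real t - 2) / (1 + \<delta>) - 1 > 0" using \<delta> by real_asymp
        moreover have "(\<lambda>t :: nat. real t / ((real t - 2) / (1 + \<delta>) - 1)) \<longlonglongrightarrow> 1 + \<delta>"
          using \<delta> by real_asymp
        then have "\<forall>\<^sub>F t :: nat in sequentially. real t / ((real t - 2) / (1 + \<delta>) - 1) < 1 + c"
          using c by (intro order_tendstoD) (auto simp: \<delta>_def)
        moreover have "\<forall>\<^sub>F t :: nat in sequentially. real t \<ge> max 4 (2 + (1 + \<delta>) * max x0 0)"
          by (rule eventually_at_top_linorderI[of "nat \<lceil>max 4 (2 + (1 + \<delta>) * max x0 0)\<rceil>"]) linarith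
        ultimately show ?thesis by eventually_elim auto
      qed
      then show "\<forall>\<^sub>F t in sequentially. norm (\<epsilon> t) \<le> c * norm (1 / real t)"
      proof eventually_elim
        case (elim t)
        define x where "x = (real t - 2) / (1 + \<delta>)"
        have t4: "t \<ge> 4" using elim by simp
        have *: "M \<le> (T - 2) / (1 + \<delta>)" if "2 + (1 + \<delta>) * M \<le> T" for M T
          using that \<delta> by (simp add: field_simps)
        have "max 4 (2 + (1 + \<delta>) * max x0 0) \<le> real t" using elim by blast
        then have "2 + (1 + \<delta>) * max x0 0 \<le> real t" by (simp only: max.bounded_iff)
        then have "max x0 0 \<le> x" unfolding x_def by (rule *)
        then obtain p where p: "prime p" "x < real p" "real p \<le> (1 + \<delta>) * x" using x0[of x] by auto
        have "(1 + \<delta>) * x = real t - 2" using \<delta> by (simp add: x_def)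
        then have "p + 2 \<le> t" using p(3) by linarith
        then have "p \<le> q t" unfolding q_def using p(1) by (intro Max_ge fin) auto
        then have qx: "x < real (q t)" using p(2) by linarith
        have x1: "x - 1 > 0" "real t / (x - 1) < 1 + c" using elim by (auto simp: x_def)
        have "real t / (real (q t) - 1) \<le> real t / (x - 1)" using qx x1 by (intro divide_left_mono) auto
        then have "real t / (real (q t) - 1) \<le> 1 + c" using x1 by simp
        moreover have "1 \<le> real t / (real (q t) - 1)" using q(2)[OF t4] qx x1 by (simp add: field_simps)
        moreover have "real t * \<epsilon> t = real t / (real (q t) - 1) - 1"
          using t4 by (simp add: \<epsilon>_def right_diff_distrib)
        ultimately have "\<bar>real t * \<epsilon> t\<bar> \<le> c" by simp
        then have "real t * \<bar>\<epsilon> t\<bar> \<le> c" by (simp add: abs_mult)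
        then show ?case using t4 by (simp add: field_simps)
      qed
    qed
    fix t :: nat assume t: "t \<ge> 2"
    show "ereal (2 - 1 / real t - \<epsilon> t) \<le> pi_lower (P_K t)"
    proof (cases "t < 4")
      case True
      have "(0::ereal) \<le> pi_lower (P_K t)" unfolding pi_lower_def
        by (intro Liminf_bounded always_eventually allI) simp
      then show ?thesis using True t by (intro order_trans[OF _ \<open>0 \<le> pi_lower (P_K t)\<close>]) (simp add: \<epsilon>_def)
    next
      case False
      then show ?thesis using pi_lower_P_K_ge[OF q[of t]] by (simp add: \<epsilon>_def)
    qed
  qed
qed

lemma pi_lower_P_K_tendsto: "(\<lambda>t. pi_lower (P_K t)) \<longlonglongrightarrow> 2"
proof -
  obtain \<epsilon> :: "nat \<Rightarrow> real" where \<epsilon>: "\<epsilon> \<in> o(\<lambda>t. 1 / real t)"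
    "\<And>t. t \<ge> 2 \<Longrightarrow> ereal (2 - 1 / real t - \<epsilon> t) \<le> pi_lower (P_K t)"
    using pi_lower_P_K_asymptotic by blast
  have inv: "(\<lambda>t. 1 / real t) \<longlonglongrightarrow> 0" by real_asymp
  have "\<forall>\<^sub>F t in sequentially. norm (\<epsilon> t) \<le> 1 / real t"
    using landau_o.smallD[OF \<epsilon>(1), of 1] by simp
  then have "\<epsilon> \<longlonglongrightarrow> 0" by (rule Lim_null_comparison[OF _ inv])
  then have "(\<lambda>t. 2 - 1 / real t - \<epsilon> t) \<longlonglongrightarrow> 2 - 0 - 0" by (intro tendsto_intros inv)
  then have "(\<lambda>t. ereal (2 - 1 / real t - \<epsilon> t)) \<longlonglongrightarrow> ereal 2" by simp
  then have lim: "(\<lambda>t. ereal (2 - 1 / real t - \<epsilon> t)) \<longlonglongrightarrow> 2" by simp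
  show ?thesis
  proof (rule tendsto_sandwich[OF _ _ lim tendsto_const])
    show "\<forall>\<^sub>F t in sequentially. ereal (2 - 1 / real t - \<epsilon> t) \<le> pi_lower (P_K t)"
      using eventually_ge_at_top[of 2] by eventually_elim (rule \<epsilon>(2))
    show "\<forall>\<^sub>F t in sequentially. pi_lower (P_K t) \<le> 2"
      using eventually_gt_at_top[of 0] by eventually_elim (rule pi_lower_P_K_le_2)
  qed
qed

section \<open>Renaming the elements of a poset\<close>

lemma weak_copy_image:
  assumes inj: "inj_on f (fst P)" and sub: "snd P \<subseteq> fst P \<times> fst P"
  shows "weak_copy (f ` fst P, map_prod f f ` snd P) G \<longleftrightarrow> weak_copy P G"
proof
  assume "weak_copy (f ` fst P, map_prod f f ` snd P) G"
  then obtain \<psi> where bij: "bij_betw \<psi> (f ` fst P) G"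
    and mono: "\<forall>p\<in>f ` fst P. \<forall>q\<in>f ` fst P. (p, q) \<in> map_prod f f ` snd P \<longrightarrow> \<psi> p \<subseteq> \<psi> q"
    unfolding weak_copy_def by auto
  show "weak_copy P G" unfolding weak_copy_def
  proof (intro exI[of _ "\<psi> \<circ> f"] conjI ballI impI)
    show "bij_betw (\<psi> \<circ> f) (fst P) G"
      by (rule bij_betw_trans[OF inj_on_imp_bij_betw[OF inj] bij])
    show "(\<psi> \<circ> f) p \<subseteq> (\<psi> \<circ> f) q" if "p \<in> fst P" "q \<in> fst P" "(p, q) \<in> snd P" for p q
    proof -
      have "(f p, f q) \<in> map_prod f f ` snd P" using that(3) by (rule map_prod_imageI)
      then show ?thesis using mono that by simp
    qed
  qed
next
  assume "weak_copy P G"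
  then obtain \<psi> where bij: "bij_betw \<psi> (fst P) G"
    and mono: "\<forall>p\<in>fst P. \<forall>q\<in>fst P. (p, q) \<in> snd P \<longrightarrow> \<psi> p \<subseteq> \<psi> q"
    unfolding weak_copy_def by auto
  let ?g = "inv_into (fst P) f"
  show "weak_copy (f ` fst P, map_prod f f ` snd P) G" unfolding weak_copy_def fst_conv snd_conv
  proof (intro exI[of _ "\<psi> \<circ> ?g"] conjI ballI impI)
    show "bij_betw (\<psi> \<circ> ?g) (f ` fst P) G"
      by (rule bij_betw_trans[OF inj_on_imp_bij_betw[OF inj, THEN bij_betw_inv_into] bij])
    show "(\<psi> \<circ> ?g) p \<subseteq> (\<psi> \<circ> ?g) q" if "(p, q) \<in> map_prod f f ` snd P" for p q
    proof -
      obtain a b where ab: "(a, b) \<in> snd P" "p = f a" "q = f b"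
        using \<open>(p, q) \<in> map_prod f f ` snd P\<close> by auto
      then have "a \<in> fst P" "b \<in> fst P" using sub by auto
      then show ?thesis using ab mono by (simp add: inv_into_f_f[OF inj])
    qed
  qed
qed

lemma finite_poset_image:
  assumes inj: "inj_on f (fst P)" and P: "finite_poset P"
  shows "finite_poset (f ` fst P, map_prod f f ` snd P)"
proof -
  have sub: "snd P \<subseteq> fst P \<times> fst P" and refl: "refl_on (fst P) (snd P)"
    and trans: "trans (snd P)" and antisym: "antisym (snd P)"
    using P by (auto simp: finite_poset_def partial_order_on_def preorder_on_def)
  have sub': "map_prod f f ` snd P \<subseteq> f ` fst P \<times> f ` fst P" using sub by auto
  moreover have "refl_on (f ` fst P) (map_prod f f ` snd P)"
    by (rule refl_onI) (use refl in \<open>auto dest: refl_onD\<close>)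
  moreover have "trans (map_prod f f ` snd P)"
  proof (rule transI)
    fix x y z assume "(x, y) \<in> map_prod f f ` snd P" "(y, z) \<in> map_prod f f ` snd P"
    then obtain a b b' c where *: "(a, b) \<in> snd P" "(b', c) \<in> snd P" "x = f a" "y = f b" "y = f b'" "z = f c"
      by auto
    then have "b = b'" using sub inj_onD[OF inj] by auto
    then have "(a, c) \<in> snd P" using * transD[OF trans] by blast
    then show "(x, z) \<in> map_prod f f ` snd P" using * by force
  qed
  moreover have "antisym (map_prod f f ` snd P)"
  proof (rule antisymI)
    fix x y assume "(x, y) \<in> map_prod f f ` snd P" "(y, x) \<in> map_prod f f ` snd P"
    then obtain a b a' b' where *: "(a, b) \<in> snd P" "(b', a') \<in> snd P" "x = f a" "y = f b" "y = f b'" "x = f a'"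
      by auto
    then have "b = b'" "a = a'" using sub inj_onD[OF inj] by auto
    then show "x = y" using * antisymD[OF antisym] by blast
  qed
  ultimately show ?thesis
    using P by (simp add: finite_poset_def partial_order_on_def preorder_on_def)
qed

text \<open>The last claim quantifies over posets on the type \<open>nat\<close>, while
  \<open>P_K t\<close> lives on \<open>nat + nat set\<close>. A finite carrier embeds into
  \<open>nat\<close>, and freeness is invariant under such a renaming.\<close>

lemma finite_poset_iso_nat_poset:
  assumes "finite_poset P"
  obtains Q :: "nat poset" where "finite_poset Q" "e_poset Q = e_poset P" "pi_upper Q = pi_upper P"
proof -
  have "finite (fst P)" using assms by (simp add: finite_poset_def)
  then obtain f :: "_ \<Rightarrow> nat" where inj: "inj_on f (fst P)"
    using finite_imp_inj_to_nat_seg by blast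
  define Q where "Q = (f ` fst P, map_prod f f ` snd P)"
  have sub: "snd P \<subseteq> fst P \<times> fst P" using assms by (simp add: finite_poset_def)
  have free: "weak_free Q F \<longleftrightarrow> weak_free P F" for F :: "nat set set"
    unfolding weak_free_def Q_def weak_copy_image[OF inj sub] ..
  have "finite_poset Q" unfolding Q_def by (rule finite_poset_image[OF inj assms])
  moreover have "e_poset Q = e_poset P" by (simp add: e_poset_def layers_free_def free)
  moreover have "pi_upper Q = pi_upper P" by (simp add: pi_upper_def La_def free)
  ultimately show ?thesis by (rule that)
qed

theorem mainTheorem6:
  shows "(\<forall>t\<ge>2. e_poset (P_K t) = 1) \<and>
    (\<exists>\<epsilon> :: nat \<Rightarrow> real. \<epsilon> \<in> o(\<lambda>t. 1 / real t) \<and>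
       (\<forall>t\<ge>2. pi_lower (P_K t) \<ge> ereal (2 - 1 / real t - \<epsilon> t))) \<and>
    (\<lambda>t. pi_lower (P_K t)) \<longlonglongrightarrow> 2 \<and>
    \<not> (\<exists>c :: real. c < 2 \<and>
        (\<forall>P :: nat poset. finite_poset P \<and> e_poset P = 1 \<longrightarrow> pi_upper P \<le> ereal c))"
proof (intro conjI)
  show "\<forall>t\<ge>2. e_poset (P_K t) = 1" using e_poset_P_K by blast
  show "\<exists>\<epsilon> :: nat \<Rightarrow> real. \<epsilon> \<in> o(\<lambda>t. 1 / real t) \<and>
       (\<forall>t\<ge>2. pi_lower (P_K t) \<ge> ereal (2 - 1 / real t - \<epsilon> t))"
    by (rule pi_lower_P_K_asymptotic)
  show "(\<lambda>t. pi_lower (P_K t)) \<longlonglongrightarrow> 2" by (rule pi_lower_P_K_tendsto)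
  show "\<not> (\<exists>c :: real. c < 2 \<and>
        (\<forall>P :: nat poset. finite_poset P \<and> e_poset P = 1 \<longrightarrow> pi_upper P \<le> ereal c))"
  proof
    assume "\<exists>c :: real. c < 2 \<and>
        (\<forall>P :: nat poset. finite_poset P \<and> e_poset P = 1 \<longrightarrow> pi_upper P \<le> ereal c)"
    then obtain c :: real where c: "c < 2"
      "\<And>P :: nat poset. finite_poset P \<Longrightarrow> e_poset P = 1 \<Longrightarrow> pi_upper P \<le> ereal c" by blast
    have "ereal c < 2" using c(1) by simp
    then have "\<forall>\<^sub>F t in sequentially. ereal c < pi_lower (P_K t) \<and> t \<ge> 2"
      using order_tendstoD(1)[OF pi_lower_P_K_tendsto] eventually_ge_at_top[of 2]
      by (intro eventually_conj)
    then obtain t where t: "ereal c < pi_lower (P_K t)" "t \<ge> 2"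
      by (auto simp: eventually_sequentially)
    have "finite_poset (P_K t)"
      unfolding P_K_def by (rule finite_poset_incidence_poset) (use t in \<open>auto simp: complete_edges_def\<close>)
    then obtain Q :: "nat poset" where Q: "finite_poset Q" "e_poset Q = e_poset (P_K t)" "pi_upper Q = pi_upper (P_K t)"
      by (rule finite_poset_iso_nat_poset)
    have "pi_lower (P_K t) \<le> pi_upper (P_K t)"
      unfolding pi_lower_def pi_upper_def by (rule Liminf_le_Limsup) simp
    also have "\<dots> \<le> ereal c" using c(2)[OF Q(1)] Q(2,3) e_poset_P_K[OF t(2)] by simp
    finally show False using t(1) by simp
  qed
qed

end
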